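(* Let $n\geq 3$. The projective variety $$\mathcal{S}=\mathrm{Proj}\left(\mathbb{C}[x_0,x_1,\ldots,x_n]\Big/\Big\langle x_0^n-\prod_{i=1}^n x_i\Big\rangle\right)$$ is a normal toric variety.
   Context: A toric variety over $\mathbb{C}$ is a (not necessarily normal) irreducible algebraic variety $X$ over $\mathbb{C}$ which contains, for some positive integer $m$, an algebraic torus $G_{m,\mathbb{C}}^{m}=\mathrm{Spec}(\mathbb{C}[t_1^{\pm1},\ldots,t_m^{\pm1}])$ as a Zariski open (hence dense) subset, such that the action of the torus on itself by multiplication extends to an algebraic action of the torus on $X$, i.e. an action given by a morphism $G_{m,\mathbb{C}}^{m}\times X\to X$. (In the symbol $G_{m,\mathbb{C}}$ the subscript $m$ stands for "multiplicative group"; the exponent $m$ is the dimension of the torus.) Normal means that all local rings are integrally closed domains. *)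

theory Defs
  imports
    "HOL-Analysis.Abstract_Topology"
    "HOL-Library.Poly_Mapping"
    "HOL-Algebra.Ideal"
begin

section \<open>Polynomials over the complex numbers\<close>

text \<open>
  A polynomial maps each monomial (finitely supported exponent vector) to its coefficient; the
  product on \<^type>\<open>poly_mapping\<close> is convolution.
\<close>

type_synonym mpoly = "(nat \<Rightarrow>\<^sub>0 nat) \<Rightarrow>\<^sub>0 complex"

definition Var :: "nat \<Rightarrow> mpoly" where
  "Var i = Poly_Mapping.single (Poly_Mapping.single i 1) 1"

definition vars :: "mpoly \<Rightarrow> nat set" where
  "vars p = (\<Union>m\<in>Poly_Mapping.keys p. Poly_Mapping.keys m)"

definition peval :: "mpoly \<Rightarrow> (nat \<Rightarrow> complex) \<Rightarrow> complex" where
  "peval p x = (\<Sum>m\<in>Poly_Mapping.keys p. Poly_Mapping.lookup p m *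
      (\<Prod>i\<in>Poly_Mapping.keys m. x i ^ Poly_Mapping.lookup m i))"

text \<open>The zero polynomial is homogeneous of every degree.\<close>

definition homogeneous :: "nat \<Rightarrow> mpoly \<Rightarrow> bool" where
  "homogeneous d p \<longleftrightarrow>
     (\<forall>m\<in>Poly_Mapping.keys p. (\<Sum>i\<in>Poly_Mapping.keys m. Poly_Mapping.lookup m i) = d)"

text \<open>The ring \<open>\<complex>[x\<^sub>0, \<dots>, x\<^bsub>k-1\<^esub>]\<close> in \<open>k\<close> variables.\<close>

definition mpoly_ring :: "nat \<Rightarrow> mpoly ring" where
  "mpoly_ring k =
     \<lparr>carrier = {p. vars p \<subseteq> {..<k}}, mult = (*), one = 1, zero = 0, add = (+)\<rparr>"

section \<open>Spaces with functions and varieties\<close>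

text \<open>
  Varieties over \<open>\<complex>\<close> are taken in the sense of Serre and Kempf: a set of (closed) points with its
  Zariski topology and the sheaf of regular functions. A function is total on the type of points,
  and \<open>f \<in> regular X U\<close> says that its restriction to \<open>U\<close> is a section over \<open>U\<close>; values
  outside \<open>U\<close> are irrelevant.
\<close>

record 'a fspace =
  zariski :: "'a topology"
  regular :: "'a set \<Rightarrow> ('a \<Rightarrow> complex) set"

abbreviation points :: "'a fspace \<Rightarrow> 'a set" where
  "points X \<equiv> topspace (zariski X)"

definition space_with_functions :: "'a fspace \<Rightarrow> bool" where
  "space_with_functions X \<longleftrightarrow>
     (\<forall>U. openin (zariski X) U \<longrightarrow>
        (\<forall>c. (\<lambda>_. c) \<in> regular X U) \<and>
        (\<forall>f\<in>regular X U. \<forall>g\<in>regular X U.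
            (\<lambda>x. f x + g x) \<in> regular X U \<and> (\<lambda>x. f x * g x) \<in> regular X U) \<and>
        (\<forall>f\<in>regular X U. \<forall>g. (\<forall>x\<in>U. g x = f x) \<longrightarrow> g \<in> regular X U) \<and>
        (\<forall>f\<in>regular X U. \<forall>V. openin (zariski X) V \<and> V \<subseteq> U \<longrightarrow> f \<in> regular X V) \<and>
        (\<forall>f. (\<forall>x\<in>U. \<exists>V. openin (zariski X) V \<and> x \<in> V \<and> V \<subseteq> U \<and> f \<in> regular X V)
            \<longrightarrow> f \<in> regular X U) \<and>
        (\<forall>f\<in>regular X U. openin (zariski X) {x\<in>U. f x \<noteq> 0} \<and>
            (\<lambda>x. 1 / f x) \<in> regular X {x\<in>U. f x \<noteq> 0}))"

definition is_morphism :: "'a fspace \<Rightarrow> 'b fspace \<Rightarrow> ('a \<Rightarrow> 'b) \<Rightarrow> bool" where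
  "is_morphism X Y \<phi> \<longleftrightarrow>
     continuous_map (zariski X) (zariski Y) \<phi> \<and>
     (\<forall>V f. openin (zariski Y) V \<and> f \<in> regular Y V \<longrightarrow>
        (\<lambda>x. f (\<phi> x)) \<in> regular X {x\<in>points X. \<phi> x \<in> V})"

definition is_isomorphism :: "'a fspace \<Rightarrow> 'b fspace \<Rightarrow> ('a \<Rightarrow> 'b) \<Rightarrow> bool" where
  "is_isomorphism X Y \<phi> \<longleftrightarrow>
     is_morphism X Y \<phi> \<and>
     (\<exists>\<psi>. is_morphism Y X \<psi> \<and> (\<forall>x\<in>points X. \<psi> (\<phi> x) = x) \<and> (\<forall>y\<in>points Y. \<phi> (\<psi> y) = y))"

text \<open>Only used for \<open>U\<close> open in \<open>X\<close>.\<close>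

definition open_subspace :: "'a fspace \<Rightarrow> 'a set \<Rightarrow> 'a fspace" where
  "open_subspace X U = \<lparr>zariski = subtopology (zariski X) U, regular = regular X\<rparr>"

text \<open>
  The product of varieties. Its topology is not the product topology: a basis of open sets is
  given by the non-vanishing loci on \<open>U \<times> V\<close> of the functions \<open>\<Sum>i. a\<^sub>i(x) b\<^sub>i(y)\<close> with \<open>a\<^sub>i\<close>
  regular on \<open>U\<close> and \<open>b\<^sub>i\<close> regular on \<open>V\<close>, i.e. of elements of the tensor product, and the
  regular functions are locally quotients of such sums.
\<close>

definition tensor_functions ::
    "'a fspace \<Rightarrow> 'b fspace \<Rightarrow> 'a set \<Rightarrow> 'b set \<Rightarrow> ('a \<times> 'b \<Rightarrow> complex) set" where
  "tensor_functions X Y U V =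
     {\<lambda>(x, y). \<Sum>i<k. a i x * b i y | (k::nat) a b.
        \<forall>i<k. a i \<in> regular X U \<and> b i \<in> regular Y V}"

definition product_topology_fs :: "'a fspace \<Rightarrow> 'b fspace \<Rightarrow> ('a \<times> 'b) topology" where
  "product_topology_fs X Y = topology_generated_by
     {{z \<in> U \<times> V. F z \<noteq> 0} | U V F.
        openin (zariski X) U \<and> openin (zariski Y) V \<and> F \<in> tensor_functions X Y U V}"

definition product_space :: "'a fspace \<Rightarrow> 'b fspace \<Rightarrow> ('a \<times> 'b) fspace" where
  "product_space X Y =
     \<lparr>zariski = product_topology_fs X Y,
      regular = (\<lambda>W. {f. \<forall>z\<in>W. \<exists>W' U V F G.
        openin (product_topology_fs X Y) W' \<and> z \<in> W' \<and> W' \<subseteq> W \<and> W' \<subseteq> U \<times> V \<and>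
        openin (zariski X) U \<and> openin (zariski Y) V \<and>
        F \<in> tensor_functions X Y U V \<and> G \<in> tensor_functions X Y U V \<and>
        (\<forall>w\<in>W'. G w \<noteq> 0 \<and> f w = F w / G w)})\<rparr>"

subsection \<open>Affine varieties\<close>

text \<open>The points of \<open>\<complex>\<^sup>k\<close>, padded with zeros.\<close>

definition affine_points :: "nat \<Rightarrow> (nat \<Rightarrow> complex) set" where
  "affine_points k = {x. \<forall>i\<ge>k. x i = 0}"

definition affine_zeros :: "nat \<Rightarrow> mpoly set \<Rightarrow> (nat \<Rightarrow> complex) set" where
  "affine_zeros k J = {x\<in>affine_points k. \<forall>g\<in>J. peval g x = 0}"

definition affine_topology :: "nat \<Rightarrow> mpoly set \<Rightarrow> (nat \<Rightarrow> complex) topology" where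
  "affine_topology k J = topology_generated_by
     {{x\<in>affine_zeros k J. peval g x \<noteq> 0} | g. g \<in> carrier (mpoly_ring k)}"

definition closed_affine :: "nat \<Rightarrow> mpoly set \<Rightarrow> (nat \<Rightarrow> complex) fspace" where
  "closed_affine k J =
     \<lparr>zariski = affine_topology k J,
      regular = (\<lambda>U. {f. \<forall>x\<in>U. \<exists>W g h.
        openin (affine_topology k J) W \<and> x \<in> W \<and> W \<subseteq> U \<and>
        g \<in> carrier (mpoly_ring k) \<and> h \<in> carrier (mpoly_ring k) \<and>
        (\<forall>y\<in>W. peval h y \<noteq> 0 \<and> f y = peval g y / peval h y)})\<rparr>"

definition affine_variety :: "'a fspace \<Rightarrow> bool" where
  "affine_variety X \<longleftrightarrow>
     (\<exists>k J \<phi>. J \<subseteq> carrier (mpoly_ring k) \<and> is_isomorphism X (closed_affine k J) \<phi>)"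

subsection \<open>Algebraic varieties\<close>

definition separated :: "'a fspace \<Rightarrow> bool" where
  "separated X \<longleftrightarrow> closedin (zariski (product_space X X)) {(x, x) | x. x \<in> points X}"

definition algebraic_variety :: "'a fspace \<Rightarrow> bool" where
  "algebraic_variety X \<longleftrightarrow>
     space_with_functions X \<and>
     (\<exists>\<U>. finite \<U> \<and> \<Union>\<U> = points X \<and>
        (\<forall>U\<in>\<U>. openin (zariski X) U \<and> affine_variety (open_subspace X U))) \<and>
     separated X"

definition irreducible_variety :: "'a fspace \<Rightarrow> bool" where
  "irreducible_variety X \<longleftrightarrow>
     algebraic_variety X \<and> points X \<noteq> {} \<and>
     (\<forall>A B. closedin (zariski X) A \<and> closedin (zariski X) B \<and> A \<union> B = points X \<longrightarrow>
        A = points X \<or> B = points X)"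

subsection \<open>Projective varieties\<close>

text \<open>
  Points of projective space: punctured lines through the origin, i.e. nonzero vectors up to
  nonzero scalars.
\<close>

definition projective_points :: "nat \<Rightarrow> (nat \<Rightarrow> complex) set set" where
  "projective_points N =
     {{\<lambda>i. c * v i | c. c \<noteq> 0} | v. v \<in> affine_points (Suc N) \<and> (\<exists>i. v i \<noteq> 0)}"

definition projective_zeros :: "nat \<Rightarrow> mpoly set \<Rightarrow> (nat \<Rightarrow> complex) set set" where
  "projective_zeros N I = {q\<in>projective_points N. \<forall>g\<in>I. \<forall>v\<in>q. peval g v = 0}"

definition projective_topology :: "nat \<Rightarrow> mpoly set \<Rightarrow> (nat \<Rightarrow> complex) set topology" where
  "projective_topology N I = topology_generated_by
     {{q\<in>projective_zeros N I. \<forall>v\<in>q. peval g v \<noteq> 0} | g.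
        g \<in> carrier (mpoly_ring (Suc N)) \<and> (\<exists>d. homogeneous d g)}"

text \<open>
  The projective variety \<open>Proj (\<complex>[x\<^sub>0, \<dots>, x\<^bsub>N\<^esub>] / I)\<close>, for \<open>I\<close> a homogeneous prime ideal: the
  closed points, with the regular functions given locally by quotients of forms of equal degree.
  This only sees the radical of \<open>I\<close>, so primality of \<open>I\<close> has to be asserted separately.
\<close>

definition Proj_variety :: "nat \<Rightarrow> mpoly set \<Rightarrow> (nat \<Rightarrow> complex) set fspace" where
  "Proj_variety N I =
     \<lparr>zariski = projective_topology N I,
      regular = (\<lambda>U. {f. \<forall>p\<in>U. \<exists>W d g h.
        openin (projective_topology N I) W \<and> p \<in> W \<and> W \<subseteq> U \<and>
        g \<in> carrier (mpoly_ring (Suc N)) \<and> homogeneous d g \<and>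
        h \<in> carrier (mpoly_ring (Suc N)) \<and> homogeneous d h \<and>
        (\<forall>q\<in>W. \<forall>v\<in>q. peval h v \<noteq> 0 \<and> f q = peval g v / peval h v)})\<rparr>"

section \<open>Toric varieties\<close>

text \<open>
  The torus \<open>Spec \<complex>[t\<^sub>0\<^sup>\<plusminus>\<^sup>1, \<dots>, t\<^bsub>m-1\<^esub>\<^sup>\<plusminus>\<^sup>1]\<close>, as the principal open subset of affine \<open>m\<close>-space
  where no coordinate vanishes.
\<close>

definition torus :: "nat \<Rightarrow> (nat \<Rightarrow> complex) fspace" where
  "torus m = open_subspace (closed_affine m {}) {t\<in>affine_points m. \<forall>i<m. t i \<noteq> 0}"

definition torus_one :: "nat \<Rightarrow> nat \<Rightarrow> complex" where
  "torus_one m = (\<lambda>i. if i < m then 1 else 0)"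

definition torus_mult :: "(nat \<Rightarrow> complex) \<Rightarrow> (nat \<Rightarrow> complex) \<Rightarrow> (nat \<Rightarrow> complex)" where
  "torus_mult s t = (\<lambda>i. s i * t i)"

definition algebraic_torus_action ::
    "nat \<Rightarrow> 'a fspace \<Rightarrow> ((nat \<Rightarrow> complex) \<times> 'a \<Rightarrow> 'a) \<Rightarrow> bool" where
  "algebraic_torus_action m X \<alpha> \<longleftrightarrow>
     is_morphism (product_space (torus m) X) X \<alpha> \<and>
     (\<forall>x\<in>points X. \<alpha> (torus_one m, x) = x) \<and>
     (\<forall>s\<in>points (torus m). \<forall>t\<in>points (torus m). \<forall>x\<in>points X.
        \<alpha> (torus_mult s t, x) = \<alpha> (s, \<alpha> (t, x)))"

text \<open>Here \<open>\<iota>\<close> identifies the torus with an open subvariety of \<open>X\<close>.\<close>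

definition toric_variety :: "'a fspace \<Rightarrow> bool" where
  "toric_variety X \<longleftrightarrow>
     irreducible_variety X \<and>
     (\<exists>m U \<iota> \<alpha>. m > 0 \<and> openin (zariski X) U \<and>
        is_isomorphism (torus m) (open_subspace X U) \<iota> \<and>
        algebraic_torus_action m X \<alpha> \<and>
        (\<forall>s\<in>points (torus m). \<forall>t\<in>points (torus m). \<alpha> (s, \<iota> t) = \<iota> (torus_mult s t)))"

section \<open>Normality\<close>

text \<open>
  The class of the fraction \<open>a / b\<close>. The field operations are defined on representatives, the
  union ranging over equal sets.
\<close>

definition fraction ::
    "('a, 'm) ring_scheme \<Rightarrow> 'a \<Rightarrow> 'a \<Rightarrow> ('a \<times> 'a) set" where
  "fraction R a b =
     {(c, d). c \<in> carrier R \<and> d \<in> carrier R - {\<zero>\<^bsub>R\<^esub>} \<and> a \<otimes>\<^bsub>R\<^esub> d = c \<otimes>\<^bsub>R\<^esub> b}"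

definition fraction_field :: "('a, 'm) ring_scheme \<Rightarrow> ('a \<times> 'a) set ring" where
  "fraction_field R =
     \<lparr>carrier = {fraction R a b | a b. a \<in> carrier R \<and> b \<in> carrier R - {\<zero>\<^bsub>R\<^esub>}},
      mult = (\<lambda>A B. \<Union>(a, b)\<in>A. \<Union>(c, d)\<in>B. fraction R (a \<otimes>\<^bsub>R\<^esub> c) (b \<otimes>\<^bsub>R\<^esub> d)),
      one = fraction R \<one>\<^bsub>R\<^esub> \<one>\<^bsub>R\<^esub>,
      zero = fraction R \<zero>\<^bsub>R\<^esub> \<one>\<^bsub>R\<^esub>,
      add = (\<lambda>A B. \<Union>(a, b)\<in>A. \<Union>(c, d)\<in>B.
        fraction R (a \<otimes>\<^bsub>R\<^esub> d \<oplus>\<^bsub>R\<^esub> c \<otimes>\<^bsub>R\<^esub> b) (b \<otimes>\<^bsub>R\<^esub> d))\<rparr>"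

definition embed_fraction :: "('a, 'm) ring_scheme \<Rightarrow> 'a \<Rightarrow> ('a \<times> 'a) set" where
  "embed_fraction R a = fraction R a \<one>\<^bsub>R\<^esub>"

definition integral_fraction :: "('a, 'm) ring_scheme \<Rightarrow> ('a \<times> 'a) set \<Rightarrow> bool" where
  "integral_fraction R z \<longleftrightarrow>
     (\<exists>(k::nat) c. (\<forall>i<k. c i \<in> carrier R) \<and>
        z [^]\<^bsub>fraction_field R\<^esub> k \<oplus>\<^bsub>fraction_field R\<^esub>
          (\<Oplus>\<^bsub>fraction_field R\<^esub>i\<in>{..<k}.
             embed_fraction R (c i) \<otimes>\<^bsub>fraction_field R\<^esub> z [^]\<^bsub>fraction_field R\<^esub> i)
        = \<zero>\<^bsub>fraction_field R\<^esub>)"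

definition integrally_closed_domain :: "('a, 'm) ring_scheme \<Rightarrow> bool" where
  "integrally_closed_domain R \<longleftrightarrow>
     domain R \<and>
     (\<forall>z\<in>carrier (fraction_field R). integral_fraction R z \<longrightarrow>
        z \<in> embed_fraction R ` carrier R)"

text \<open>The germ at \<open>x\<close> of a section \<open>f\<close> over an open neighbourhood \<open>U\<close> of \<open>x\<close>.\<close>

definition germ ::
    "'a fspace \<Rightarrow> 'a \<Rightarrow> 'a set \<Rightarrow> ('a \<Rightarrow> complex) \<Rightarrow> ('a set \<times> ('a \<Rightarrow> complex)) set" where
  "germ X x U f =
     {(V, g). openin (zariski X) V \<and> x \<in> V \<and> g \<in> regular X V \<and>
        (\<exists>W. openin (zariski X) W \<and> x \<in> W \<and> W \<subseteq> U \<inter> V \<and> (\<forall>y\<in>W. f y = g y))}"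

definition local_ring :: "'a fspace \<Rightarrow> 'a \<Rightarrow> ('a set \<times> ('a \<Rightarrow> complex)) set ring" where
  "local_ring X x =
     \<lparr>carrier = {germ X x U f | U f. openin (zariski X) U \<and> x \<in> U \<and> f \<in> regular X U},
      mult = (\<lambda>A B. \<Union>(U, f)\<in>A. \<Union>(V, g)\<in>B. germ X x (U \<inter> V) (\<lambda>y. f y * g y)),
      one = germ X x (points X) (\<lambda>_. 1),
      zero = germ X x (points X) (\<lambda>_. 0),
      add = (\<lambda>A B. \<Union>(U, f)\<in>A. \<Union>(V, g)\<in>B. germ X x (U \<inter> V) (\<lambda>y. f y + g y))\<rparr>"

definition normal_variety :: "'a fspace \<Rightarrow> bool" where
  "normal_variety X \<longleftrightarrow> (\<forall>x\<in>points X. integrally_closed_domain (local_ring X x))"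

end

theory Submission
  imports Defs "HOL-Analysis.Complex_Transcendental" "HOL-Number_Theory.Cong"
begin

text \<open>
  Let \<open>S\<close> be the variety \<open>x\<^sub>0\<^sup>n = x\<^sub>1 \<cdots> x\<^sub>n\<close>. The affine cone over \<open>S\<close> is the image of \<open>\<complex>\<^sup>n\<close> under the
  monomial map \<open>s \<mapsto> (s\<^sub>1 \<cdots> s\<^sub>n, s\<^sub>1\<^sup>n, \<dots>, s\<^sub>n\<^sup>n)\<close> (\<open>cone_parametrized\<close>): extract roots of \<open>x\<^sub>1, \<dots>, x\<^sub>n\<close>, then
  correct one of them by a root of unity. Pulling polynomials back along this map identifies the
  coordinate ring of the cone with the span \<open>\<complex>[P]\<close> of the monomials whose exponents lie in the monoid
  \<open>P = {a \<in> \<nat>\<^sup>n. a\<^sub>1 \<equiv> \<dots> \<equiv> a\<^sub>n (mod n)}\<close>. The kernel of the pullback is generated by the one equation,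
  because modulo it every polynomial has degree less than \<open>n\<close> in \<open>x\<^sub>0\<close>, and monomials with this
  property have distinct pullbacks (\<open>defining_ideal_iff_pullback\<close>). As \<open>\<complex>[P]\<close> is a domain, the ideal
  is prime and \<open>S\<close> is irreducible.

  Normality rests on \<open>\<complex>[P]\<close> being integrally closed, and this follows from saturation of \<open>P\<close>: if
  \<open>w + j u \<in> P + j v\<close> for all \<open>j\<close>, then \<open>u \<in> P + v\<close>. Suppose that \<open>a / b\<close> is integral over \<open>\<complex>[P]\<close>. Then
  there is a \<open>c \<noteq> 0\<close> with \<open>c a\<^sup>j \<in> b\<^sup>j \<complex>[P]\<close> for all \<open>j\<close>. Comparing leading monomials, saturation shows
  that the leading monomial of \<open>a\<close> is that of \<open>b\<close> times a monomial of \<open>\<complex>[P]\<close>; after subtraction of a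
  multiple of \<open>b\<close> from \<open>a\<close> the same hypothesis holds for a smaller leading monomial, so the division
  terminates without remainder (\<open>almost_integral_dvd\<close>). An integral equation over a local ring of
  \<open>S\<close> becomes, with a common denominator, an identity between forms on all of \<open>S\<close>, and to its pullback
  this applies (\<open>normal_varietyI\<close>, \<open>normal\<close>).

  The torus is the locus \<open>x\<^sub>0 \<noteq> 0\<close>: normalising \<open>x\<^sub>0 = 1\<close> leaves \<open>x\<^sub>1 \<cdots> x\<^sub>n = 1\<close>, where \<open>x\<^sub>1, \<dots>, x\<^bsub>n-1\<^esub>\<close>
  are arbitrary nonzero numbers. It acts on \<open>S\<close> by multiplication of homogeneous coordinates.

  Projective and affine spaces with functions are treated together. Both arise from a set of points
  and a graded family of functions on it, the regular functions being locally quotients of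
  functions of equal degree (\<open>fspace_of\<close>). The sheaf axioms, the description of morphisms,
  irreducibility and the local rings are derived from the graded family alone.
\<close>

section \<open>Monomials and polynomial functions\<close>

abbreviation keys where "keys \<equiv> Poly_Mapping.keys"
abbreviation lookup where "lookup \<equiv> Poly_Mapping.lookup"
abbreviation single where "single \<equiv> Poly_Mapping.single"

definition mon_eval :: "(nat \<Rightarrow>\<^sub>0 nat) \<Rightarrow> (nat \<Rightarrow> complex) \<Rightarrow> complex" where
  "mon_eval m x = (\<Prod>i\<in>keys m. x i ^ lookup m i)"

definition mon_deg :: "(nat \<Rightarrow>\<^sub>0 nat) \<Rightarrow> nat" where
  "mon_deg m = (\<Sum>i\<in>keys m. lookup m i)"

lemma mon_eval_superset:
  assumes "finite A" "keys m \<subseteq> A"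
  shows "mon_eval m x = (\<Prod>i\<in>A. x i ^ lookup m i)"
  unfolding mon_eval_def
  by (rule prod.mono_neutral_left) (use assms in \<open>auto simp: in_keys_iff\<close>)

lemma mon_deg_superset:
  assumes "finite A" "keys m \<subseteq> A"
  shows "mon_deg m = (\<Sum>i\<in>A. lookup m i)"
  unfolding mon_deg_def
  by (rule sum.mono_neutral_left) (use assms in \<open>auto simp: in_keys_iff\<close>)

lemma keys_add_nat: "keys (m + m') = keys m \<union> keys (m' :: nat \<Rightarrow>\<^sub>0 nat)"
  by (auto simp: in_keys_iff lookup_add)

lemma mon_eval_add: "mon_eval (m + m') x = mon_eval m x * mon_eval m' x"
proof -
  let ?A = "keys m \<union> keys m'"
  have "mon_eval (m + m') x = (\<Prod>i\<in>?A. x i ^ lookup (m + m') i)"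
    by (rule mon_eval_superset) (auto simp: keys_add_nat)
  also have "\<dots> = (\<Prod>i\<in>?A. x i ^ lookup m i) * (\<Prod>i\<in>?A. x i ^ lookup m' i)"
    by (simp add: lookup_add power_add prod.distrib)
  also have "\<dots> = mon_eval m x * mon_eval m' x"
    by (simp flip: mon_eval_superset)
  finally show ?thesis .
qed

lemma mon_deg_add: "mon_deg (m + m') = mon_deg m + mon_deg m'"
proof -
  let ?A = "keys m \<union> keys m'"
  have "mon_deg (m + m') = (\<Sum>i\<in>?A. lookup (m + m') i)"
    by (rule mon_deg_superset) (auto simp: keys_add_nat)
  also have "\<dots> = (\<Sum>i\<in>?A. lookup m i) + (\<Sum>i\<in>?A. lookup m' i)"
    by (simp add: lookup_add sum.distrib)
  also have "\<dots> = mon_deg m + mon_deg m'"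
    by (simp flip: mon_deg_superset)
  finally show ?thesis .
qed

lemma mon_eval_0 [simp]: "mon_eval 0 x = 1"
  by (simp add: mon_eval_def)

lemma mon_deg_0 [simp]: "mon_deg 0 = 0"
  by (simp add: mon_deg_def)

lemma mon_eval_single [simp]: "mon_eval (single i k) x = x i ^ k"
  by (simp add: mon_eval_def)

lemma mon_deg_single [simp]: "mon_deg (single i k) = k"
  by (simp add: mon_deg_def)

lemma mon_eval_times: "mon_eval m (\<lambda>i. x i * y i) = mon_eval m x * mon_eval m y"
  by (simp add: mon_eval_def power_mult_distrib prod.distrib)

lemma mon_eval_scale: "mon_eval m (\<lambda>i. c * x i) = c ^ mon_deg m * mon_eval m x"
  by (simp add: mon_eval_def mon_deg_def power_mult_distrib prod.distrib power_sum)

lemma mon_eval_cong: "(\<And>i. i \<in> keys m \<Longrightarrow> x i = y i) \<Longrightarrow> mon_eval m x = mon_eval m y"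
  by (simp add: mon_eval_def)

lemma peval_alt: "peval p x = (\<Sum>m\<in>keys p. lookup p m * mon_eval m x)"
  by (simp add: peval_def mon_eval_def)

lemma peval_superset:
  assumes "finite M" "keys p \<subseteq> M"
  shows "peval p x = (\<Sum>m\<in>M. lookup p m * mon_eval m x)"
  unfolding peval_alt
  by (rule sum.mono_neutral_left) (use assms in \<open>auto simp: in_keys_iff\<close>)

lemma peval_add [simp]: "peval (p + q) x = peval p x + peval q x"
proof -
  let ?M = "keys p \<union> keys q"
  have "peval (p + q) x = (\<Sum>m\<in>?M. lookup (p + q) m * mon_eval m x)"
    by (rule peval_superset) (use Poly_Mapping.keys_add[of p q] in auto)
  also have "\<dots> = (\<Sum>m\<in>?M. lookup p m * mon_eval m x) + (\<Sum>m\<in>?M. lookup q m * mon_eval m x)"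
    by (simp add: lookup_add sum.distrib algebra_simps)
  also have "\<dots> = peval p x + peval q x"
    by (simp flip: peval_superset)
  finally show ?thesis .
qed

lemma peval_0 [simp]: "peval 0 x = 0"
  by (simp add: peval_def)

lemma peval_1 [simp]: "peval 1 x = 1"
  by (simp add: peval_def)

lemma peval_uminus [simp]: "peval (- p) x = - peval p x"
  using peval_add[of p "- p" x] by (simp add: eq_neg_iff_add_eq_0 add.commute)

lemma peval_diff [simp]: "peval (p - q) x = peval p x - peval q x"
  using peval_add[of p "- q" x] by simp

lemma peval_sum: "peval (sum f A) x = (\<Sum>a\<in>A. peval (f a) x)"
  by (induction A rule: infinite_finite_induct) auto

lemma peval_single [simp]: "peval (single m c) x = c * mon_eval m x"
  by (simp add: peval_alt)

lemma poly_expansion: "p = (\<Sum>m\<in>keys p. single m (lookup p m))"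
proof (rule poly_mapping_eqI)
  fix k
  have "(\<Sum>m\<in>keys p. lookup (single m (lookup p m)) k) = (\<Sum>m\<in>keys p. if m = k then lookup p m else 0)"
    by (rule sum.cong) (auto simp: lookup_single when_def)
  also have "\<dots> = lookup p k"
    by (auto simp: in_keys_iff)
  finally show "lookup p k = lookup (\<Sum>m\<in>keys p. single m (lookup p m)) k"
    by (simp add: lookup_sum)
qed

lemma peval_mult [simp]: "peval (p * q) x = peval p x * peval q x"
proof -
  have "p * q = (\<Sum>m\<in>keys p. single m (lookup p m)) * (\<Sum>m\<in>keys q. single m (lookup q m))"
    using poly_expansion[of p] poly_expansion[of q] by simp
  then have "p * q = (\<Sum>m\<in>keys p. \<Sum>m'\<in>keys q. single (m + m') (lookup p m * lookup q m'))"
    by (simp add: sum_product mult_single)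
  then have "peval (p * q) x = (\<Sum>m\<in>keys p. \<Sum>m'\<in>keys q. lookup p m * lookup q m' * (mon_eval m x * mon_eval m' x))"
    by (simp only: peval_sum peval_single mon_eval_add)
  also have "\<dots> = peval p x * peval q x"
    unfolding peval_alt sum_product by (intro sum.cong refl) (simp only: mult_ac)
  finally show ?thesis .
qed

lemma peval_power [simp]: "peval (p ^ k) x = peval p x ^ k"
  by (induction k) auto

lemma peval_prod: "peval (prod f A) x = (\<Prod>a\<in>A. peval (f a) x)"
  by (induction A rule: infinite_finite_induct) auto

lemma peval_Var [simp]: "peval (Var i) x = x i"
  by (simp add: Var_def)

definition supported :: "(nat \<Rightarrow>\<^sub>0 nat) set \<Rightarrow> mpoly set" where
  "supported M = {p. keys p \<subseteq> M}"

lemma supported_add: "p \<in> supported M \<Longrightarrow> q \<in> supported M \<Longrightarrow> p + q \<in> supported M"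
  unfolding supported_def using Poly_Mapping.keys_add[of p q] by auto

lemma supported_uminus: "p \<in> supported M \<Longrightarrow> - p \<in> supported M"
  unfolding supported_def by (auto simp: in_keys_iff)

lemma supported_diff: "p \<in> supported M \<Longrightarrow> q \<in> supported M \<Longrightarrow> p - q \<in> supported M"
  using supported_add[of p M "- q"] supported_uminus[of q M] by simp

lemma supported_0 [simp]: "0 \<in> supported M"
  by (simp add: supported_def)

lemma supported_sum: "(\<And>a. a \<in> A \<Longrightarrow> f a \<in> supported M) \<Longrightarrow> sum f A \<in> supported M"
  by (induction A rule: infinite_finite_induct) (auto intro: supported_add)

lemma supported_single: "c = 0 \<or> m \<in> M \<Longrightarrow> single m c \<in> supported M"
  by (auto simp: supported_def)

lemma supported_mult:
  assumes "p \<in> supported A" "q \<in> supported B" "\<And>a b. a \<in> A \<Longrightarrow> b \<in> B \<Longrightarrow> a + b \<in> C"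
  shows "p * q \<in> supported C"
  using assms Poly_Mapping.keys_mult[of p q] unfolding supported_def by blast

lemma supported_mono: "p \<in> supported A \<Longrightarrow> A \<subseteq> B \<Longrightarrow> p \<in> supported B"
  by (auto simp: supported_def)

lemma supported_1: "0 \<in> M \<Longrightarrow> 1 \<in> supported M"
  by (simp add: supported_def)

lemma supported_power:
  assumes "p \<in> supported M" "0 \<in> M" "\<And>a b. a \<in> M \<Longrightarrow> b \<in> M \<Longrightarrow> a + b \<in> M"
  shows "p ^ k \<in> supported M"
  by (induction k) (auto intro: supported_1 supported_mult assms)

lemma supported_of_nat: "0 \<in> M \<Longrightarrow> of_nat k \<in> supported M"
  by (induction k) (auto intro: supported_1 supported_add)

text \<open>
  Dedekind's argument for characters. Evaluation is multiplicative in the point, so replacing \<open>x\<close> by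
  \<open>x y\<close> in a linear relation multiplies the coefficient of \<open>m\<close> by the value of \<open>m\<close> at \<open>y\<close>. Subtracting
  the original relation, scaled by the value of \<open>m\<^sub>0\<close> at \<open>y\<close>, removes \<open>m\<^sub>0\<close>.
\<close>
lemma monomials_linearly_independent:
  assumes "finite M" "\<And>x. (\<Sum>m\<in>M. c m * mon_eval m x) = 0" "m \<in> M"
  shows "c m = 0"
  using assms
proof (induction M arbitrary: c m rule: finite_induct)
  case empty
  then show ?case by simp
next
  case (insert m0 M)
  have c0: "c m = 0" if "m \<in> M" for m
  proof -
    have "m \<noteq> m0"
      using that insert by auto
    then obtain i where i: "lookup m i \<noteq> lookup m0 i"
      by (metis poly_mapping_eqI)
    \<comment> \<open>A point at which two monomials with different exponents of the variable \<open>i\<close> differ.\<close>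
    define y :: "nat \<Rightarrow> complex" where "y j = (if j = i then 2 else 1)" for j
    have ev: "mon_eval u y = 2 ^ lookup u i" for u
    proof -
      have "mon_eval u y = (\<Prod>j\<in>insert i (keys u). y j ^ lookup u j)"
        by (rule mon_eval_superset) auto
      also have "\<dots> = y i ^ lookup u i * (\<Prod>j\<in>insert i (keys u) - {i}. y j ^ lookup u j)"
        by (rule prod.remove) auto
      also have "(\<Prod>j\<in>insert i (keys u) - {i}. y j ^ lookup u j) = 1"
        by (rule prod.neutral) (auto simp: y_def)
      finally show ?thesis by (simp add: y_def[of i])
    qed
    have ne: "mon_eval m y \<noteq> mon_eval m0 y"
    proof
      assume "mon_eval m y = mon_eval m0 y"
      then have "(of_nat (2 ^ lookup m i) :: complex) = of_nat (2 ^ lookup m0 i)"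
        by (simp add: ev)
      then have "(2::nat) ^ lookup m i = 2 ^ lookup m0 i"
        by (simp only: of_nat_eq_iff)
      then show False
        using i by simp
    qed
    have "c m * (mon_eval m y - mon_eval m0 y) = 0"
    proof (rule insert.IH[where c = "\<lambda>m. c m * (mon_eval m y - mon_eval m0 y)"])
      fix x
      have "(\<Sum>m\<in>insert m0 M. c m * mon_eval m (\<lambda>i. x i * y i))
            - mon_eval m0 y * (\<Sum>m\<in>insert m0 M. c m * mon_eval m x) = 0"
        using insert.prems(1) by simp
      then show "(\<Sum>m\<in>M. c m * (mon_eval m y - mon_eval m0 y) * mon_eval m x) = 0"
        using insert.hyps
        by (simp add: mon_eval_times algebra_simps sum_subtractf sum_distrib_left)
    qed (use that in auto)
    then show ?thesis
      using ne by simp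
  qed
  moreover have "c m0 = 0"
  proof -
    have "(\<Sum>m\<in>insert m0 M. c m * mon_eval m (\<lambda>_. 1)) = 0"
      by (rule insert.prems)
    then show ?thesis
      using insert.hyps c0 by (simp add: mon_eval_def)
  qed
  ultimately show ?case
    using insert.prems by auto
qed

lemma peval_eq_0_imp:
  assumes "\<And>x. peval p x = 0"
  shows "p = 0"
proof (rule poly_mapping_eqI)
  fix m
  show "lookup p m = lookup 0 m"
    using monomials_linearly_independent[of "keys p" "lookup p" m] assms
    by (cases "m \<in> keys p") (auto simp: peval_alt in_keys_iff)
qed

section \<open>Leading monomials\<close>

text \<open>
  Monomials are ordered lexicographically. The order is total and compatible with addition, but it
  is a well-order only on monomials in finitely many variables.
\<close>
definition lead_mon :: "mpoly \<Rightarrow> (nat \<Rightarrow>\<^sub>0 nat)" where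
  "lead_mon p = Max (keys p)"

lemma lead_mon_in_keys: "p \<noteq> 0 \<Longrightarrow> lead_mon p \<in> keys p"
  unfolding lead_mon_def by (rule Max_in) auto

lemma lead_mon_ge: "m \<in> keys p \<Longrightarrow> m \<le> lead_mon p"
  unfolding lead_mon_def by (rule Max_ge) auto

text \<open>
  Every other product of a monomial of \<open>p\<close> with a monomial of \<open>q\<close> is smaller than the product of the
  leading ones, so nothing cancels the leading term.
\<close>
lemma lookup_mult_lead_mon:
  assumes "p \<noteq> 0" "q \<noteq> 0"
  shows "lookup (p * q) (lead_mon p + lead_mon q) = lookup p (lead_mon p) * lookup q (lead_mon q)"
proof -
  define u v where "u = lead_mon p" and "v = lead_mon q"
  define p' where "p' = p - single u (lookup p u)"
  define q' where "q' = q - single v (lookup q v)"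
  have p': "m \<le> u \<and> m \<noteq> u" if "m \<in> keys p'" for m
    using that lead_mon_ge[of m p] unfolding p'_def u_def
    by (auto simp: in_keys_iff lookup_minus lookup_single when_def split: if_splits)
  have q': "m \<le> v \<and> m \<noteq> v" if "m \<in> keys q'" for m
    using that lead_mon_ge[of m q] unfolding q'_def v_def
    by (auto simp: in_keys_iff lookup_minus lookup_single when_def split: if_splits)
  have "p * q = single (u + v) (lookup p u * lookup q v) + (single u (lookup p u) * q' + p' * q)"
    by (simp add: p'_def q'_def algebra_simps mult_single)
  moreover have "u + v \<notin> keys (single u (lookup p u) * q')"
  proof
    assume "u + v \<in> keys (single u (lookup p u) * q')"
    then obtain b where "b \<in> keys q'" "u + v = u + b"
      using Poly_Mapping.keys_mult by (fastforce split: if_splits)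
    then show False
      using q' by auto
  qed
  moreover have "u + v \<notin> keys (p' * q)"
  proof
    assume "u + v \<in> keys (p' * q)"
    then obtain a b where ab: "a \<in> keys p'" "b \<in> keys q" "u + v = a + b"
      using Poly_Mapping.keys_mult by blast
    then have "a < u" "b \<le> v"
      using p' lead_mon_ge v_def by (auto simp: less_le)
    then have "a + b < u + v"
      by (rule add_less_le_mono)
    then show False
      using ab by simp
  qed
  ultimately show ?thesis
    by (simp add: lookup_add u_def v_def in_keys_iff)
qed

lemma lead_mon_mult:
  assumes "p \<noteq> 0" "q \<noteq> 0"
  shows "lead_mon (p * q) = lead_mon p + lead_mon q"
  unfolding lead_mon_def[of "p * q"]
proof (rule Max_eqI)
  fix m
  assume "m \<in> keys (p * q)"
  then obtain a b where "a \<in> keys p" "b \<in> keys q" "m = a + b"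
    using Poly_Mapping.keys_mult by blast
  then show "m \<le> lead_mon p + lead_mon q"
    by (auto intro!: add_mono lead_mon_ge)
next
  show "lead_mon p + lead_mon q \<in> keys (p * q)"
    using lookup_mult_lead_mon[OF assms] assms lead_mon_in_keys
    by (simp add: in_keys_iff)
qed auto

lemma lead_mon_power:
  assumes "p \<noteq> 0"
  shows "lead_mon (p ^ j) = (\<Sum>i<j. lead_mon p)"
proof (induction j)
  case 0
  show ?case by (simp add: lead_mon_def)
next
  case (Suc j)
  then show ?case
    using assms by (simp add: lead_mon_mult add.commute del: sum_constant)
qed

section \<open>The monoid ring of a saturated monoid is integrally closed\<close>

text \<open>
  Saturation is stated in the form in which leading monomials produce it: \<open>w\<close> stands for the leading
  exponent of a common denominator of all powers of a fraction with leading exponent \<open>u - v\<close>. In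
  \<open>\<int>\<^sup>n\<close>, dividing by \<open>j\<close> and letting \<open>j\<close> grow shows that \<open>u - v\<close> lies in the closed cone spanned by \<open>P\<close>.
  Finiteness of the levels makes the leading monomials of homogeneous polynomials well-founded.
\<close>
locale saturated_monoid =
  fixes P :: "(nat \<Rightarrow>\<^sub>0 nat) set"
  assumes zero_mem: "0 \<in> P"
    and add_mem: "\<And>u v. u \<in> P \<Longrightarrow> v \<in> P \<Longrightarrow> u + v \<in> P"
    and saturated: "\<And>u v w. \<lbrakk>u \<in> P; v \<in> P; w \<in> P; \<And>j. \<exists>t\<in>P. w + (\<Sum>i<j. u) = t + (\<Sum>i<(j::nat). v)\<rbrakk>
                      \<Longrightarrow> \<exists>t\<in>P. u = t + v"
    and finite_level: "\<And>d. finite {m\<in>P. mon_deg m = d}"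
begin

lemmas mem_mult = supported_mult[where A = P and B = P and C = P, OF _ _ add_mem]
lemmas mem_power = supported_power[where M = P, OF _ zero_mem add_mem]

text \<open>
  Long division of \<open>a\<close> by \<open>b\<close> in the monoid ring. The last hypothesis says that the fraction \<open>a / b\<close> is
  almost integral; it passes to \<open>a / b - r\<close> for \<open>r\<close> in the ring by the binomial theorem, and it forces
  the leading monomial of \<open>b\<close> to divide that of \<open>a\<close> within \<open>P\<close>.
\<close>
lemma almost_integral_dvd:
  assumes "a \<in> supported {m\<in>P. mon_deg m = D}" "b \<in> supported {m\<in>P. mon_deg m = E}"
    and "b \<noteq> 0" "c \<noteq> 0" "c \<in> supported P"
    and "\<And>j. \<exists>d\<in>supported P. c * a ^ j = d * b ^ j"
  shows "\<exists>w\<in>supported {m\<in>P. mon_deg m + E = D}. a = w * b"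
  using assms(1,6)
proof (induction "card {m\<in>P. mon_deg m = D \<and> m \<le> lead_mon a}" arbitrary: a rule: less_induct)
  case less
  show ?case
  proof (cases "a = 0")
    case True
    then show ?thesis by (auto intro!: bexI[of _ 0])
  next
    case False
    let ?u = "lead_mon a" and ?v = "lead_mon b"
    have u: "?u \<in> P" "mon_deg ?u = D"
      using lead_mon_in_keys[OF False] less.prems(1) by (auto simp: supported_def)
    have v: "?v \<in> P" "mon_deg ?v = E"
      using lead_mon_in_keys[OF assms(3)] assms(2) by (auto simp: supported_def)
    have "\<exists>t\<in>P. ?u = t + ?v"
    proof (rule saturated[OF u(1) v(1)])
      show "lead_mon c \<in> P"
        using lead_mon_in_keys[OF assms(4)] assms(5) by (auto simp: supported_def)
      fix j
      obtain d where d: "d \<in> supported P" "c * a ^ j = d * b ^ j"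
        using less.prems(2) by blast
      have "c * a ^ j \<noteq> 0"
        using False assms(4) by simp
      then have "d \<noteq> 0"
        using d by auto
      then have "lead_mon c + (\<Sum>i<j. ?u) = lead_mon d + (\<Sum>i<j. ?v)"
        using arg_cong[OF d(2), of lead_mon] False assms(3,4)
        by (simp add: lead_mon_mult lead_mon_power)
      moreover have "lead_mon d \<in> P"
        using lead_mon_in_keys[OF \<open>d \<noteq> 0\<close>] d(1) by (auto simp: supported_def)
      ultimately show "\<exists>t\<in>P. lead_mon c + (\<Sum>i<j. ?u) = t + (\<Sum>i<j. ?v)"
        by blast
    qed
    then obtain t where t: "t \<in> P" "?u = t + ?v"
      by blast
    \<comment> \<open>The term of the quotient that cancels the leading term of \<open>a\<close>.\<close>
    define r where "r = single t (lookup a ?u / lookup b ?v)"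
    define a' where "a' = a - r * b"
    have tdeg: "mon_deg t + E = D"
      using arg_cong[OF t(2), of mon_deg] u v by (simp add: mon_deg_add)
    have r: "r \<in> supported {m\<in>P. mon_deg m + E = D}"
      unfolding r_def by (rule supported_single) (use t tdeg in auto)
    have rb: "r * b \<in> supported {m\<in>P. mon_deg m = D}"
      by (rule supported_mult[OF r assms(2)]) (auto simp: add_mem mon_deg_add)
    have r0: "r \<noteq> 0"
      using lead_mon_in_keys[OF False] lead_mon_in_keys[OF assms(3)] unfolding r_def
      by (auto simp: in_keys_iff simp flip: keys_eq_empty)
    have a': "a' \<in> supported {m\<in>P. mon_deg m = D}"
      unfolding a'_def by (rule supported_diff) (use less.prems rb in auto)
    have lr: "lead_mon r = t"
    proof -
      have "keys r = {t}"
        using r0 unfolding r_def by (cases "lookup a ?u / lookup b ?v = 0") (auto simp only: keys_single if_False single_zero)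
      then show ?thesis by (simp add: lead_mon_def)
    qed
    have lrb: "lead_mon (r * b) = ?u"
      using r0 assms(3) by (simp add: lead_mon_mult lr t(2))
    have crb: "lookup (r * b) ?u = lookup a ?u"
    proof -
      have "lookup (r * b) ?u = lookup r t * lookup b ?v"
        using lookup_mult_lead_mon[OF r0 assms(3)] lr t(2) by simp
      also have "\<dots> = lookup a ?u"
        using lead_mon_in_keys[OF assms(3)] by (simp add: r_def in_keys_iff)
      finally show ?thesis .
    qed
    have below: "m < ?u" if "m \<in> keys a'" for m
    proof -
      have "m \<in> keys a \<or> m \<in> keys (r * b)"
        using that keys_diff[of a "r * b"] unfolding a'_def by blast
      then have "m \<le> ?u"
        using lead_mon_ge lrb by metis
      moreover have "m \<noteq> ?u"
        using that crb by (auto simp: a'_def in_keys_iff lookup_minus)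
      ultimately show ?thesis by simp
    qed
    have "\<exists>w\<in>supported {m\<in>P. mon_deg m + E = D}. a' = w * b"
    proof (cases "a' = 0")
      case True
      then show ?thesis by (auto intro!: bexI[of _ 0])
    next
      case a'0: False
      show ?thesis
      proof (rule less.hyps)
        have lt: "lead_mon a' < ?u"
          using below lead_mon_in_keys[OF a'0] by blast
        show "card {m \<in> P. mon_deg m = D \<and> m \<le> lead_mon a'} < card {m \<in> P. mon_deg m = D \<and> m \<le> ?u}"
        proof (rule psubset_card_mono)
          show "finite {m \<in> P. mon_deg m = D \<and> m \<le> ?u}"
            by (rule finite_subset[OF _ finite_level[of D]]) auto
          have "?u \<in> {m \<in> P. mon_deg m = D \<and> m \<le> ?u}"
            using u by simp
          moreover have "?u \<notin> {m \<in> P. mon_deg m = D \<and> m \<le> lead_mon a'}"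
            using lt by auto
          moreover have "{m \<in> P. mon_deg m = D \<and> m \<le> lead_mon a'} \<subseteq> {m \<in> P. mon_deg m = D \<and> m \<le> ?u}"
            using lt by auto
          ultimately show "{m \<in> P. mon_deg m = D \<and> m \<le> lead_mon a'} \<subset> {m \<in> P. mon_deg m = D \<and> m \<le> ?u}"
            by blast
        qed
        show "a' \<in> supported {m \<in> P. mon_deg m = D}"
          by (rule a')
        fix j
        obtain d where d: "\<And>i. d i \<in> supported P" "\<And>i. c * a ^ i = d i * b ^ i"
          using less.prems(2) by metis
        have "c * a' ^ j = c * (\<Sum>k\<le>j. of_nat (j choose k) * a ^ k * (- (r * b)) ^ (j - k))"
          unfolding a'_def using binomial_ring[of a "- (r * b)" j] by simp
        also have "\<dots> = (\<Sum>k\<le>j. of_nat (j choose k) * (c * a ^ k) * (- r * b) ^ (j - k))"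
          by (simp add: sum_distrib_left algebra_simps)
        also have "\<dots> = (\<Sum>k\<le>j. of_nat (j choose k) * d k * (- r) ^ (j - k) * b ^ j)"
        proof (rule sum.cong)
          fix k assume "k \<in> {..j}"
          then have "b ^ k * b ^ (j - k) = b ^ j"
            by (simp flip: power_add)
          then show "of_nat (j choose k) * (c * a ^ k) * (- r * b) ^ (j - k)
              = of_nat (j choose k) * d k * (- r) ^ (j - k) * b ^ j"
            by (simp only: d(2) power_mult_distrib flip: \<open>b ^ k * b ^ (j - k) = b ^ j\<close>) (simp only: mult_ac)
        qed simp
        also have "\<dots> = (\<Sum>k\<le>j. of_nat (j choose k) * d k * (- r) ^ (j - k)) * b ^ j"
          by (simp add: sum_distrib_right)
        finally have *: "c * a' ^ j = (\<Sum>k\<le>j. of_nat (j choose k) * d k * (- r) ^ (j - k)) * b ^ j" .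
        have "r \<in> supported P"
          by (rule supported_mono[OF r]) auto
        then have "(\<Sum>k\<le>j. of_nat (j choose k) * d k * (- r) ^ (j - k)) \<in> supported P"
          by (intro supported_sum mem_mult mem_power supported_of_nat supported_uminus zero_mem d(1))
        then show "\<exists>d\<in>supported P. c * a' ^ j = d * b ^ j"
          using * by blast
      qed
    qed
    then obtain w where w: "w \<in> supported {m\<in>P. mon_deg m + E = D}" "a' = w * b"
      by blast
    then have "a = (w + r) * b"
      by (simp add: a'_def algebra_simps)
    then show ?thesis
      using w(1) r supported_add by blast
  qed
qed

text \<open>
  The equation, multiplied by a power of \<open>h\<close>, is a monic equation for \<open>h a / b\<close> with coefficients in
  the monoid ring. It expresses the \<open>k\<close>-th power of \<open>h a / b\<close> by lower powers, so \<open>b\<^sup>k\<close> is a common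
  denominator of all powers.
\<close>
lemma integral_dvd:
  assumes "a \<in> supported {m\<in>P. mon_deg m = D}" "b \<in> supported {m\<in>P. mon_deg m = D}"
    and "h \<in> supported {m\<in>P. mon_deg m = E}" "\<And>i. i < k \<Longrightarrow> c i \<in> supported P"
    and "b \<noteq> 0" "h \<noteq> 0"
    and eq: "h * a ^ k + (\<Sum>i<k. c i * a ^ i * b ^ (k - i)) = 0"
  shows "\<exists>w\<in>supported {m\<in>P. mon_deg m = E}. h * a = w * b"
proof -
  have aP: "a \<in> supported P" and bP: "b \<in> supported P" and hP: "h \<in> supported P"
    using assms(1-3) by (auto simp: supported_def)
  have k0: "k > 0"
    using eq assms(6) by (cases k) auto
  have main: "(h * a) ^ k = - (\<Sum>i<k. c i * h ^ (k - 1 - i) * (h * a) ^ i * b ^ (k - i))"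
  proof -
    have "h ^ (k - 1) * (h * a ^ k + (\<Sum>i<k. c i * a ^ i * b ^ (k - i))) = 0"
      using eq by simp
    moreover have "h ^ (k - 1) * (h * a ^ k) = (h * a) ^ k"
      using k0 by (cases k) (auto simp: power_mult_distrib algebra_simps)
    moreover have "h ^ (k - 1) * (\<Sum>i<k. c i * a ^ i * b ^ (k - i))
         = (\<Sum>i<k. c i * h ^ (k - 1 - i) * (h * a) ^ i * b ^ (k - i))"
      unfolding sum_distrib_left
    proof (rule sum.cong)
      fix i assume "i \<in> {..<k}"
      then have "h ^ (k - 1) = h ^ (k - 1 - i) * h ^ i"
        by (simp flip: power_add)
      then show "h ^ (k - 1) * (c i * a ^ i * b ^ (k - i)) = c i * h ^ (k - 1 - i) * (h * a) ^ i * b ^ (k - i)"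
        by (simp only: power_mult_distrib mult_ac)
    qed simp
    ultimately show ?thesis
      by (simp add: distrib_left eq_neg_iff_add_eq_0)
  qed
  have alm: "\<exists>d\<in>supported P. b ^ k * (h * a) ^ j = d * b ^ j" for j
  proof (induction j rule: less_induct)
    case (less j)
    show ?case
    proof (cases "j < k")
      case True
      then have "b ^ k = b ^ (k - j) * b ^ j"
        by (simp flip: power_add)
      then have "b ^ k * (h * a) ^ j = (b ^ (k - j) * (h * a) ^ j) * b ^ j"
        by (simp only: mult_ac)
      moreover have "b ^ (k - j) * (h * a) ^ j \<in> supported P"
        by (intro mem_mult mem_power aP bP hP)
      ultimately show ?thesis by blast
    next
      case False
      define l where "l = j - k"
      have j: "j = k + l"
        using False l_def by simp
      have "\<exists>d. \<forall>i<k. d i \<in> supported P \<and> b ^ k * (h * a) ^ (i + l) = d i * b ^ (i + l)"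
        using less[of "_ + l"] j by (intro choice allI) (metis add_less_mono1)
      then obtain d where d: "\<And>i. i < k \<Longrightarrow> d i \<in> supported P"
         "\<And>i. i < k \<Longrightarrow> b ^ k * (h * a) ^ (i + l) = d i * b ^ (i + l)"
        by blast
      have "b ^ k * (h * a) ^ j = b ^ k * (h * a) ^ l * (h * a) ^ k"
        by (simp add: j power_add mult_ac)
      also have "\<dots> = - (\<Sum>i<k. b ^ k * (h * a) ^ l * (c i * h ^ (k - 1 - i) * (h * a) ^ i * b ^ (k - i)))"
        by (simp add: main sum_distrib_left)
      also have "(\<Sum>i<k. b ^ k * (h * a) ^ l * (c i * h ^ (k - 1 - i) * (h * a) ^ i * b ^ (k - i)))
          = (\<Sum>i<k. c i * h ^ (k - 1 - i) * d i * b ^ j)"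
      proof (rule sum.cong)
        fix i assume "i \<in> {..<k}"
        then have i: "i < k" by simp
        have "b ^ k * (h * a) ^ l * (c i * h ^ (k - 1 - i) * (h * a) ^ i * b ^ (k - i))
          = c i * h ^ (k - 1 - i) * (b ^ k * (h * a) ^ (i + l)) * b ^ (k - i)"
          by (simp only: power_add mult_ac)
        also have "\<dots> = c i * h ^ (k - 1 - i) * d i * (b ^ (i + l) * b ^ (k - i))"
          by (subst d(2)[OF i]) (simp only: mult_ac)
        also have "b ^ (i + l) * b ^ (k - i) = b ^ j"
          using i by (simp add: j add.commute flip: power_add)
        finally show "b ^ k * (h * a) ^ l * (c i * h ^ (k - 1 - i) * (h * a) ^ i * b ^ (k - i))
          = c i * h ^ (k - 1 - i) * d i * b ^ j" .
      qed simp
      finally have "b ^ k * (h * a) ^ j = (- (\<Sum>i<k. c i * h ^ (k - 1 - i) * d i)) * b ^ j"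
        by (simp add: sum_distrib_right)
      moreover have "- (\<Sum>i<k. c i * h ^ (k - 1 - i) * d i) \<in> supported P"
        by (intro supported_uminus supported_sum mem_mult mem_power hP) (auto simp: assms d(1))
      ultimately show ?thesis by blast
    qed
  qed
  have "\<exists>w\<in>supported {m\<in>P. mon_deg m + D = E + D}. h * a = w * b"
  proof (rule almost_integral_dvd[where c = "b ^ k"])
    show "h * a \<in> supported {m \<in> P. mon_deg m = E + D}"
      by (rule supported_mult[OF assms(3,1)]) (auto simp: add_mem mon_deg_add)
  qed (use assms alm bP in \<open>auto intro: mem_power\<close>)
  then show ?thesis by simp
qed

end

section \<open>Spaces of functions defined by a graded family\<close>

text \<open>
  For a projective variety \<open>F d\<close> consists of the forms of degree \<open>d\<close>, evaluated at a representative of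
  each point; for an affine variety every \<open>F d\<close> consists of all polynomial functions.
\<close>
definition fspace_of :: "'p set \<Rightarrow> (nat \<Rightarrow> ('p \<Rightarrow> complex) set) \<Rightarrow> 'p fspace" where
  "fspace_of Z F =
     (let T = topology_generated_by {{z\<in>Z. g z \<noteq> 0} | g. \<exists>d. g \<in> F d} in
     \<lparr>zariski = T,
      regular = (\<lambda>U. {f. \<forall>p\<in>U. \<exists>W d g h. openin T W \<and> p \<in> W \<and> W \<subseteq> U \<and> g \<in> F d \<and> h \<in> F d \<and>
        (\<forall>q\<in>W. h q \<noteq> 0 \<and> f q = g q / h q)})\<rparr>)"

lemma regularD:
  assumes "f \<in> regular (fspace_of Z F) U" "p \<in> U"
  obtains W d g h where "openin (zariski (fspace_of Z F)) W" "p \<in> W" "W \<subseteq> U" "g \<in> F d" "h \<in> F d"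
    "\<And>q. q \<in> W \<Longrightarrow> h q \<noteq> 0" "\<And>q. q \<in> W \<Longrightarrow> f q = g q / h q"
proof -
  let ?T = "zariski (fspace_of Z F)"
  have "\<exists>W d g h. openin ?T W \<and> p \<in> W \<and> W \<subseteq> U \<and> g \<in> F d \<and> h \<in> F d \<and>
        (\<forall>q\<in>W. h q \<noteq> 0 \<and> f q = g q / h q)"
    using assms by (simp add: fspace_of_def Let_def)
  then show ?thesis
    using that by blast
qed

definition quotient_near ::
    "'p set \<Rightarrow> (nat \<Rightarrow> ('p \<Rightarrow> complex) set) \<Rightarrow> 'p set \<Rightarrow> ('p \<Rightarrow> complex) \<Rightarrow> 'p \<Rightarrow> bool" where
  "quotient_near Z F U f p \<longleftrightarrow>
     (\<exists>W d g h. openin (zariski (fspace_of Z F)) W \<and> p \<in> W \<and> W \<subseteq> U \<and> g \<in> F d \<and> h \<in> F d \<and>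
       (\<forall>q\<in>W. h q \<noteq> 0 \<and> f q = g q / h q))"

lemma quotient_nearI:
  assumes "openin (zariski (fspace_of Z F)) W" "p \<in> W" "W \<subseteq> U" "g \<in> F d" "h \<in> F d"
    "\<And>q. q \<in> W \<Longrightarrow> h q \<noteq> 0 \<and> f q = g q / h q"
  shows "quotient_near Z F U f p"
  unfolding quotient_near_def
  by (rule exI[of _ W], rule exI[of _ d], rule exI[of _ g], rule exI[of _ h]) (use assms in simp)

lemma regularI:
  assumes "\<And>p. p \<in> U \<Longrightarrow> quotient_near Z F U f p"
  shows "f \<in> regular (fspace_of Z F) U"
  using assms unfolding quotient_near_def by (simp add: fspace_of_def Let_def)

locale function_system =
  fixes Z :: "'p set" and F :: "nat \<Rightarrow> ('p \<Rightarrow> complex) set"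
  assumes const_mem: "(\<lambda>_. c) \<in> F 0"
    and zero_mem: "(\<lambda>_. 0) \<in> F d"
    and add_mem: "f \<in> F d \<Longrightarrow> g \<in> F d \<Longrightarrow> (\<lambda>x. f x + g x) \<in> F d"
    and mult_mem: "f \<in> F d \<Longrightarrow> g \<in> F e \<Longrightarrow> (\<lambda>x. f x * g x) \<in> F (d + e)"
begin

abbreviation X where "X \<equiv> fspace_of Z F"

abbreviation basic :: "('p \<Rightarrow> complex) \<Rightarrow> 'p set" where
  "basic g \<equiv> {z\<in>Z. g z \<noteq> 0}"

lemma openin_basic: "g \<in> F d \<Longrightarrow> openin (zariski X) (basic g)"
  unfolding fspace_of_def Let_def by (auto intro!: topology_generated_by_Basis)

lemma points_eq: "points X = Z"
proof -
  have "points X = \<Union>{{z\<in>Z. g z \<noteq> 0} | g. \<exists>d. g \<in> F d}"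
    by (simp add: fspace_of_def Let_def)
  also have "\<dots> = Z"
  proof
    have "Z \<in> {{z\<in>Z. g z \<noteq> 0} | g. \<exists>d. g \<in> F d}"
      using const_mem[of 1] by (auto intro!: exI[of _ "\<lambda>_. 1 :: complex"])
    then show "Z \<subseteq> \<Union>{{z\<in>Z. g z \<noteq> 0} | g. \<exists>d. g \<in> F d}"
      by blast
  qed blast
  finally show ?thesis .
qed

lemma openin_subset_Z: "openin (zariski X) U \<Longrightarrow> U \<subseteq> Z"
  using openin_subset points_eq by metis

lemma openinD:
  assumes "openin (zariski X) U" "z \<in> U"
  shows "\<exists>d. \<exists>g\<in>F d. g z \<noteq> 0 \<and> basic g \<subseteq> U"
proof -
  have "generate_topology_on {{z\<in>Z. g z \<noteq> 0} | g. \<exists>d. g \<in> F d} U"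
    using assms(1) unfolding fspace_of_def Let_def by (simp add: openin_topology_generated_by)
  then show ?thesis
    using assms(2)
  proof (induction arbitrary: z rule: generate_topology_on.induct)
    case (Int A B)
    then have zA: "z \<in> A" and zB: "z \<in> B" by auto
    obtain d g where "g \<in> F d" "g z \<noteq> 0" "basic g \<subseteq> A"
      using Int.IH(1)[OF zA] by blast
    moreover obtain e h where "h \<in> F e" "h z \<noteq> 0" "basic h \<subseteq> B"
      using Int.IH(2)[OF zB] by blast
    ultimately show ?case
      by (intro exI[of _ "d + e"] bexI[of _ "\<lambda>x. g x * h x"]) (auto intro: mult_mem)
  next
    case (UN K)
    then obtain k where "k \<in> K" "z \<in> k" by blast
    then have "\<exists>d. \<exists>g\<in>F d. g z \<noteq> 0 \<and> basic g \<subseteq> k"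
      using UN.IH by blast
    then show ?case
      using \<open>k \<in> K\<close> by (meson Union_upper subset_trans)
  next
    case (Basis s)
    then obtain g d where "s = basic g" "g \<in> F d" by blast
    then show ?case using \<open>z \<in> s\<close> by auto
  qed simp
qed

lemma openinI:
  assumes "U \<subseteq> Z" "\<And>z. z \<in> U \<Longrightarrow> \<exists>W. openin (zariski X) W \<and> z \<in> W \<and> W \<subseteq> U"
  shows "openin (zariski X) U"
  by (subst openin_subopen) (use assms in blast)

text \<open>
  Multiplying numerator and denominator by a function that cuts out a smaller basic neighbourhood
  makes the non-vanishing locus of the denominator itself the neighbourhood on which the quotient
  represents \<open>f\<close>.
\<close>
lemma regular_basicD:
  assumes "f \<in> regular X U" "p \<in> U"
  obtains d g h where "p \<in> Z" "g \<in> F d" "h \<in> F d" "h p \<noteq> 0" "basic h \<subseteq> U"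
    "\<And>q. q \<in> Z \<Longrightarrow> h q \<noteq> 0 \<Longrightarrow> f q = g q / h q"
proof -
  obtain W d g h where *: "openin (zariski X) W" "p \<in> W" "W \<subseteq> U" "g \<in> F d" "h \<in> F d"
    "\<And>q. q \<in> W \<Longrightarrow> h q \<noteq> 0" "\<And>q. q \<in> W \<Longrightarrow> f q = g q / h q"
    by (rule regularD[OF assms], blast)
  obtain e k where k: "k \<in> F e" "k p \<noteq> 0" "basic k \<subseteq> W"
    using openinD[OF *(1,2)] by blast
  show ?thesis
  proof (rule that[of "\<lambda>x. g x * k x" "d + e" "\<lambda>x. h x * k x"])
    show "p \<in> Z"
      using openin_subset_Z[OF *(1)] *(2) by blast
    show "basic (\<lambda>x. h x * k x) \<subseteq> U"
      using k *(3) by auto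
    show "f q = g q * k q / (h q * k q)" if "q \<in> Z" "h q * k q \<noteq> 0" for q
      using *(7)[of q] k that by auto
  qed (use * k in \<open>auto intro: mult_mem\<close>)
qed

lemma regular_quotient:
  assumes "g \<in> F d" "h \<in> F d" "openin (zariski X) U" "\<And>q. q \<in> U \<Longrightarrow> h q \<noteq> 0"
    "\<And>q. q \<in> U \<Longrightarrow> f q = g q / h q"
  shows "f \<in> regular X U"
  by (rule regularI, rule quotient_nearI[OF assms(3) _ _ assms(1,2)]) (use assms in auto)

lemma space_with_functions: "space_with_functions X"
  unfolding space_with_functions_def
proof (intro allI impI conjI ballI)
  fix U assume U: "openin (zariski X) U"
  note UZ = openin_subset_Z[OF U]
  show "(\<lambda>_. c) \<in> regular X U" for c
    by (rule regular_quotient[OF const_mem[of c] const_mem[of 1] U]) auto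
  show "(\<lambda>x. f x + g x) \<in> regular X U" if f: "f \<in> regular X U" and g: "g \<in> regular X U" for f g
  proof (rule regularI)
    fix p assume p: "p \<in> U"
    obtain d a b where 1: "p \<in> Z" "a \<in> F d" "b \<in> F d" "b p \<noteq> 0" "basic b \<subseteq> U"
      "\<And>q. q \<in> Z \<Longrightarrow> b q \<noteq> 0 \<Longrightarrow> f q = a q / b q" by (rule regular_basicD[OF f p], blast)
    obtain e a' b' where 2: "p \<in> Z" "a' \<in> F e" "b' \<in> F e" "b' p \<noteq> 0" "basic b' \<subseteq> U"
      "\<And>q. q \<in> Z \<Longrightarrow> b' q \<noteq> 0 \<Longrightarrow> g q = a' q / b' q" by (rule regular_basicD[OF g p], blast)
    have m1: "(\<lambda>q. a q * b' q + b q * a' q) \<in> F (d + e)"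
      by (intro add_mem mult_mem 1 2)
    have m2: "(\<lambda>q. b q * b' q) \<in> F (d + e)"
      by (intro mult_mem 1 2)
    show "quotient_near Z F U (\<lambda>q. f q + g q) p"
      by (rule quotient_nearI[OF openin_basic[OF m2] _ _ m1 m2])
         (use 1(1,2,4,5,6) 2(4,6) in \<open>auto simp: add_frac_eq mult.commute\<close>)
  qed
  show "(\<lambda>x. f x * g x) \<in> regular X U" if f: "f \<in> regular X U" and g: "g \<in> regular X U" for f g
  proof (rule regularI)
    fix p assume p: "p \<in> U"
    obtain d a b where 1: "p \<in> Z" "a \<in> F d" "b \<in> F d" "b p \<noteq> 0" "basic b \<subseteq> U"
      "\<And>q. q \<in> Z \<Longrightarrow> b q \<noteq> 0 \<Longrightarrow> f q = a q / b q" by (rule regular_basicD[OF f p], blast)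
    obtain e a' b' where 2: "p \<in> Z" "a' \<in> F e" "b' \<in> F e" "b' p \<noteq> 0" "basic b' \<subseteq> U"
      "\<And>q. q \<in> Z \<Longrightarrow> b' q \<noteq> 0 \<Longrightarrow> g q = a' q / b' q" by (rule regular_basicD[OF g p], blast)
    have m1: "(\<lambda>q. a q * a' q) \<in> F (d + e)"
      by (intro add_mem mult_mem 1 2)
    have m2: "(\<lambda>q. b q * b' q) \<in> F (d + e)"
      by (intro mult_mem 1 2)
    show "quotient_near Z F U (\<lambda>q. f q * g q) p"
      by (rule quotient_nearI[OF openin_basic[OF m2] _ _ m1 m2]) (use 1(1,2,4,5,6) 2(4,6) in auto)
  qed
  show "g \<in> regular X U" if f: "f \<in> regular X U" and g: "\<forall>x\<in>U. g x = f x" for f g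
  proof (rule regularI)
    fix p assume p: "p \<in> U"
    obtain W d a b where *: "openin (zariski X) W" "p \<in> W" "W \<subseteq> U" "a \<in> F d" "b \<in> F d"
      "\<And>q. q \<in> W \<Longrightarrow> b q \<noteq> 0" "\<And>q. q \<in> W \<Longrightarrow> f q = a q / b q"
      by (rule regularD[OF f p], blast)
    show "quotient_near Z F U g p"
      by (rule quotient_nearI[OF *(1-5)]) (use * g in auto)
  qed
  show "f \<in> regular X V" if f: "f \<in> regular X U" and V: "openin (zariski X) V \<and> V \<subseteq> U" for f V
  proof (rule regularI)
    fix p assume p: "p \<in> V"
    then have pU: "p \<in> U" using V by auto
    obtain W d a b where *: "openin (zariski X) W" "p \<in> W" "W \<subseteq> U" "a \<in> F d" "b \<in> F d"
      "\<And>q. q \<in> W \<Longrightarrow> b q \<noteq> 0" "\<And>q. q \<in> W \<Longrightarrow> f q = a q / b q"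
      by (rule regularD[OF f pU], blast)
    show "quotient_near Z F V f p"
      by (rule quotient_nearI[where F = F and W = "W \<inter> V", OF _ _ _ *(4,5)]) (use * V p in auto)
  qed
  show "f \<in> regular X U"
    if f: "\<forall>x\<in>U. \<exists>V. openin (zariski X) V \<and> x \<in> V \<and> V \<subseteq> U \<and> f \<in> regular X V" for f
  proof (rule regularI)
    fix p assume "p \<in> U"
    then obtain V where V: "openin (zariski X) V" "p \<in> V" "V \<subseteq> U" "f \<in> regular X V"
      using f by blast
    obtain W d a b where *: "openin (zariski X) W" "p \<in> W" "W \<subseteq> V" "a \<in> F d" "b \<in> F d"
      "\<And>q. q \<in> W \<Longrightarrow> b q \<noteq> 0" "\<And>q. q \<in> W \<Longrightarrow> f q = a q / b q"
      by (rule regularD[OF V(4,2)], blast)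
    show "quotient_near Z F U f p"
      by (rule quotient_nearI[OF *(1,2) _ *(4,5)]) (use * V(3) in auto)
  qed
  show "openin (zariski X) {x \<in> U. f x \<noteq> 0}" if f: "f \<in> regular X U" for f
  proof (rule openinI)
    fix p assume p: "p \<in> {x \<in> U. f x \<noteq> 0}"
    then have pU: "p \<in> U" by auto
    obtain d a b where 1: "p \<in> Z" "a \<in> F d" "b \<in> F d" "b p \<noteq> 0" "basic b \<subseteq> U"
      "\<And>q. q \<in> Z \<Longrightarrow> b q \<noteq> 0 \<Longrightarrow> f q = a q / b q" by (rule regular_basicD[OF f pU], blast)
    show "\<exists>W. openin (zariski X) W \<and> p \<in> W \<and> W \<subseteq> {x \<in> U. f x \<noteq> 0}"
      by (intro exI[of _ "basic (\<lambda>q. a q * b q)"] conjI openin_basic[OF mult_mem])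
         (use 1 p in auto)
  qed (use UZ in auto)
  show "(\<lambda>x. 1 / f x) \<in> regular X {x \<in> U. f x \<noteq> 0}" if f: "f \<in> regular X U" for f
  proof (rule regularI)
    fix p assume p: "p \<in> {x \<in> U. f x \<noteq> 0}"
    then have pU: "p \<in> U" by auto
    obtain d a b where 1: "p \<in> Z" "a \<in> F d" "b \<in> F d" "b p \<noteq> 0" "basic b \<subseteq> U"
      "\<And>q. q \<in> Z \<Longrightarrow> b q \<noteq> 0 \<Longrightarrow> f q = a q / b q" by (rule regular_basicD[OF f pU], blast)
    have m1: "(\<lambda>q. a q * b q) \<in> F (d + d)"
      by (intro mult_mem 1)
    have m2: "(\<lambda>q. b q * b q) \<in> F (d + d)"
      by (intro mult_mem 1)
    show "quotient_near Z F {x \<in> U. f x \<noteq> 0} (\<lambda>x. 1 / f x) p"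
      by (rule quotient_nearI[OF openin_basic[OF m1] _ _ m2 m1]) (use 1 p in auto)
  qed
qed

lemma power_mem: "f \<in> F d \<Longrightarrow> (\<lambda>x. f x ^ k) \<in> F (k * d)"
proof (induction k)
  case 0
  then show ?case using const_mem[of 1] by simp
next
  case (Suc k)
  then show ?case using mult_mem[of f d "\<lambda>x. f x ^ k" "k * d"] by simp
qed

lemma sum_mem: "(\<And>i. i \<in> A \<Longrightarrow> f i \<in> F d) \<Longrightarrow> (\<lambda>x. \<Sum>i\<in>A. f i x) \<in> F d"
  by (induction A rule: infinite_finite_induct) (auto intro: zero_mem add_mem)

end

text \<open>
  The factor \<open>e\<close> is an arbitrary function without zeros: it absorbs the denominators of \<open>\<phi>\<close> and the choice of
  representatives of projective points. It must be the same for \<open>g\<close> and \<open>h\<close>, so that it cancels in the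
  quotient \<open>g / h\<close>.
\<close>
lemma subspace_morphism:
  assumes "function_system F1" "function_system F2"
    and O1: "openin (zariski (fspace_of Z1 F1)) O1" and O2: "openin (zariski (fspace_of Z2 F2)) O2"
    and maps: "\<And>z. z \<in> O1 \<Longrightarrow> \<phi> z \<in> O2"
    and pull: "\<And>d g h. g \<in> F2 d \<Longrightarrow> h \<in> F2 d \<Longrightarrow>
        \<exists>d' e. \<exists>g'\<in>F1 d'. \<exists>h'\<in>F1 d'. \<forall>z\<in>O1. e z \<noteq> 0 \<and> g' z = e z * g (\<phi> z) \<and> h' z = e z * h (\<phi> z)"
  shows "is_morphism (open_subspace (fspace_of Z1 F1) O1) (open_subspace (fspace_of Z2 F2) O2) \<phi>"
proof -
  interpret A: function_system Z1 F1 by fact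
  interpret B: function_system Z2 F2 by fact
  have op1: "openin (subtopology (zariski A.X) O1) U \<longleftrightarrow> openin (zariski A.X) U \<and> U \<subseteq> O1" for U
    by (rule openin_open_subtopology[OF O1])
  have op2: "openin (subtopology (zariski B.X) O2) U \<longleftrightarrow> openin (zariski B.X) U \<and> U \<subseteq> O2" for U
    by (rule openin_open_subtopology[OF O2])
  have t1: "topspace (subtopology (zariski A.X) O1) = O1"
    using A.openin_subset_Z[OF O1] A.points_eq by auto
  have t2: "topspace (subtopology (zariski B.X) O2) = O2"
    using B.openin_subset_Z[OF O2] B.points_eq by auto
  have O1Z: "O1 \<subseteq> Z1" and O2Z: "O2 \<subseteq> Z2"
    using A.openin_subset_Z[OF O1] B.openin_subset_Z[OF O2] by auto
  show ?thesis
    unfolding is_morphism_def open_subspace_def fspace.simps t1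
  proof (intro conjI allI impI)
    show "continuous_map (subtopology (zariski A.X) O1) (subtopology (zariski B.X) O2) \<phi>"
      unfolding continuous_map_def t1 t2 op1 op2
    proof (intro conjI allI impI)
      show "\<phi> \<in> O1 \<rightarrow> O2"
        using maps by auto
      fix U assume U: "openin (zariski B.X) U \<and> U \<subseteq> O2"
      show "openin (zariski A.X) {x \<in> O1. \<phi> x \<in> U}"
      proof (rule A.openinI)
        fix z assume z: "z \<in> {x \<in> O1. \<phi> x \<in> U}"
        then obtain d g where g: "g \<in> F2 d" "g (\<phi> z) \<noteq> 0" "B.basic g \<subseteq> U"
          using B.openinD[of U "\<phi> z"] U by auto
        obtain d' e g' where g': "g' \<in> F1 d'" "\<And>z. z \<in> O1 \<Longrightarrow> e z \<noteq> 0 \<and> g' z = e z * g (\<phi> z)"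
          using pull[OF g(1) g(1)] by blast
        show "\<exists>W. openin (zariski A.X) W \<and> z \<in> W \<and> W \<subseteq> {x \<in> O1. \<phi> x \<in> U}"
        proof (intro exI[of _ "O1 \<inter> A.basic g'"] conjI)
          show "openin (zariski A.X) (O1 \<inter> A.basic g')"
            by (intro openin_Int O1 A.openin_basic[OF g'(1)])
          show "z \<in> O1 \<inter> A.basic g'"
            using z g' g O1Z by auto
          show "O1 \<inter> A.basic g' \<subseteq> {x \<in> O1. \<phi> x \<in> U}"
            using g' g maps O2Z by fastforce
        qed
      qed (use O1Z in auto)
    qed simp
  next
    fix V f assume V: "openin (subtopology (zariski B.X) O2) V \<and> f \<in> regular B.X V"
    then have VO: "V \<subseteq> O2" and f: "f \<in> regular B.X V"
      by (auto simp: op2)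
    show "(\<lambda>x. f (\<phi> x)) \<in> regular A.X {x \<in> O1. \<phi> x \<in> V}"
    proof (rule regularI)
      fix z assume z: "z \<in> {x \<in> O1. \<phi> x \<in> V}"
      then have "\<phi> z \<in> V" by simp
      then obtain d g h where *: "\<phi> z \<in> Z2" "g \<in> F2 d" "h \<in> F2 d" "h (\<phi> z) \<noteq> 0" "B.basic h \<subseteq> V"
        "\<And>q. q \<in> Z2 \<Longrightarrow> h q \<noteq> 0 \<Longrightarrow> f q = g q / h q" by (rule B.regular_basicD[OF f], blast)
      obtain d' e g' h' where gh: "g' \<in> F1 d'" "h' \<in> F1 d'"
        "\<And>z. z \<in> O1 \<Longrightarrow> e z \<noteq> 0 \<and> g' z = e z * g (\<phi> z) \<and> h' z = e z * h (\<phi> z)"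
        using pull[OF *(2,3)] by blast
      show "quotient_near Z1 F1 {x \<in> O1. \<phi> x \<in> V} (\<lambda>x. f (\<phi> x)) z"
      proof (rule quotient_nearI[where F = F1, OF _ _ _ gh(1,2)])
        show "openin (zariski A.X) (O1 \<inter> A.basic h')"
          by (intro openin_Int O1 A.openin_basic[OF gh(2)])
        show "z \<in> O1 \<inter> A.basic h'"
          using z gh * O1Z by auto
        show "O1 \<inter> A.basic h' \<subseteq> {x \<in> O1. \<phi> x \<in> V}"
          using gh * maps O2Z by fastforce
        fix q assume q: "q \<in> O1 \<inter> A.basic h'"
        then have "\<phi> q \<in> Z2" "h (\<phi> q) \<noteq> 0" "e q \<noteq> 0" "g' q = e q * g (\<phi> q)" "h' q = e q * h (\<phi> q)"
            using gh maps O2Z by auto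
        then show "h' q \<noteq> 0 \<and> f (\<phi> q) = g' q / h' q"
          using *(6) by simp
      qed
    qed
  qed
qed

lemma openin_product_basic:
  assumes "openin (zariski A) U" "openin (zariski B) V" "G \<in> tensor_functions A B U V"
  shows "openin (product_topology_fs A B) {z \<in> U \<times> V. G z \<noteq> 0}"
  unfolding product_topology_fs_def by (rule topology_generated_by_Basis) (use assms in blast)

lemma tensor_functions_sumI:
  assumes "finite J" "\<And>j. j \<in> J \<Longrightarrow> a j \<in> regular A U" "\<And>j. j \<in> J \<Longrightarrow> b j \<in> regular B V"
  shows "(\<lambda>(x, y). \<Sum>j\<in>J. a j x * b j y) \<in> tensor_functions A B U V"
proof -
  obtain \<pi> where \<pi>: "bij_betw \<pi> {..<card J} J"
    using ex_bij_betw_nat_finite[OF assms(1)] by (auto simp: atLeast0LessThan)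
  have "(\<Sum>j\<in>J. a j x * b j y) = (\<Sum>i<card J. a (\<pi> i) x * b (\<pi> i) y)" for x y
    using sum.reindex_bij_betw[OF \<pi>, of "\<lambda>j. a j x * b j y"] by simp
  moreover have "\<forall>i<card J. a (\<pi> i) \<in> regular A U \<and> b (\<pi> i) \<in> regular B V"
    using assms \<pi> by (auto simp: bij_betw_def)
  ultimately show ?thesis
    unfolding tensor_functions_def mem_Collect_eq
    by (intro exI[of _ "card J"] exI[of _ "\<lambda>i. a (\<pi> i)"] exI[of _ "\<lambda>i. b (\<pi> i)"]) auto
qed

lemma topspace_product:
  assumes "(\<lambda>_. 1) \<in> regular A (points A)" "(\<lambda>_. 1) \<in> regular B (points B)"
  shows "topspace (product_topology_fs A B) = points A \<times> points B"
proof
  show "topspace (product_topology_fs A B) \<subseteq> points A \<times> points B"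
    unfolding product_topology_fs_def by (auto dest: openin_subset)
  have "(\<lambda>(x, y). \<Sum>j\<in>{0::nat}. 1 * 1) \<in> tensor_functions A B (points A) (points B)"
    by (rule tensor_functions_sumI) (use assms in auto)
  from openin_subset[OF openin_product_basic[OF _ _ this]]
  show "points A \<times> points B \<subseteq> topspace (product_topology_fs A B)"
    by auto
qed

text \<open>
  The analogue of \<open>subspace_morphism\<close> for maps out of a product. The pulled back functions only have
  to be tensors near each point, since projective coordinates become regular functions only after
  division by a coordinate that does not vanish there.
\<close>
lemma product_morphism:
  assumes one: "(\<lambda>_. 1) \<in> regular A (points A)" "(\<lambda>_. 1) \<in> regular B (points B)"
    and fs: "function_system F"
    and maps: "\<And>x y. x \<in> points A \<Longrightarrow> y \<in> points B \<Longrightarrow> \<phi> (x, y) \<in> Z"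
    and pull: "\<And>d g h z. g \<in> F d \<Longrightarrow> h \<in> F d \<Longrightarrow> z \<in> points A \<times> points B \<Longrightarrow>
        \<exists>U V e G H. G \<in> tensor_functions A B U V \<and> H \<in> tensor_functions A B U V \<and>
          openin (zariski A) U \<and> openin (zariski B) V \<and> z \<in> U \<times> V \<and>
          (\<forall>z\<in>U \<times> V. e z \<noteq> 0 \<and> G z = e z * g (\<phi> z) \<and> H z = e z * h (\<phi> z))"
  shows "is_morphism (product_space A B) (fspace_of Z F) \<phi>"
proof -
  interpret function_system Z F by fact
  let ?T = "product_topology_fs A B"
  have t: "topspace ?T = points A \<times> points B"
    by (rule topspace_product[OF one])
  have sub: "U \<times> V \<subseteq> points A \<times> points B" if "openin (zariski A) U" "openin (zariski B) V" for U V
    using openin_subset[OF that(1)] openin_subset[OF that(2)] by blast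
  show ?thesis
    unfolding is_morphism_def product_space_def fspace.simps t
  proof (intro conjI allI impI)
    show "continuous_map ?T (zariski X) \<phi>"
      unfolding continuous_map_def t points_eq
    proof (intro conjI allI impI)
      show "\<phi> \<in> points A \<times> points B \<rightarrow> Z"
        using maps by auto
      fix W assume W: "openin (zariski X) W"
      show "openin ?T {z \<in> points A \<times> points B. \<phi> z \<in> W}"
      proof (subst openin_subopen, rule ballI)
        fix z assume z: "z \<in> {z \<in> points A \<times> points B. \<phi> z \<in> W}"
        then obtain d g where g: "g \<in> F d" "g (\<phi> z) \<noteq> 0" "basic g \<subseteq> W"
          using openinD[OF W, of "\<phi> z"] by blast
        have "z \<in> points A \<times> points B"
          using z by simp
        from pull[OF g(1) g(1) this] obtain U V e G H where
          *: "G \<in> tensor_functions A B U V \<and> H \<in> tensor_functions A B U V \<and>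
          openin (zariski A) U \<and> openin (zariski B) V \<and> z \<in> U \<times> V \<and>
          (\<forall>z\<in>U \<times> V. e z \<noteq> 0 \<and> G z = e z * g (\<phi> z) \<and> H z = e z * g (\<phi> z))"
          by (elim exE)
        then have G: "G \<in> tensor_functions A B U V" "openin (zariski A) U" "openin (zariski B) V"
          "z \<in> U \<times> V"
          by (simp_all only: simp_thms)
        have Ge: "e z \<noteq> 0 \<and> G z = e z * g (\<phi> z)" if "z \<in> U \<times> V" for z
          using bspec[OF *[THEN conjunct2, THEN conjunct2, THEN conjunct2, THEN conjunct2, THEN conjunct2] that]
          by (elim conjE) (intro conjI)
        note G = G Ge
        have "{z \<in> U \<times> V. G z \<noteq> 0} \<subseteq> {z \<in> points A \<times> points B. \<phi> z \<in> W}"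
        proof
          fix w assume w: "w \<in> {z \<in> U \<times> V. G z \<noteq> 0}"
          then have wp: "w \<in> points A \<times> points B"
            using sub[OF G(2,3)] by blast
          have "\<phi> w \<in> Z"
            using wp maps by (cases w) auto
          moreover have "g (\<phi> w) \<noteq> 0"
            using w Ge[of w] by auto
          ultimately show "w \<in> {z \<in> points A \<times> points B. \<phi> z \<in> W}"
            using g(3) wp by blast
        qed
        moreover have "z \<in> {z \<in> U \<times> V. G z \<noteq> 0}"
          using G g by auto
        ultimately show "\<exists>T. openin ?T T \<and> z \<in> T \<and> T \<subseteq> {z \<in> points A \<times> points B. \<phi> z \<in> W}"
          using openin_product_basic[OF G(2,3,1)] by blast
      qed
    qed
  next
    fix W f assume W: "openin (zariski X) W \<and> f \<in> regular X W"
    show "(\<lambda>z. f (\<phi> z)) \<in> {f. \<forall>z\<in>{z \<in> points A \<times> points B. \<phi> z \<in> W}. \<exists>W' U V F G.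
        openin ?T W' \<and> z \<in> W' \<and> W' \<subseteq> {z \<in> points A \<times> points B. \<phi> z \<in> W} \<and> W' \<subseteq> U \<times> V \<and>
        openin (zariski A) U \<and> openin (zariski B) V \<and>
        F \<in> tensor_functions A B U V \<and> G \<in> tensor_functions A B U V \<and>
        (\<forall>w\<in>W'. G w \<noteq> 0 \<and> f w = F w / G w)}"
    proof (intro CollectI ballI)
      fix z assume z: "z \<in> {z \<in> points A \<times> points B. \<phi> z \<in> W}"
      then have "\<phi> z \<in> W" by simp
      then obtain d g h where *: "\<phi> z \<in> Z" "g \<in> F d" "h \<in> F d" "h (\<phi> z) \<noteq> 0" "basic h \<subseteq> W"
        "\<And>q. q \<in> Z \<Longrightarrow> h q \<noteq> 0 \<Longrightarrow> f q = g q / h q" by (rule regular_basicD[OF conjunct2[OF W]], blast)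
      have "z \<in> points A \<times> points B"
        using z by simp
      from pull[OF *(2,3) this] obtain U V e G H where
        **: "G \<in> tensor_functions A B U V \<and> H \<in> tensor_functions A B U V \<and>
        openin (zariski A) U \<and> openin (zariski B) V \<and> z \<in> U \<times> V \<and>
        (\<forall>z\<in>U \<times> V. e z \<noteq> 0 \<and> G z = e z * g (\<phi> z) \<and> H z = e z * h (\<phi> z))"
        by (elim exE)
      then have G: "G \<in> tensor_functions A B U V" "H \<in> tensor_functions A B U V"
          "openin (zariski A) U" "openin (zariski B) V"
          "z \<in> U \<times> V"
        by (simp_all only: simp_thms)
      have Ge: "e z \<noteq> 0 \<and> G z = e z * g (\<phi> z) \<and> H z = e z * h (\<phi> z)" if "z \<in> U \<times> V" for z
        by (rule bspec[OF **[THEN conjunct2, THEN conjunct2, THEN conjunct2, THEN conjunct2, THEN conjunct2] that])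
      note G = G Ge
      let ?W = "{z \<in> U \<times> V. H z \<noteq> 0}"
      have 1: "?W \<subseteq> {z \<in> points A \<times> points B. \<phi> z \<in> W}"
      proof
        fix w assume w: "w \<in> ?W"
        then have wp: "w \<in> points A \<times> points B"
          using sub[OF G(3,4)] by blast
        have "\<phi> w \<in> Z"
          using wp maps by (cases w) auto
        moreover have "h (\<phi> w) \<noteq> 0"
          using w Ge[of w] by auto
        ultimately show "w \<in> {z \<in> points A \<times> points B. \<phi> z \<in> W}"
          using *(5) wp by blast
      qed
      have 2: "\<forall>w\<in>?W. H w \<noteq> 0 \<and> f (\<phi> w) = G w / H w"
      proof
        fix w assume w: "w \<in> ?W"
        then have "\<phi> w \<in> Z" "h (\<phi> w) \<noteq> 0" "e w \<noteq> 0" "G w = e w * g (\<phi> w)" "H w = e w * h (\<phi> w)"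
          using 1 openin_subset_Z W G by auto
        then show "H w \<noteq> 0 \<and> f (\<phi> w) = G w / H w"
          using *(6) by simp
      qed
      show "\<exists>W' U V F G.
        openin ?T W' \<and> z \<in> W' \<and> W' \<subseteq> {z \<in> points A \<times> points B. \<phi> z \<in> W} \<and> W' \<subseteq> U \<times> V \<and>
        openin (zariski A) U \<and> openin (zariski B) V \<and>
        F \<in> tensor_functions A B U V \<and> G \<in> tensor_functions A B U V \<and>
        (\<forall>w\<in>W'. G w \<noteq> 0 \<and> f (\<phi> w) = F w / G w)"
        by (rule exI[of _ ?W], rule exI[of _ U], rule exI[of _ V], rule exI[of _ G], rule exI[of _ H],
            intro conjI openin_product_basic 1 2 G) (use G * in auto)
    qed
  qed
qed

section \<open>Fractions and integral equations\<close>

context domain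
begin

abbreviation Q where "Q \<equiv> fraction_field R"

lemma fraction_eq_iff:
  assumes "a \<in> carrier R" "b \<in> carrier R - {\<zero>}" "c \<in> carrier R" "d \<in> carrier R - {\<zero>}"
  shows "fraction R a b = fraction R c d \<longleftrightarrow> a \<otimes> d = c \<otimes> b"
proof
  assume "fraction R a b = fraction R c d"
  moreover have "(c, d) \<in> fraction R c d"
    using assms by (simp add: fraction_def)
  ultimately have "(c, d) \<in> fraction R a b"
    by simp
  then show "a \<otimes> d = c \<otimes> b"
    by (simp add: fraction_def)
next
  assume eq: "a \<otimes> d = c \<otimes> b"
  have "a \<otimes> f = e \<otimes> b \<longleftrightarrow> c \<otimes> f = e \<otimes> d" if "e \<in> carrier R" "f \<in> carrier R" for e f
  proof -
    have "a \<otimes> f = e \<otimes> b \<longleftrightarrow> d \<otimes> (a \<otimes> f) = d \<otimes> (e \<otimes> b)"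
      using assms that by (intro m_lcancel[symmetric]) auto
    also have "d \<otimes> (a \<otimes> f) = (a \<otimes> d) \<otimes> f"
      using assms that by (auto simp: m_ac)
    also have "\<dots> = b \<otimes> (c \<otimes> f)"
      unfolding eq using assms that by (auto simp: m_ac)
    also have "d \<otimes> (e \<otimes> b) = b \<otimes> (e \<otimes> d)"
      using assms that by (auto simp: m_ac)
    also have "b \<otimes> (c \<otimes> f) = b \<otimes> (e \<otimes> d) \<longleftrightarrow> c \<otimes> f = e \<otimes> d"
      using assms that by (intro m_lcancel) auto
    finally show ?thesis .
  qed
  then show "fraction R a b = fraction R c d"
    unfolding fraction_def by auto
qed

lemma fraction_memD:
  assumes "a \<in> carrier R" "b \<in> carrier R - {\<zero>}" "(c, d) \<in> fraction R a b"
  shows "c \<in> carrier R" "d \<in> carrier R - {\<zero>}" "a \<otimes> d = c \<otimes> b"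
  using assms by (auto simp: fraction_def)

lemma nonzero_mult: "b \<in> carrier R - {\<zero>} \<Longrightarrow> d \<in> carrier R - {\<zero>} \<Longrightarrow> b \<otimes> d \<in> carrier R - {\<zero>}"
  by (auto simp: integral_iff)

lemma nonzero_pow: "b \<in> carrier R - {\<zero>} \<Longrightarrow> b [^] (k::nat) \<in> carrier R - {\<zero>}"
  by (induction k) (use nonzero_mult in auto)

lemma fraction_self: "a \<in> carrier R \<Longrightarrow> b \<in> carrier R - {\<zero>} \<Longrightarrow> (a, b) \<in> fraction R a b"
  by (simp add: fraction_def)

lemma fraction_mult:
  assumes "a \<in> carrier R" "b \<in> carrier R - {\<zero>}" "c \<in> carrier R" "d \<in> carrier R - {\<zero>}"
  shows "fraction R a b \<otimes>\<^bsub>Q\<^esub> fraction R c d = fraction R (a \<otimes> c) (b \<otimes> d)"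
proof -
  have "fraction R (a' \<otimes> c') (b' \<otimes> d') = fraction R (a \<otimes> c) (b \<otimes> d)"
    if 1: "(a', b') \<in> fraction R a b" and 2: "(c', d') \<in> fraction R c d" for a' b' c' d'
  proof -
    note 3 = fraction_memD[OF assms(1,2) 1] fraction_memD[OF assms(3,4) 2]
    have c: "a \<in> carrier R" "b \<in> carrier R" "c \<in> carrier R" "d \<in> carrier R"
      "a' \<in> carrier R" "b' \<in> carrier R" "c' \<in> carrier R" "d' \<in> carrier R"
      using assms 3 by auto
    have "(a' \<otimes> c') \<otimes> (b \<otimes> d) = (a' \<otimes> b) \<otimes> (c' \<otimes> d)"
      using c by (simp add: m_ac)
    also have "\<dots> = (a \<otimes> b') \<otimes> (c \<otimes> d')"
      by (simp only: 3(3,6))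
    also have "\<dots> = (a \<otimes> c) \<otimes> (b' \<otimes> d')"
      using c by (simp add: m_ac)
    finally show ?thesis
      using assms 3 by (subst fraction_eq_iff) (auto simp: integral_iff)
  qed
  then have "(\<Union>(a', b')\<in>fraction R a b. \<Union>(c', d')\<in>fraction R c d. fraction R (a' \<otimes> c') (b' \<otimes> d'))
      = (\<Union>(a', b')\<in>fraction R a b. \<Union>(c', d')\<in>fraction R c d. fraction R (a \<otimes> c) (b \<otimes> d))"
    by (intro SUP_cong refl) auto
  also have "\<dots> = fraction R (a \<otimes> c) (b \<otimes> d)"
    using fraction_self[OF assms(1,2)] fraction_self[OF assms(3,4)] by auto
  finally show ?thesis
    by (simp add: fraction_field_def)
qed

lemma fraction_add:
  assumes "a \<in> carrier R" "b \<in> carrier R - {\<zero>}" "c \<in> carrier R" "d \<in> carrier R - {\<zero>}"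
  shows "fraction R a b \<oplus>\<^bsub>Q\<^esub> fraction R c d = fraction R (a \<otimes> d \<oplus> c \<otimes> b) (b \<otimes> d)"
proof -
  have "fraction R (a' \<otimes> d' \<oplus> c' \<otimes> b') (b' \<otimes> d') = fraction R (a \<otimes> d \<oplus> c \<otimes> b) (b \<otimes> d)"
    if 1: "(a', b') \<in> fraction R a b" and 2: "(c', d') \<in> fraction R c d" for a' b' c' d'
  proof -
    note 3 = fraction_memD[OF assms(1,2) 1] fraction_memD[OF assms(3,4) 2]
    have c: "a \<in> carrier R" "b \<in> carrier R" "c \<in> carrier R" "d \<in> carrier R"
      "a' \<in> carrier R" "b' \<in> carrier R" "c' \<in> carrier R" "d' \<in> carrier R"
      using assms 3 by auto
    have "(a' \<otimes> d' \<oplus> c' \<otimes> b') \<otimes> (b \<otimes> d) = (a' \<otimes> b) \<otimes> (d' \<otimes> d) \<oplus> (c' \<otimes> d) \<otimes> (b' \<otimes> b)"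
      using c by (simp add: l_distr r_distr m_ac)
    also have "\<dots> = (a \<otimes> b') \<otimes> (d' \<otimes> d) \<oplus> (c \<otimes> d') \<otimes> (b' \<otimes> b)"
      by (simp only: 3(3,6))
    also have "\<dots> = (a \<otimes> d \<oplus> c \<otimes> b) \<otimes> (b' \<otimes> d')"
      using c by (simp add: l_distr r_distr m_ac)
    finally show ?thesis
      using assms 3 by (subst fraction_eq_iff) (auto simp: integral_iff)
  qed
  then have "(\<Union>(a', b')\<in>fraction R a b. \<Union>(c', d')\<in>fraction R c d. fraction R (a' \<otimes> d' \<oplus> c' \<otimes> b') (b' \<otimes> d'))
      = (\<Union>(a', b')\<in>fraction R a b. \<Union>(c', d')\<in>fraction R c d. fraction R (a \<otimes> d \<oplus> c \<otimes> b) (b \<otimes> d))"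
    by (intro SUP_cong refl) auto
  also have "\<dots> = fraction R (a \<otimes> d \<oplus> c \<otimes> b) (b \<otimes> d)"
    using fraction_self[OF assms(1,2)] fraction_self[OF assms(3,4)] by auto
  finally show ?thesis
    by (simp add: fraction_field_def)
qed

lemma one_nonzero: "\<one> \<in> carrier R - {\<zero>}"
  by auto

lemma fraction_carrier:
  assumes "a \<in> carrier R" "b \<in> carrier R - {\<zero>}"
  shows "fraction R a b \<in> carrier Q"
  using assms unfolding fraction_field_def by auto

lemma fraction_carrierE:
  assumes "z \<in> carrier Q"
  obtains a b where "a \<in> carrier R" "b \<in> carrier R - {\<zero>}" "z = fraction R a b"
  using assms unfolding fraction_field_def by auto

lemma fraction_zero: "\<zero>\<^bsub>Q\<^esub> = fraction R \<zero> \<one>"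
  by (simp add: fraction_field_def)

lemma fraction_one: "\<one>\<^bsub>Q\<^esub> = fraction R \<one> \<one>"
  by (simp add: fraction_field_def)

lemma fraction_add_same:
  assumes "a \<in> carrier R" "c \<in> carrier R" "b \<in> carrier R - {\<zero>}"
  shows "fraction R a b \<oplus>\<^bsub>Q\<^esub> fraction R c b = fraction R (a \<oplus> c) b"
  unfolding fraction_add[OF assms(1,3,2,3)]
  using assms by (subst fraction_eq_iff) (auto simp: integral_iff l_distr r_distr m_ac)

text \<open>
  The structure needed to evaluate the finite sum in an integral equation.
\<close>
lemma fraction_field_abelian_monoid: "abelian_monoid Q"
proof (rule abelian_monoidI)
  fix x y assume "x \<in> carrier Q" "y \<in> carrier Q"
  then obtain a b c d where 1: "a \<in> carrier R" "b \<in> carrier R - {\<zero>}" "x = fraction R a b"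
     "c \<in> carrier R" "d \<in> carrier R - {\<zero>}" "y = fraction R c d"
    by (elim fraction_carrierE)
  show "x \<oplus>\<^bsub>Q\<^esub> y \<in> carrier Q"
    unfolding 1(3,6) fraction_add[OF 1(1,2,4,5)] using 1
    by (intro fraction_carrier) (auto simp: integral_iff)
  show "x \<oplus>\<^bsub>Q\<^esub> y = y \<oplus>\<^bsub>Q\<^esub> x"
    unfolding 1(3,6) fraction_add[OF 1(1,2,4,5)] fraction_add[OF 1(4,5,1,2)]
    using 1 by (auto simp: m_ac a_ac)
next
  show "\<zero>\<^bsub>Q\<^esub> \<in> carrier Q"
    unfolding fraction_zero by (rule fraction_carrier) auto
next
  fix x y z assume "x \<in> carrier Q" "y \<in> carrier Q" "z \<in> carrier Q"
  then obtain a b c d e f where 1: "a \<in> carrier R" "b \<in> carrier R - {\<zero>}" "x = fraction R a b"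
     "c \<in> carrier R" "d \<in> carrier R - {\<zero>}" "y = fraction R c d"
     "e \<in> carrier R" "f \<in> carrier R - {\<zero>}" "z = fraction R e f"
    by (elim fraction_carrierE)
  have 2: "a \<otimes> d \<oplus> c \<otimes> b \<in> carrier R" "c \<otimes> f \<oplus> e \<otimes> d \<in> carrier R"
    using 1 by auto
  have "((a \<otimes> d \<oplus> c \<otimes> b) \<otimes> f \<oplus> e \<otimes> (b \<otimes> d)) = (a \<otimes> (d \<otimes> f) \<oplus> (c \<otimes> f \<oplus> e \<otimes> d) \<otimes> b)"
    using 1 by (auto simp: l_distr r_distr m_ac a_ac)
  moreover have "b \<otimes> d \<otimes> f = b \<otimes> (d \<otimes> f)"
    using 1 by (auto simp: m_ac)
  ultimately show "(x \<oplus>\<^bsub>Q\<^esub> y) \<oplus>\<^bsub>Q\<^esub> z = x \<oplus>\<^bsub>Q\<^esub> (y \<oplus>\<^bsub>Q\<^esub> z)"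
    unfolding 1(3,6,9) fraction_add[OF 1(1,2,4,5)] fraction_add[OF 1(4,5,7,8)]
      fraction_add[OF 2(1) nonzero_mult[OF 1(2,5)] 1(7,8)]
      fraction_add[OF 1(1,2) 2(2) nonzero_mult[OF 1(5,8)]]
    by simp
next
  fix x assume "x \<in> carrier Q"
  then obtain a b where 1: "a \<in> carrier R" "b \<in> carrier R - {\<zero>}" "x = fraction R a b"
    by (elim fraction_carrierE)
  show "\<zero>\<^bsub>Q\<^esub> \<oplus>\<^bsub>Q\<^esub> x = x"
    unfolding fraction_zero 1(3) fraction_add[OF zero_closed one_nonzero 1(1,2)]
    using 1 by auto
qed

lemma fraction_pow:
  assumes "a \<in> carrier R" "b \<in> carrier R - {\<zero>}"
  shows "fraction R a b [^]\<^bsub>Q\<^esub> (k::nat) = fraction R (a [^] k) (b [^] k)"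
proof (induction k)
  case 0
  show ?case by (simp add: nat_pow_def fraction_one)
next
  case (Suc k)
  have "fraction R a b [^]\<^bsub>Q\<^esub> Suc k
      = fraction R a b [^]\<^bsub>Q\<^esub> k \<otimes>\<^bsub>Q\<^esub> fraction R a b"
    by (simp add: nat_pow_def)
  then show ?case
    using assms nonzero_pow[OF assms(2), of k] by (simp add: Suc fraction_mult)
qed

lemma fraction_finsum:
  assumes "\<And>i. i < (l::nat) \<Longrightarrow> x i \<in> carrier R" "b \<in> carrier R - {\<zero>}"
  shows "(\<Oplus>\<^bsub>Q\<^esub>i\<in>{..<l}. fraction R (x i) b) = fraction R (\<Oplus>i\<in>{..<l}. x i) b"
  using assms(1)
proof (induction l)
  interpret K: abelian_monoid Q
    by (rule fraction_field_abelian_monoid)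
  case 0
  show ?case
    using assms(2) by (simp add: fraction_zero, subst fraction_eq_iff) auto
next
  interpret K: abelian_monoid Q
    by (rule fraction_field_abelian_monoid)
  case (Suc l)
  have "(\<Oplus>\<^bsub>Q\<^esub>i\<in>insert l {..<l}. fraction R (x i) b)
      = fraction R (x l) b \<oplus>\<^bsub>Q\<^esub> (\<Oplus>\<^bsub>Q\<^esub>i\<in>{..<l}. fraction R (x i) b)"
    by (rule K.finsum_insert) (use Suc.prems assms(2) in \<open>auto intro!: fraction_carrier\<close>)
  also have "\<dots> = fraction R (x l) b \<oplus>\<^bsub>Q\<^esub> fraction R (\<Oplus>i\<in>{..<l}. x i) b"
    using Suc by simp
  also have "\<dots> = fraction R (x l \<oplus> (\<Oplus>i\<in>{..<l}. x i)) b"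
    by (rule fraction_add_same) (use Suc.prems assms(2) in auto)
  also have "x l \<oplus> (\<Oplus>i\<in>{..<l}. x i) = (\<Oplus>i\<in>insert l {..<l}. x i)"
    by (rule finsum_insert[symmetric]) (use Suc.prems in auto)
  finally show ?case
    by (simp only: lessThan_Suc)
qed

text \<open>
  Over the common denominator \<open>b\<^sup>k\<close> an integral equation for \<open>a / b\<close> becomes the homogeneous equation
  between its numerators.
\<close>
lemma integral_fractionE:
  assumes "integral_fraction R z" "z = fraction R a b" "a \<in> carrier R" "b \<in> carrier R - {\<zero>}"
  obtains k c where "\<And>i. i < k \<Longrightarrow> c i \<in> carrier R"
    "a [^] (k::nat) \<oplus> (\<Oplus>i\<in>{..<k}. c i \<otimes> a [^] i \<otimes> b [^] (k - i)) = \<zero>"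
proof -
  interpret K: abelian_monoid Q
    by (rule fraction_field_abelian_monoid)
  obtain k :: nat and c where c: "\<And>i. i < k \<Longrightarrow> c i \<in> carrier R"
    and eq: "z [^]\<^bsub>Q\<^esub> k \<oplus>\<^bsub>Q\<^esub>
          (\<Oplus>\<^bsub>Q\<^esub>i\<in>{..<k}.
             embed_fraction R (c i) \<otimes>\<^bsub>Q\<^esub> z [^]\<^bsub>Q\<^esub> i)
        = \<zero>\<^bsub>Q\<^esub>"
    using assms(1) unfolding integral_fraction_def by blast
  let ?x = "\<lambda>i. c i \<otimes> a [^] i \<otimes> b [^] (k - i)"
  have bk: "b [^] i \<in> carrier R - {\<zero>}" for i :: nat
    by (rule nonzero_pow[OF assms(4)])
  have x: "?x i \<in> carrier R" if "i < k" for i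
    using c[OF that] assms by auto
  have summand: "embed_fraction R (c i) \<otimes>\<^bsub>Q\<^esub> z [^]\<^bsub>Q\<^esub> i = fraction R (?x i) (b [^] k)"
    if i: "i < k" for i
  proof -
    have "embed_fraction R (c i) \<otimes>\<^bsub>Q\<^esub> z [^]\<^bsub>Q\<^esub> i
       = fraction R (c i \<otimes> a [^] i) (\<one> \<otimes> b [^] i)"
      unfolding assms(2) embed_fraction_def fraction_pow[OF assms(3,4)]
      using c[OF i] assms bk by (intro fraction_mult) auto
    also have "\<dots> = fraction R (?x i) (b [^] k)"
    proof -
      have "b [^] k = b [^] (k - i) \<otimes> b [^] i"
        using i assms by (simp add: nat_pow_mult)
      then have "c i \<otimes> a [^] i \<otimes> b [^] k = ?x i \<otimes> (\<one> \<otimes> b [^] i)"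
        using c[OF i] assms by (simp add: m_ac)
      then show ?thesis
        using c[OF i] assms bk x[OF i] by (subst fraction_eq_iff) auto
    qed
    finally show ?thesis .
  qed
  have "(\<Oplus>\<^bsub>Q\<^esub>i\<in>{..<k}.
             embed_fraction R (c i) \<otimes>\<^bsub>Q\<^esub> z [^]\<^bsub>Q\<^esub> i)
      = (\<Oplus>\<^bsub>Q\<^esub>i\<in>{..<k}. fraction R (?x i) (b [^] k))"
    by (rule K.finsum_cong') (use summand x bk in \<open>auto intro!: fraction_carrier\<close>)
  also have "\<dots> = fraction R (\<Oplus>i\<in>{..<k}. ?x i) (b [^] k)"
    by (rule fraction_finsum) (use x bk in auto)
  finally have "fraction R (a [^] k) (b [^] k) \<oplus>\<^bsub>Q\<^esub> fraction R (\<Oplus>i\<in>{..<k}. ?x i) (b [^] k) = fraction R \<zero> \<one>"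
    using eq unfolding assms(2) fraction_pow[OF assms(3,4)] by (simp add: fraction_zero)
  moreover have fs: "(\<Oplus>i\<in>{..<k}. ?x i) \<in> carrier R"
    by (rule finsum_closed) (use x in auto)
  ultimately have "fraction R (a [^] k \<oplus> (\<Oplus>i\<in>{..<k}. ?x i)) (b [^] k) = fraction R \<zero> \<one>"
    using assms(3) bk by (simp add: fraction_add_same)
  then have "(a [^] k \<oplus> (\<Oplus>i\<in>{..<k}. ?x i)) \<otimes> \<one> = \<zero> \<otimes> b [^] k"
    using fs assms(3) bk[of k] by (subst (asm) fraction_eq_iff) auto
  then have "a [^] k \<oplus> (\<Oplus>i\<in>{..<k}. ?x i) = \<zero>"
    using fs assms(3) bk[of k] by auto
  then show ?thesis
    using that c by blast
qed

end

section \<open>Germs\<close>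

locale germ_space =
  fixes X :: "'a fspace" and x :: 'a
  assumes sf: "space_with_functions X" and x: "x \<in> points X"
begin

text \<open>
  The representatives of germs at \<open>x\<close>.
\<close>
definition sec where
  "sec U f \<longleftrightarrow> openin (zariski X) U \<and> x \<in> U \<and> f \<in> regular X U"

abbreviation R where "R \<equiv> local_ring X x"

lemmas sheaf = sf[unfolded space_with_functions_def, THEN spec, THEN mp]

lemma sec_const: "openin (zariski X) U \<Longrightarrow> x \<in> U \<Longrightarrow> sec U (\<lambda>_. c)"
  unfolding sec_def by (intro conjI sheaf[THEN conjunct1, THEN spec])

lemma sec_restrict: "sec U f \<Longrightarrow> openin (zariski X) V \<Longrightarrow> x \<in> V \<Longrightarrow> V \<subseteq> U \<Longrightarrow> sec V f"
  unfolding sec_def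
  using sheaf[of U, THEN conjunct2, THEN conjunct2, THEN conjunct2, THEN conjunct1, THEN bspec, THEN spec, THEN mp, of f V]
  by simp

lemma sec_add_same: "sec U f \<Longrightarrow> sec U g \<Longrightarrow> sec U (\<lambda>y. f y + g y)"
  unfolding sec_def
  using sheaf[of U, THEN conjunct2, THEN conjunct1, THEN bspec, THEN bspec, THEN conjunct1, of f g] by simp

lemma sec_mult_same: "sec U f \<Longrightarrow> sec U g \<Longrightarrow> sec U (\<lambda>y. f y * g y)"
  unfolding sec_def
  using sheaf[of U, THEN conjunct2, THEN conjunct1, THEN bspec, THEN bspec, THEN conjunct2, of f g] by simp

lemma sec_Int: "sec U f \<Longrightarrow> sec V g \<Longrightarrow> sec (U \<inter> V) f" "sec U f \<Longrightarrow> sec V g \<Longrightarrow> sec (U \<inter> V) g"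
  by (auto intro!: sec_restrict[of U f] sec_restrict[of V g]) (auto simp: sec_def)

lemma sec_add: "sec U f \<Longrightarrow> sec V g \<Longrightarrow> sec (U \<inter> V) (\<lambda>y. f y + g y)"
  by (intro sec_add_same sec_Int)

lemma sec_mult: "sec U f \<Longrightarrow> sec V g \<Longrightarrow> sec (U \<inter> V) (\<lambda>y. f y * g y)"
  by (intro sec_mult_same sec_Int)

lemma sec_power: "sec U f \<Longrightarrow> sec U (\<lambda>y. f y ^ k)"
proof (induction k)
  case 0
  then show ?case using sec_const[of U 1] by (simp add: sec_def)
qed (simp add: sec_mult_same)

lemma sec_sum: "openin (zariski X) U \<Longrightarrow> x \<in> U \<Longrightarrow> (\<And>i. i \<in> A \<Longrightarrow> sec U (f i)) \<Longrightarrow> sec U (\<lambda>y. \<Sum>i\<in>A. f i y)"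
  by (induction A rule: infinite_finite_induct) (auto intro: sec_const sec_add_same)

lemma germ_mem_iff:
  "(V, g) \<in> germ X x U f \<longleftrightarrow> sec V g \<and> (\<exists>W. openin (zariski X) W \<and> x \<in> W \<and> W \<subseteq> U \<inter> V \<and> (\<forall>y\<in>W. f y = g y))"
  unfolding germ_def sec_def by auto

lemma germ_self: "sec U f \<Longrightarrow> (U, f) \<in> germ X x U f"
  unfolding germ_mem_iff by (auto simp: sec_def)

lemma germ_eq_iff:
  assumes "sec U f" "sec V g"
  shows "germ X x U f = germ X x V g \<longleftrightarrow>
    (\<exists>W. openin (zariski X) W \<and> x \<in> W \<and> W \<subseteq> U \<inter> V \<and> (\<forall>y\<in>W. f y = g y))" (is "_ \<longleftrightarrow> ?E")
proof
  assume "germ X x U f = germ X x V g"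
  then have "(V, g) \<in> germ X x U f"
    using germ_self[OF assms(2)] by simp
  then show ?E
    unfolding germ_mem_iff by simp
next
  assume ?E
  then obtain W where W: "openin (zariski X) W" "x \<in> W" "W \<subseteq> U \<inter> V" "\<forall>y\<in>W. f y = g y"
    by blast
  have *: "(A, h) \<in> germ X x U' f' \<Longrightarrow> (A, h) \<in> germ X x V' g'"
    if "W \<subseteq> U' \<inter> V'" "\<forall>y\<in>W. f' y = g' y" for A h U' V' f' g'
  proof -
    assume "(A, h) \<in> germ X x U' f'"
    then obtain W' where W': "sec A h" "openin (zariski X) W'" "x \<in> W'" "W' \<subseteq> U' \<inter> A" "\<forall>y\<in>W'. f' y = h y"
      unfolding germ_mem_iff by blast
    then show "(A, h) \<in> germ X x V' g'"
      unfolding germ_mem_iff using that W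
      by (intro conjI exI[of _ "W \<inter> W'"]) (auto intro: openin_Int)
  qed
  show "germ X x U f = germ X x V g"
  proof (rule Set.set_eqI)
    fix p :: "'a set \<times> ('a \<Rightarrow> complex)"
    obtain A h where p: "p = (A, h)" by (cases p)
    show "p \<in> germ X x U f \<longleftrightarrow> p \<in> germ X x V g"
      unfolding p using *[of U V f g A h] *[of V U g f A h] W by auto
  qed
qed

lemma germ_eqI:
  assumes "sec U f" "sec V g" "\<And>y. y \<in> U \<Longrightarrow> y \<in> V \<Longrightarrow> f y = g y"
  shows "germ X x U f = germ X x V g"
  unfolding germ_eq_iff[OF assms(1,2)]
  by (rule exI[of _ "U \<inter> V"]) (use assms in \<open>auto simp: sec_def\<close>)

lemma germ_operation:
  assumes closed: "\<And>U f V g. sec U f \<Longrightarrow> sec V g \<Longrightarrow> sec (U \<inter> V) (\<lambda>y. op (f y) (g y))"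
    and "sec U f" "sec V g"
  shows "(\<Union>(U', f')\<in>germ X x U f. \<Union>(V', g')\<in>germ X x V g. germ X x (U' \<inter> V') (\<lambda>y. op (f' y) (g' y)))
    = germ X x (U \<inter> V) (\<lambda>y. op (f y) (g y))"
proof -
  have "germ X x (U' \<inter> V') (\<lambda>y. op (f' y) (g' y)) = germ X x (U \<inter> V) (\<lambda>y. op (f y) (g y))"
    if 1: "(U', f') \<in> germ X x U f" and 2: "(V', g') \<in> germ X x V g" for U' f' V' g'
  proof -
    obtain W1 where 3: "sec U' f'" "openin (zariski X) W1" "x \<in> W1" "W1 \<subseteq> U \<inter> U'" "\<forall>y\<in>W1. f y = f' y"
      using 1 unfolding germ_mem_iff by blast
    obtain W2 where 4: "sec V' g'" "openin (zariski X) W2" "x \<in> W2" "W2 \<subseteq> V \<inter> V'" "\<forall>y\<in>W2. g y = g' y"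
      using 2 unfolding germ_mem_iff by blast
    show ?thesis
      unfolding germ_eq_iff[OF closed[OF 3(1) 4(1)] closed[OF assms(2,3)]]
      by (rule exI[of _ "W1 \<inter> W2"]) (use 3 4 in auto)
  qed
  then have "(\<Union>(U', f')\<in>germ X x U f. \<Union>(V', g')\<in>germ X x V g. germ X x (U' \<inter> V') (\<lambda>y. op (f' y) (g' y)))
    = (\<Union>(U', f')\<in>germ X x U f. \<Union>(V', g')\<in>germ X x V g. germ X x (U \<inter> V) (\<lambda>y. op (f y) (g y)))"
    by (intro SUP_cong refl) auto
  also have "\<dots> = germ X x (U \<inter> V) (\<lambda>y. op (f y) (g y))"
    using germ_self[OF assms(2)] germ_self[OF assms(3)] by auto
  finally show ?thesis .
qed

lemma germ_mult:
  "sec U f \<Longrightarrow> sec V g \<Longrightarrow> germ X x U f \<otimes>\<^bsub>R\<^esub> germ X x V g = germ X x (U \<inter> V) (\<lambda>y. f y * g y)"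
  using germ_operation[OF sec_mult] by (simp add: local_ring_def)

lemma germ_add:
  "sec U f \<Longrightarrow> sec V g \<Longrightarrow> germ X x U f \<oplus>\<^bsub>R\<^esub> germ X x V g = germ X x (U \<inter> V) (\<lambda>y. f y + g y)"
  using germ_operation[OF sec_add] by (simp add: local_ring_def)

lemma carrierE:
  assumes "r \<in> carrier R"
  obtains U f where "sec U f" "r = germ X x U f"
  using assms unfolding local_ring_def sec_def by auto

lemma carrierI: "sec U f \<Longrightarrow> germ X x U f \<in> carrier R"
  unfolding local_ring_def sec_def by auto

lemma one_eq: "\<one>\<^bsub>R\<^esub> = germ X x (points X) (\<lambda>_. 1)" and zero_eq: "\<zero>\<^bsub>R\<^esub> = germ X x (points X) (\<lambda>_. 0)"
  by (simp_all add: local_ring_def)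

lemma sec_points: "sec (points X) (\<lambda>_. c)"
  by (rule sec_const) (use x in auto)

lemma local_ring_cring: "cring R"
proof (rule cringI)
  show "abelian_group R"
  proof (rule abelian_groupI)
    fix r s assume "r \<in> carrier R" "s \<in> carrier R"
    then obtain U f V g where 1: "sec U f" "r = germ X x U f" "sec V g" "s = germ X x V g"
      by (elim carrierE)
    show "r \<oplus>\<^bsub>R\<^esub> s \<in> carrier R"
      unfolding 1(2,4) germ_add[OF 1(1,3)] by (intro carrierI sec_add 1)
    show "r \<oplus>\<^bsub>R\<^esub> s = s \<oplus>\<^bsub>R\<^esub> r"
      unfolding 1(2,4) germ_add[OF 1(1,3)] germ_add[OF 1(3,1)] by (simp add: Int_commute add.commute)
  next
    show "\<zero>\<^bsub>R\<^esub> \<in> carrier R"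
      unfolding zero_eq by (intro carrierI sec_points)
  next
    fix r s t assume "r \<in> carrier R" "s \<in> carrier R" "t \<in> carrier R"
    then obtain U f V g W h where 1: "sec U f" "r = germ X x U f" "sec V g" "s = germ X x V g" "sec W h" "t = germ X x W h"
      by (elim carrierE)
    show "r \<oplus>\<^bsub>R\<^esub> s \<oplus>\<^bsub>R\<^esub> t = r \<oplus>\<^bsub>R\<^esub> (s \<oplus>\<^bsub>R\<^esub> t)"
      unfolding 1(2,4,6) germ_add[OF 1(1,3)] germ_add[OF 1(3,5)] germ_add[OF sec_add[OF 1(1,3)] 1(5)]
        germ_add[OF 1(1) sec_add[OF 1(3,5)]]
      by (simp add: Int_assoc add.assoc)
  next
    fix r assume "r \<in> carrier R"
    then obtain U f where 1: "sec U f" "r = germ X x U f"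
      by (elim carrierE)
    show "\<zero>\<^bsub>R\<^esub> \<oplus>\<^bsub>R\<^esub> r = r"
      unfolding zero_eq 1(2) germ_add[OF sec_points 1(1)]
      by (rule germ_eqI[OF sec_add[OF sec_points 1(1)] 1(1)]) auto
    have 2: "sec U (\<lambda>y. - 1 * f y)"
      by (intro sec_mult_same 1 sec_const) (use 1 in \<open>auto simp: sec_def\<close>)
    show "\<exists>s\<in>carrier R. s \<oplus>\<^bsub>R\<^esub> r = \<zero>\<^bsub>R\<^esub>"
    proof (rule bexI[OF _ carrierI[OF 2]])
      show "germ X x U (\<lambda>y. - 1 * f y) \<oplus>\<^bsub>R\<^esub> r = \<zero>\<^bsub>R\<^esub>"
        unfolding zero_eq 1(2) germ_add[OF 2 1(1)]
        by (rule germ_eqI[OF sec_add[OF 2 1(1)] sec_points]) auto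
    qed
  qed
  show "comm_monoid R"
  proof (rule comm_monoidI)
    fix r s assume "r \<in> carrier R" "s \<in> carrier R"
    then obtain U f V g where 1: "sec U f" "r = germ X x U f" "sec V g" "s = germ X x V g"
      by (elim carrierE)
    show "r \<otimes>\<^bsub>R\<^esub> s \<in> carrier R"
      unfolding 1(2,4) germ_mult[OF 1(1,3)] by (intro carrierI sec_mult 1)
    show "r \<otimes>\<^bsub>R\<^esub> s = s \<otimes>\<^bsub>R\<^esub> r"
      unfolding 1(2,4) germ_mult[OF 1(1,3)] germ_mult[OF 1(3,1)] by (simp add: Int_commute mult.commute)
  next
    show "\<one>\<^bsub>R\<^esub> \<in> carrier R"
      unfolding one_eq by (intro carrierI sec_points)
  next
    fix r s t assume "r \<in> carrier R" "s \<in> carrier R" "t \<in> carrier R"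
    then obtain U f V g W h where 1: "sec U f" "r = germ X x U f" "sec V g" "s = germ X x V g" "sec W h" "t = germ X x W h"
      by (elim carrierE)
    show "r \<otimes>\<^bsub>R\<^esub> s \<otimes>\<^bsub>R\<^esub> t = r \<otimes>\<^bsub>R\<^esub> (s \<otimes>\<^bsub>R\<^esub> t)"
      unfolding 1(2,4,6) germ_mult[OF 1(1,3)] germ_mult[OF 1(3,5)] germ_mult[OF sec_mult[OF 1(1,3)] 1(5)]
        germ_mult[OF 1(1) sec_mult[OF 1(3,5)]]
      by (simp add: Int_assoc mult.assoc)
  next
    fix r assume "r \<in> carrier R"
    then obtain U f where 1: "sec U f" "r = germ X x U f"
      by (elim carrierE)
    show "\<one>\<^bsub>R\<^esub> \<otimes>\<^bsub>R\<^esub> r = r"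
      unfolding one_eq 1(2) germ_mult[OF sec_points 1(1)]
      by (rule germ_eqI[OF sec_mult[OF sec_points 1(1)] 1(1)]) auto
  qed
  fix r s t assume "r \<in> carrier R" "s \<in> carrier R" "t \<in> carrier R"
  then obtain U f V g W h where 1: "sec U f" "r = germ X x U f" "sec V g" "s = germ X x V g" "sec W h" "t = germ X x W h"
    by (elim carrierE)
  show "(r \<oplus>\<^bsub>R\<^esub> s) \<otimes>\<^bsub>R\<^esub> t = r \<otimes>\<^bsub>R\<^esub> t \<oplus>\<^bsub>R\<^esub> s \<otimes>\<^bsub>R\<^esub> t"
    unfolding 1(2,4,6) germ_add[OF 1(1,3)] germ_mult[OF 1(1,5)] germ_mult[OF 1(3,5)]
      germ_mult[OF sec_add[OF 1(1,3)] 1(5)] germ_add[OF sec_mult[OF 1(1,5)] sec_mult[OF 1(3,5)]]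
    by (rule germ_eqI[OF sec_mult[OF sec_add[OF 1(1,3)] 1(5)] sec_add[OF sec_mult[OF 1(1,5)] sec_mult[OF 1(3,5)]]])
       (auto simp: algebra_simps)
qed

lemma germ_power:
  assumes "sec U f"
  shows "germ X x U f [^]\<^bsub>R\<^esub> (k::nat) = germ X x U (\<lambda>y. f y ^ k)"
proof (induction k)
  case 0
  have "sec U (\<lambda>y. 1)"
    using sec_power[OF assms, of 0] by simp
  then show ?case
    by (simp add: nat_pow_def one_eq) (rule germ_eqI[OF sec_points], auto)
next
  case (Suc k)
  then have "germ X x U f [^]\<^bsub>R\<^esub> Suc k = germ X x U (\<lambda>y. f y ^ k) \<otimes>\<^bsub>R\<^esub> germ X x U f"
    by (simp add: nat_pow_def)
  then show ?case
    by (simp add: germ_mult[OF sec_power[OF assms] assms] mult.commute)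
qed

lemma germ_finsum:
  assumes "openin (zariski X) U" "x \<in> U" "\<And>i. i < (l::nat) \<Longrightarrow> sec U (f i)"
  shows "(\<Oplus>\<^bsub>R\<^esub>i\<in>{..<l}. germ X x U (f i)) = germ X x U (\<lambda>y. \<Sum>i<l. f i y)"
  using assms(3)
proof (induction l)
  interpret cring R by (rule local_ring_cring)
  case 0
  show ?case
    by (simp add: zero_eq) (rule germ_eqI[OF sec_points sec_const], use assms in auto)
next
  interpret cring R by (rule local_ring_cring)
  case (Suc l)
  have 1: "sec U (\<lambda>y. \<Sum>i<l. f i y)"
    by (rule sec_sum) (use assms Suc.prems in auto)
  have 2: "sec U (f l)"
    using Suc.prems by simp
  have "(\<Oplus>\<^bsub>R\<^esub>i\<in>insert l {..<l}. germ X x U (f i))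
      = germ X x U (f l) \<oplus>\<^bsub>R\<^esub> (\<Oplus>\<^bsub>R\<^esub>i\<in>{..<l}. germ X x U (f i))"
    by (rule finsum_insert) (use Suc.prems in \<open>auto intro!: carrierI\<close>)
  also have "\<dots> = germ X x U (f l) \<oplus>\<^bsub>R\<^esub> germ X x U (\<lambda>y. \<Sum>i<l. f i y)"
    using Suc by simp
  finally show ?case
    by (simp add: lessThan_Suc germ_add[OF 2 1])
qed

end

section \<open>Irreducibility and normality of a graded family without zero divisors\<close>

locale integral_system = function_system +
  assumes nonempty: "Z \<noteq> {}"
    and no_zero_divisors: "\<lbrakk>g \<in> F d; h \<in> F e; \<And>z. z \<in> Z \<Longrightarrow> g z * h z = 0\<rbrakk>
          \<Longrightarrow> (\<forall>z\<in>Z. g z = 0) \<or> (\<forall>z\<in>Z. h z = 0)"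
begin

lemma irreducible:
  assumes A: "closedin (zariski X) A" and B: "closedin (zariski X) B" and AB: "A \<union> B = points X"
  shows "A = points X \<or> B = points X"
proof (rule ccontr)
  assume "\<not> ?thesis"
  then obtain a b where ab: "a \<in> points X - A" "b \<in> points X - B"
    using A B closedin_subset by blast
  have oA: "openin (zariski X) (points X - A)" and oB: "openin (zariski X) (points X - B)"
    using A B by (auto simp: closedin_def)
  obtain d g where g: "g \<in> F d" "g a \<noteq> 0" "basic g \<subseteq> points X - A"
    using openinD[OF oA ab(1)] by blast
  obtain e h where h: "h \<in> F e" "h b \<noteq> 0" "basic h \<subseteq> points X - B"
    using openinD[OF oB ab(2)] by blast
  have "g z * h z = 0" if "z \<in> Z" for z
    using that g(3) h(3) AB points_eq by (auto simp: set_eq_iff)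
  then have "(\<forall>z\<in>Z. g z = 0) \<or> (\<forall>z\<in>Z. h z = 0)"
    by (rule no_zero_divisors[OF g(1) h(1)])
  then show False
    using g(2) h(2) ab points_eq by auto
qed

text \<open>
  The product of \<open>c\<close> with a function supported in \<open>W\<close> is zero, and the latter can be chosen nonzero at \<open>x\<close>.
\<close>
lemma vanishing_near_a_point:
  assumes "c \<in> F d" "openin (zariski X) W" "x \<in> W" "\<And>y. y \<in> W \<Longrightarrow> c y = 0" "z \<in> Z"
  shows "c z = 0"
proof -
  obtain e k where k: "k \<in> F e" "k x \<noteq> 0" "basic k \<subseteq> W"
    using openinD[OF assms(2,3)] by blast
  have "c y * k y = 0" if "y \<in> Z" for y
    using that k(3) assms(4)[of y] by auto
  then have "(\<forall>z\<in>Z. c z = 0) \<or> (\<forall>z\<in>Z. k z = 0)"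
    by (rule no_zero_divisors[OF assms(1) k(1)])
  moreover have "x \<in> Z"
    using openin_subset_Z[OF assms(2)] assms(3) by blast
  ultimately show ?thesis
    using k(2) assms(5) by auto
qed

context
  fixes x assumes xZ: "x \<in> Z"
begin

interpretation germ_space X x
  by unfold_locales (simp_all add: space_with_functions points_eq xZ)

abbreviation quot where "quot c h \<equiv> germ X x (basic h) (\<lambda>y. c y / h y)"

lemma sec_quot: "c \<in> F d \<Longrightarrow> h \<in> F d \<Longrightarrow> h x \<noteq> 0 \<Longrightarrow> sec (basic h) (\<lambda>y. c y / h y)"
  unfolding sec_def using xZ openin_basic
  by (auto intro: regular_quotient)

lemma carrier_quotE:
  assumes "r \<in> carrier R"
  obtains d c h where "c \<in> F d" "h \<in> F d" "h x \<noteq> 0" "r = quot c h"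
proof -
  obtain U f where U: "sec U f" "r = germ X x U f"
    using assms by (rule carrierE)
  then have f: "f \<in> regular X U" "x \<in> U"
    by (auto simp: sec_def)
  obtain d g h where *: "x \<in> Z" "g \<in> F d" "h \<in> F d" "h x \<noteq> 0" "basic h \<subseteq> U"
    "\<And>q. q \<in> Z \<Longrightarrow> h q \<noteq> 0 \<Longrightarrow> f q = g q / h q"
    by (rule regular_basicD[OF f], blast)
  have "germ X x U f = quot g h"
    by (rule germ_eqI[OF U(1) sec_quot[OF *(2-4)]]) (use * in auto)
  then show ?thesis
    using that * U(2) by blast
qed

lemma quot_eq_zero_iff:
  assumes "c \<in> F d" "h \<in> F d" "h x \<noteq> 0"
  shows "quot c h = \<zero>\<^bsub>R\<^esub> \<longleftrightarrow> (\<forall>z\<in>Z. c z = 0)"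
  unfolding zero_eq germ_eq_iff[OF sec_quot[OF assms] sec_points]
proof
  assume "\<exists>W. openin (zariski X) W \<and> x \<in> W \<and> W \<subseteq> basic h \<inter> points X \<and> (\<forall>y\<in>W. c y / h y = 0)"
  then obtain W where W: "openin (zariski X) W" "x \<in> W" "W \<subseteq> basic h" "\<And>y. y \<in> W \<Longrightarrow> c y / h y = 0"
    by auto
  have "c y = 0" if "y \<in> W" for y
    using W(3) W(4)[OF that] that by auto
  then show "\<forall>z\<in>Z. c z = 0"
    using vanishing_near_a_point[OF assms(1) W(1,2)] by blast
next
  assume "\<forall>z\<in>Z. c z = 0"
  then show "\<exists>W. openin (zariski X) W \<and> x \<in> W \<and> W \<subseteq> basic h \<inter> points X \<and> (\<forall>y\<in>W. c y / h y = 0)"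
    using xZ assms openin_basic[OF assms(2)] points_eq by (intro exI[of _ "basic h"]) auto
qed

lemma local_ring_domain: "domain R"
proof -
  interpret cring R by (rule local_ring_cring)
  show ?thesis
  proof
    show "\<one>\<^bsub>R\<^esub> \<noteq> \<zero>\<^bsub>R\<^esub>"
      unfolding one_eq zero_eq germ_eq_iff[OF sec_points sec_points] by auto
    fix r s assume rs: "r \<otimes>\<^bsub>R\<^esub> s = \<zero>\<^bsub>R\<^esub>" "r \<in> carrier R" "s \<in> carrier R"
    obtain d c h where 1: "c \<in> F d" "h \<in> F d" "h x \<noteq> 0" "r = quot c h"
      using rs(2) by (rule carrier_quotE)
    obtain d' c' h' where 2: "c' \<in> F d'" "h' \<in> F d'" "h' x \<noteq> 0" "s = quot c' h'"
      using rs(3) by (rule carrier_quotE)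
    have m: "(\<lambda>y. c y * c' y) \<in> F (d + d')" "(\<lambda>y. h y * h' y) \<in> F (d + d')" "h x * h' x \<noteq> 0"
      using 1 2 by (auto intro: mult_mem)
    have "r \<otimes>\<^bsub>R\<^esub> s = quot (\<lambda>y. c y * c' y) (\<lambda>y. h y * h' y)"
      unfolding 1(4) 2(4) germ_mult[OF sec_quot[OF 1(1-3)] sec_quot[OF 2(1-3)]]
      by (rule germ_eqI[OF sec_mult[OF sec_quot[OF 1(1-3)] sec_quot[OF 2(1-3)]] sec_quot[OF m]]) auto
    then have "\<forall>z\<in>Z. c z * c' z = 0"
      using rs(1) quot_eq_zero_iff[OF m] by simp
    then have "(\<forall>z\<in>Z. c z = 0) \<or> (\<forall>z\<in>Z. c' z = 0)"
      using no_zero_divisors[OF 1(1) 2(1)] by blast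
    then show "r = \<zero>\<^bsub>R\<^esub> \<or> s = \<zero>\<^bsub>R\<^esub>"
      using quot_eq_zero_iff[OF 1(1-3)] quot_eq_zero_iff[OF 2(1-3)] 1(4) 2(4) by simp
  qed
qed

text \<open>
  With a common denominator, all coefficients of an integral equation and both terms of the fraction
  have numerators of one and the same degree.
\<close>
lemma common_denominator:
  assumes "\<And>i. i < (l::nat) \<Longrightarrow> r i \<in> carrier R"
  shows "\<exists>d c h. h \<in> F d \<and> h x \<noteq> 0 \<and> (\<forall>i<l. c i \<in> F d \<and> r i = quot (c i) h)"
  using assms
proof (induction l)
  case 0
  then show ?case
    using const_mem[of 1] by (intro exI[of _ 0] exI[of _ undefined] exI[of _ "\<lambda>_. 1"]) auto
next
  case (Suc l)
  have "\<exists>d c h. h \<in> F d \<and> h x \<noteq> 0 \<and> (\<forall>i<l. c i \<in> F d \<and> r i = quot (c i) h)"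
    by (rule Suc.IH) (use Suc.prems in auto)
  then obtain d c h where 1: "h \<in> F d" "h x \<noteq> 0" "\<And>i. i < l \<Longrightarrow> c i \<in> F d \<and> r i = quot (c i) h"
    by (elim exE conjE) blast
  obtain d' c' h' where 2: "c' \<in> F d'" "h' \<in> F d'" "h' x \<noteq> 0" "r l = quot c' h'"
    by (rule carrier_quotE[of "r l"]) (use Suc.prems[of l] in auto)
  let ?h = "\<lambda>y. h y * h' y"
  let ?c = "\<lambda>i. if i = l then (\<lambda>y. h y * c' y) else (\<lambda>y. c i y * h' y)"
  have h: "?h \<in> F (d + d')" "?h x \<noteq> 0"
    using 1 2 by (auto intro: mult_mem)
  have "?c i \<in> F (d + d') \<and> r i = quot (?c i) ?h" if "i < Suc l" for i
  proof (cases "i = l")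
    case True
    have "quot c' h' = quot (\<lambda>y. h y * c' y) ?h"
      by (rule germ_eqI[OF sec_quot[OF 2(1-3)] sec_quot[OF mult_mem[OF 1(1) 2(1)] h]]) auto
    then show ?thesis
      using True 2 mult_mem[OF 1(1) 2(1)] by simp
  next
    case False
    then have ci: "c i \<in> F d" "r i = quot (c i) h"
      using 1(3)[of i] that by auto
    have "quot (c i) h = quot (\<lambda>y. c i y * h' y) ?h"
      by (rule germ_eqI[OF sec_quot[OF ci(1) 1(1,2)] sec_quot[OF mult_mem[OF ci(1) 2(2)] h]]) auto
    then show ?thesis
      using False ci mult_mem[OF ci(1) 2(2)] by simp
  qed
  then have "\<forall>i<Suc l. ?c i \<in> F (d + d') \<and> r i = quot (?c i) ?h"
    by simp
  with h show ?case
    by (intro exI[of _ "d + d'"] exI[of _ ?c] exI[of _ ?h] conjI)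
qed

text \<open>
  The hypothesis is integral closedness in graded form: \<open>c i / h\<close> are the coefficients of a monic
  equation for \<open>a / b\<close>, and the conclusion says that \<open>a / b = w / h\<close>. An integral equation over
  the local ring yields such an identity near the point, and by \<open>vanishing_near_a_point\<close> everywhere;
  as \<open>h\<close> does not vanish at \<open>x\<close>, the quotient \<open>w / h\<close> is regular there.
\<close>
lemma local_ring_integrally_closed:
  assumes N: "\<And>d a b h c k. \<lbrakk>a \<in> F d; b \<in> F d; h \<in> F d; \<And>i. i < (k::nat) \<Longrightarrow> c i \<in> F d;
      \<exists>z\<in>Z. b z \<noteq> 0; \<exists>z\<in>Z. h z \<noteq> 0;
      \<And>z. z \<in> Z \<Longrightarrow> h z * a z ^ k + (\<Sum>i<k. c i z * a z ^ i * b z ^ (k - i)) = 0\<rbrakk>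
      \<Longrightarrow> \<exists>w\<in>F d. \<forall>z\<in>Z. w z * b z = h z * a z"
  shows "integrally_closed_domain R"
  unfolding integrally_closed_domain_def
proof (intro conjI ballI impI)
  show "domain R" by (rule local_ring_domain)
  then interpret domain R .
  fix z assume z: "z \<in> carrier (fraction_field R)" and int: "integral_fraction R z"
  obtain \<alpha> \<beta> where ab: "\<alpha> \<in> carrier R" "\<beta> \<in> carrier R - {\<zero>\<^bsub>R\<^esub>}" "z = fraction R \<alpha> \<beta>"
    using z by (rule fraction_carrierE)
  obtain k \<gamma> where \<gamma>: "\<And>i. i < (k::nat) \<Longrightarrow> \<gamma> i \<in> carrier R"
    and eq: "\<alpha> [^]\<^bsub>R\<^esub> k \<oplus>\<^bsub>R\<^esub> (\<Oplus>\<^bsub>R\<^esub>i\<in>{..<k}. \<gamma> i \<otimes>\<^bsub>R\<^esub> \<alpha> [^]\<^bsub>R\<^esub> i \<otimes>\<^bsub>R\<^esub> \<beta> [^]\<^bsub>R\<^esub> (k - i)) = \<zero>\<^bsub>R\<^esub>"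
    using integral_fractionE[OF int ab(3,1,2)] by blast
  \<comment> \<open>One family that lists the coefficients, then numerator and denominator of the fraction.\<close>
  define r where "r i = (if i = k then \<alpha> else if i = Suc k then \<beta> else \<gamma> i)" for i
  have "r i \<in> carrier R" if "i < Suc (Suc k)" for i
    using that ab \<gamma> by (auto simp: r_def)
  then obtain d c h where h: "h \<in> F d" "h x \<noteq> 0" and c: "\<And>i. i < Suc (Suc k) \<Longrightarrow> c i \<in> F d \<and> r i = quot (c i) h"
    using common_denominator[of "Suc (Suc k)" r] by blast
  let ?a = "c k" and ?b = "c (Suc k)"
  have a: "?a \<in> F d" "\<alpha> = quot ?a h" and b: "?b \<in> F d" "\<beta> = quot ?b h"
    using c[of k] c[of "Suc k"] by (auto simp: r_def)
  have ci: "c i \<in> F d" "\<gamma> i = quot (c i) h" if "i < k" for i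
    using c[of i] that by (auto simp: r_def)
  have s: "sec (basic h) (\<lambda>y. c i y / h y)" if "i < Suc (Suc k)" for i
    using sec_quot[OF _ h] c[OF that] by blast
  have sa: "sec (basic h) (\<lambda>y. ?a y / h y)" and sb: "sec (basic h) (\<lambda>y. ?b y / h y)"
    by (rule s, simp)+
  have bx: "openin (zariski X) (basic h)" "x \<in> basic h"
    using openin_basic[OF h(1)] h(2) xZ by auto
  let ?S = "\<lambda>i y. c i y / h y * (?a y / h y) ^ i * (?b y / h y) ^ (k - i)"
  have sS: "sec (basic h) (?S i)" if "i < k" for i
    using that by (intro sec_mult_same sec_power s) auto
  have tm: "\<gamma> i \<otimes>\<^bsub>R\<^esub> \<alpha> [^]\<^bsub>R\<^esub> i \<otimes>\<^bsub>R\<^esub> \<beta> [^]\<^bsub>R\<^esub> (k - i) = germ X x (basic h) (?S i)" if i: "i < k" for i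
  proof -
    have si: "sec (basic h) (\<lambda>y. c i y / h y)"
      using s[of i] i by simp
    show ?thesis
      unfolding ci(2)[OF i] a(2) b(2) germ_power[OF sa] germ_power[OF sb]
        germ_mult[OF si sec_power[OF sa]] germ_mult[OF sec_mult[OF si sec_power[OF sa]] sec_power[OF sb]]
      by simp
  qed
  have "(\<Oplus>\<^bsub>R\<^esub>i\<in>{..<k}. \<gamma> i \<otimes>\<^bsub>R\<^esub> \<alpha> [^]\<^bsub>R\<^esub> i \<otimes>\<^bsub>R\<^esub> \<beta> [^]\<^bsub>R\<^esub> (k - i))
     = (\<Oplus>\<^bsub>R\<^esub>i\<in>{..<k}. germ X x (basic h) (?S i))"
    by (rule finsum_cong') (use tm sS in \<open>auto intro!: carrierI\<close>)
  also have "\<dots> = germ X x (basic h) (\<lambda>y. \<Sum>i<k. ?S i y)"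
    by (rule germ_finsum[OF bx sS])
  finally have "\<alpha> [^]\<^bsub>R\<^esub> k \<oplus>\<^bsub>R\<^esub> germ X x (basic h) (\<lambda>y. \<Sum>i<k. ?S i y) = \<zero>\<^bsub>R\<^esub>"
    using eq by simp
  moreover have sSum: "sec (basic h) (\<lambda>y. \<Sum>i<k. ?S i y)"
    by (rule sec_sum[OF bx]) (use sS in auto)
  ultimately have z0: "germ X x (basic h) (\<lambda>y. (?a y / h y) ^ k + (\<Sum>i<k. ?S i y)) = \<zero>\<^bsub>R\<^esub>"
    unfolding a(2) germ_power[OF sa] germ_add[OF sec_power[OF sa] sSum] by simp
  have "sec (basic h) (\<lambda>y. (?a y / h y) ^ k + (\<Sum>i<k. ?S i y))"
    by (intro sec_add_same sec_power sa sSum)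
  from z0[unfolded zero_eq germ_eq_iff[OF this sec_points]]
  obtain W where W: "openin (zariski X) W" "x \<in> W" "W \<subseteq> basic h"
    "\<And>y. y \<in> W \<Longrightarrow> (?a y / h y) ^ k + (\<Sum>i<k. ?S i y) = 0"
    by auto
  let ?E = "\<lambda>y. h y * ?a y ^ k + (\<Sum>i<k. c i y * ?a y ^ i * ?b y ^ (k - i))"
  have E_mem: "?E \<in> F (d + k * d)"
  proof (intro add_mem sum_mem)
    show "(\<lambda>y. h y * ?a y ^ k) \<in> F (d + k * d)"
      by (intro mult_mem power_mem h a)
    fix i assume "i \<in> {..<k}"
    then have i: "i < k" by simp
    have "(\<lambda>y. c i y * ?a y ^ i * ?b y ^ (k - i)) \<in> F (d + i * d + (k - i) * d)"
      by (intro mult_mem power_mem ci(1)[OF i] a b)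
    moreover have "d + i * d + (k - i) * d = d + k * d"
      using i by (simp flip: distrib_right)
    ultimately show "(\<lambda>y. c i y * ?a y ^ i * ?b y ^ (k - i)) \<in> F (d + k * d)"
      by simp
  qed
  have E_W: "?E y = 0" if y: "y \<in> W" for y
  proof -
    have hy: "h y \<noteq> 0"
      using W(3) y by auto
    have "?E y = h y ^ Suc k * ((?a y / h y) ^ k + (\<Sum>i<k. ?S i y))"
    proof -
      have "h y ^ Suc k * ?S i y = c i y * ?a y ^ i * ?b y ^ (k - i)" if "i \<in> {..<k}" for i
      proof -
        have "h y ^ Suc k = h y * h y ^ i * h y ^ (k - i)"
          using that by (simp flip: power_add)
        then show ?thesis
          using hy by (simp add: power_divide)
      qed
      then show ?thesis
        using hy by (simp add: distrib_left sum_distrib_left power_divide)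
    qed
    then show ?thesis
      using W(4)[OF y] by simp
  qed
  have E0: "?E z = 0" if "z \<in> Z" for z
    by (rule vanishing_near_a_point[OF E_mem W(1,2) E_W that])
  have bnz: "\<exists>z\<in>Z. ?b z \<noteq> 0"
    using ab(2) quot_eq_zero_iff[OF b(1) h] b(2) by auto
  have hnz: "\<exists>z\<in>Z. h z \<noteq> 0"
    using h(2) xZ by auto
  obtain w where w: "w \<in> F d" "\<And>z. z \<in> Z \<Longrightarrow> w z * ?b z = h z * ?a z"
    using N[OF a(1) b(1) h(1) ci(1) bnz hnz E0] by blast
  have sw: "sec (basic h) (\<lambda>y. w y / h y)"
    by (rule sec_quot[OF w(1) h])
  have wc: "quot w h \<in> carrier R"
    by (rule carrierI[OF sw])
  have "quot w h \<otimes>\<^bsub>R\<^esub> \<beta> = \<alpha>"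
    unfolding b(2) a(2) germ_mult[OF sw sb]
    by (rule germ_eqI[OF sec_mult[OF sw sb] sa]) (use w(2) in \<open>auto simp: divide_simps\<close>)
  then have "z = embed_fraction R (quot w h)"
    unfolding ab(3) embed_fraction_def using ab wc one_nonzero by (subst fraction_eq_iff) auto
  then show "z \<in> embed_fraction R ` carrier R"
    using wc by blast
qed

end

lemma normal_varietyI:
  assumes "\<And>d a b h c k. \<lbrakk>a \<in> F d; b \<in> F d; h \<in> F d; \<And>i. i < (k::nat) \<Longrightarrow> c i \<in> F d;
      \<exists>z\<in>Z. b z \<noteq> 0; \<exists>z\<in>Z. h z \<noteq> 0;
      \<And>z. z \<in> Z \<Longrightarrow> h z * a z ^ k + (\<Sum>i<k. c i z * a z ^ i * b z ^ (k - i)) = 0\<rbrakk>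
      \<Longrightarrow> \<exists>w\<in>F d. \<forall>z\<in>Z. w z * b z = h z * a z"
  shows "normal_variety X"
  unfolding normal_variety_def points_eq
  by (intro ballI, rule local_ring_integrally_closed, assumption, rule assms)

end

section \<open>Polynomials and forms\<close>

abbreviation polys where "polys k \<equiv> carrier (mpoly_ring k)"
lemma polys_eq: "polys k = supported {m. keys m \<subseteq> {..<k}}"
  by (auto simp: mpoly_ring_def vars_def supported_def)

lemma mpoly_ring_simps [simp]:
  "p \<otimes>\<^bsub>mpoly_ring k\<^esub> q = p * q" "\<one>\<^bsub>mpoly_ring k\<^esub> = 1" "\<zero>\<^bsub>mpoly_ring k\<^esub> = 0"
  "p \<oplus>\<^bsub>mpoly_ring k\<^esub> q = p + q"
  by (simp_all add: mpoly_ring_def)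

lemma polys_mult: "p \<in> polys k \<Longrightarrow> q \<in> polys k \<Longrightarrow> p * q \<in> polys k"
  unfolding polys_eq by (rule supported_mult) (auto simp: keys_add_nat)

lemma polys_1: "1 \<in> polys k"
  unfolding polys_eq by (rule supported_1) simp

lemma polys_0: "0 \<in> polys k"
  unfolding polys_eq by simp

lemma polys_add: "p \<in> polys k \<Longrightarrow> q \<in> polys k \<Longrightarrow> p + q \<in> polys k"
  unfolding polys_eq by (rule supported_add)

lemma polys_uminus: "p \<in> polys k \<Longrightarrow> - p \<in> polys k"
  unfolding polys_eq by (rule supported_uminus)

lemma polys_diff: "p \<in> polys k \<Longrightarrow> q \<in> polys k \<Longrightarrow> p - q \<in> polys k"
  unfolding polys_eq by (rule supported_diff)

lemma polys_Var: "i < k \<Longrightarrow> Var i \<in> polys k"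
  unfolding polys_eq Var_def by (rule supported_single) simp

lemma polys_const: "single 0 c \<in> polys k"
  unfolding polys_eq by (rule supported_single) simp

lemma polys_power: "p \<in> polys k \<Longrightarrow> p ^ j \<in> polys k"
  by (induction j) (auto intro: polys_1 polys_mult)

lemma polys_sum: "(\<And>i. i \<in> A \<Longrightarrow> f i \<in> polys k) \<Longrightarrow> sum f A \<in> polys k"
  by (induction A rule: infinite_finite_induct) (auto intro: polys_0 polys_add)

lemma polys_prod: "(\<And>i. i \<in> A \<Longrightarrow> f i \<in> polys k) \<Longrightarrow> prod f A \<in> polys k"
  by (induction A rule: infinite_finite_induct) (auto intro: polys_1 polys_mult)

lemma mpoly_ring_cring: "cring (mpoly_ring k)"
proof (rule cringI)
  show "abelian_group (mpoly_ring k)"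
    by (rule abelian_groupI)
       (auto simp: algebra_simps intro: polys_add polys_0 bexI[OF _ polys_uminus])
  show "comm_monoid (mpoly_ring k)"
    by (rule comm_monoidI) (auto simp: algebra_simps intro: polys_mult polys_1)
qed (auto simp: algebra_simps)

definition forms :: "nat \<Rightarrow> nat \<Rightarrow> mpoly set" where
  "forms N d = supported {m. keys m \<subseteq> {..<Suc N} \<and> mon_deg m = d}"

lemma forms_iff: "g \<in> forms N d \<longleftrightarrow> g \<in> polys (Suc N) \<and> homogeneous d g"
  by (auto simp: forms_def polys_eq supported_def homogeneous_def mon_deg_def)

lemma forms_polys: "g \<in> forms N d \<Longrightarrow> g \<in> polys (Suc N)"
  by (simp add: forms_iff)

lemma forms_mult: "g \<in> forms N d \<Longrightarrow> h \<in> forms N e \<Longrightarrow> g * h \<in> forms N (d + e)"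
  unfolding forms_def by (rule supported_mult) (auto simp: keys_add_nat mon_deg_add)

lemma forms_add: "g \<in> forms N d \<Longrightarrow> h \<in> forms N d \<Longrightarrow> g + h \<in> forms N d"
  unfolding forms_def by (rule supported_add)

lemma forms_0: "0 \<in> forms N d"
  unfolding forms_def by simp

lemma forms_const: "single 0 c \<in> forms N 0"
  unfolding forms_def by (rule supported_single) simp

lemma forms_Var: "i \<le> N \<Longrightarrow> Var i \<in> forms N 1"
  unfolding forms_def Var_def by (rule supported_single) auto

lemma peval_form_scale:
  assumes "g \<in> forms N d"
  shows "peval g (\<lambda>i. c * v i) = c ^ d * peval g v"
  using assms unfolding peval_alt forms_def supported_def
  by (auto simp: mon_eval_scale sum_distrib_left intro!: sum.cong)

section \<open>Projective spaces\<close>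

definition line :: "(nat \<Rightarrow> complex) \<Rightarrow> (nat \<Rightarrow> complex) set" where
  "line v = {\<lambda>i. c * v i | c. c \<noteq> 0}"

text \<open>
  The values of a form at two representatives of a point differ by a factor that is the
  same for all forms of a given degree. Hence the non-vanishing of a form and quotients of forms of equal degree may be evaluated
  at any one representative.
\<close>
definition rep :: "(nat \<Rightarrow> complex) set \<Rightarrow> nat \<Rightarrow> complex" where
  "rep q = (SOME v. v \<in> q)"

definition form_functions :: "nat \<Rightarrow> nat \<Rightarrow> ((nat \<Rightarrow> complex) set \<Rightarrow> complex) set" where
  "form_functions N d = {\<lambda>q. peval g (rep q) | g. g \<in> forms N d}"

lemma form_functionsI: "g \<in> forms N d \<Longrightarrow> (\<lambda>q. peval g (rep q)) \<in> form_functions N d"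
  by (auto simp: form_functions_def)

lemma line_self: "v \<in> line v"
  unfolding line_def by (auto intro!: exI[of _ 1])

lemma line_scale: "c \<noteq> 0 \<Longrightarrow> line (\<lambda>i. c * v i) = line v"
proof -
  assume c: "c \<noteq> 0"
  have "\<exists>b. (\<lambda>i. a * v i) = (\<lambda>i. b * (c * v i)) \<and> b \<noteq> 0" if "a \<noteq> 0" for a
    by (rule exI[of _ "a / c"]) (use that c in auto)
  moreover have "\<exists>b. (\<lambda>i. a * (c * v i)) = (\<lambda>i. b * v i) \<and> b \<noteq> 0" if "a \<noteq> 0" for a
    by (rule exI[of _ "a * c"]) (use that c in auto)
  ultimately show ?thesis
    unfolding line_def by auto
qed

lemma rep_line: obtains c where "c \<noteq> 0" "rep (line v) = (\<lambda>i. c * v i)"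
proof -
  have "rep (line v) \<in> line v"
    unfolding rep_def by (rule someI[of "\<lambda>w. w \<in> line v", OF line_self])
  then show ?thesis
    using that unfolding line_def by auto
qed

lemma line_rep_line: "line (rep (line v)) = line v"
  by (rule rep_line[of v]) (simp add: line_scale)

lemma projective_pointE:
  assumes "q \<in> projective_points N"
  obtains "q = line (rep q)" "rep q \<in> affine_points (Suc N)" "\<exists>i. rep q i \<noteq> 0"
proof -
  obtain v where v: "q = line v" "v \<in> affine_points (Suc N)" "\<exists>i. v i \<noteq> 0"
    using assms unfolding projective_points_def line_def by blast
  obtain c where c: "c \<noteq> 0" "rep q = (\<lambda>i. c * v i)"
    using rep_line[of v] v(1) by metis
  show ?thesis
    using that v c line_rep_line[of v] by (auto simp: affine_points_def)
qed

lemma form_nonzero_on_line: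
  assumes "g \<in> forms N d" "q = line (rep q)"
  shows "(\<forall>v\<in>q. peval g v \<noteq> 0) \<longleftrightarrow> peval g (rep q) \<noteq> 0"
proof
  assume "\<forall>v\<in>q. peval g v \<noteq> 0"
  then show "peval g (rep q) \<noteq> 0"
    using line_self[of "rep q"] assms(2) by simp
next
  assume nz: "peval g (rep q) \<noteq> 0"
  show "\<forall>v\<in>q. peval g v \<noteq> 0"
  proof
    fix v assume "v \<in> q"
    then obtain c where "c \<noteq> 0" "v = (\<lambda>i. c * rep q i)"
      using assms(2) unfolding line_def by blast
    then show "peval g v \<noteq> 0"
      using nz by (simp add: peval_form_scale[OF assms(1)])
  qed
qed

lemma form_quotient_on_line:
  assumes "g \<in> forms N d" "h \<in> forms N d" "q = line (rep q)"
  shows "(\<forall>v\<in>q. peval h v \<noteq> 0 \<and> a = peval g v / peval h v) \<longleftrightarrow>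
    peval h (rep q) \<noteq> 0 \<and> a = peval g (rep q) / peval h (rep q)"
proof
  assume "\<forall>v\<in>q. peval h v \<noteq> 0 \<and> a = peval g v / peval h v"
  then show "peval h (rep q) \<noteq> 0 \<and> a = peval g (rep q) / peval h (rep q)"
    using line_self[of "rep q"] assms(3) by simp
next
  assume nz: "peval h (rep q) \<noteq> 0 \<and> a = peval g (rep q) / peval h (rep q)"
  show "\<forall>v\<in>q. peval h v \<noteq> 0 \<and> a = peval g v / peval h v"
  proof
    fix v assume "v \<in> q"
    then obtain c where "c \<noteq> 0" "v = (\<lambda>i. c * rep q i)"
      using assms(3) unfolding line_def by blast
    then show "peval h v \<noteq> 0 \<and> a = peval g v / peval h v"
      using nz by (simp add: peval_form_scale[OF assms(1)] peval_form_scale[OF assms(2)])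
  qed
qed

lemma function_system_forms: "function_system (form_functions N)"
proof
  fix c show "(\<lambda>_. c) \<in> form_functions N 0"
    using form_functionsI[OF forms_const[of c N]] by simp
next
  fix d show "(\<lambda>_. 0) \<in> form_functions N d"
    using form_functionsI[OF forms_0[of N d]] by simp
next
  fix f g d assume "f \<in> form_functions N d" "g \<in> form_functions N d"
  then obtain p q where "p \<in> forms N d" "f = (\<lambda>x. peval p (rep x))" "q \<in> forms N d" "g = (\<lambda>x. peval q (rep x))"
    unfolding form_functions_def by blast
  then show "(\<lambda>x. f x + g x) \<in> form_functions N d"
    using form_functionsI[OF forms_add[of p N d q]] by simp
next
  fix f g d e assume "f \<in> form_functions N d" "g \<in> form_functions N e"
  then obtain p q where "p \<in> forms N d" "f = (\<lambda>x. peval p (rep x))" "q \<in> forms N e" "g = (\<lambda>x. peval q (rep x))"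
    unfolding form_functions_def by blast
  then show "(\<lambda>x. f x * g x) \<in> form_functions N (d + e)"
    using form_functionsI[OF forms_mult[of p N d q e]] by simp
qed

lemma Proj_variety_eq: "Proj_variety N I = fspace_of (projective_zeros N I) (form_functions N)"
proof -
  let ?Z = "projective_zeros N I"
  have Z: "q = line (rep q)" if "q \<in> ?Z" for q
    using that projective_pointE[of q N] unfolding projective_zeros_def by blast
  have nz: "{q\<in>?Z. \<forall>v\<in>q. peval g v \<noteq> 0} = {q\<in>?Z. peval g (rep q) \<noteq> 0}" if "g \<in> forms N d" for g d
    using form_nonzero_on_line[OF that Z] by blast
  have "{{q\<in>?Z. \<forall>v\<in>q. peval g v \<noteq> 0} | g. g \<in> polys (Suc N) \<and> (\<exists>d. homogeneous d g)}
      = {{z\<in>?Z. g z \<noteq> 0} | g. \<exists>d. g \<in> form_functions N d}" (is "?A = ?B")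
  proof
    show "?A \<subseteq> ?B"
    proof
      fix S assume "S \<in> ?A"
      then obtain g d where "g \<in> forms N d" "S = {q\<in>?Z. \<forall>v\<in>q. peval g v \<noteq> 0}"
        by (auto simp: forms_iff)
      then have "S = {q\<in>?Z. (\<lambda>q. peval g (rep q)) q \<noteq> 0}" "(\<lambda>q. peval g (rep q)) \<in> form_functions N d"
        using nz form_functionsI by auto
      then show "S \<in> ?B"
        by (intro CollectI exI[of _ "\<lambda>q. peval g (rep q)"] conjI exI[of _ d])
    qed
    show "?B \<subseteq> ?A"
    proof
      fix S assume "S \<in> ?B"
      then obtain g d where "g \<in> forms N d" "S = {q\<in>?Z. peval g (rep q) \<noteq> 0}"
        unfolding form_functions_def by blast
      then have "S = {q\<in>?Z. \<forall>v\<in>q. peval g v \<noteq> 0}" "g \<in> polys (Suc N)" "homogeneous d g"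
        using nz by (auto simp: forms_iff)
      then show "S \<in> ?A" by blast
    qed
  qed
  then have T: "projective_topology N I = topology_generated_by {{z\<in>?Z. g z \<noteq> 0} | g. \<exists>d. g \<in> form_functions N d}"
    unfolding projective_topology_def by simp
  interpret function_system ?Z "form_functions N"
    by (rule function_system_forms)
  have TX: "projective_topology N I = zariski X"
    unfolding T fspace_of_def Let_def by simp
  have "regular (Proj_variety N I) U = regular X U" for U
  proof (rule Set.set_eqI)
    fix f
    have "(\<exists>W d g h. openin (zariski X) W \<and> p \<in> W \<and> W \<subseteq> U \<and>
        g \<in> polys (Suc N) \<and> homogeneous d g \<and>
        h \<in> polys (Suc N) \<and> homogeneous d h \<and>
        (\<forall>q\<in>W. \<forall>v\<in>q. peval h v \<noteq> 0 \<and> f q = peval g v / peval h v)) \<longleftrightarrow>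
       (\<exists>W d g h. openin (zariski X) W \<and> p \<in> W \<and> W \<subseteq> U \<and> g \<in> form_functions N d \<and> h \<in> form_functions N d \<and>
        (\<forall>q\<in>W. h q \<noteq> 0 \<and> f q = g q / h q))" (is "?L \<longleftrightarrow> ?R") for p
    proof
      assume ?L
      then obtain W d g h where *: "openin (zariski X) W" "p \<in> W" "W \<subseteq> U" "g \<in> forms N d" "h \<in> forms N d"
        "\<forall>q\<in>W. \<forall>v\<in>q. peval h v \<noteq> 0 \<and> f q = peval g v / peval h v"
        by (auto simp: forms_iff)
      have "peval h (rep q) \<noteq> 0 \<and> f q = peval g (rep q) / peval h (rep q)" if "q \<in> W" for q
        using *(6) form_quotient_on_line[OF *(4,5) Z[of q]] openin_subset_Z[OF *(1)] that by blast
      then show ?R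
        using * form_functionsI[OF *(4)] form_functionsI[OF *(5)] by blast
    next
      assume ?R
      then obtain W d g h where *: "openin (zariski X) W" "p \<in> W" "W \<subseteq> U" "g \<in> forms N d" "h \<in> forms N d"
        "\<forall>q\<in>W. peval h (rep q) \<noteq> 0 \<and> f q = peval g (rep q) / peval h (rep q)"
        unfolding form_functions_def by blast
      have "\<forall>v\<in>q. peval h v \<noteq> 0 \<and> f q = peval g v / peval h v" if "q \<in> W" for q
        using *(6) form_quotient_on_line[OF *(4,5) Z[of q]] openin_subset_Z[OF *(1)] that by blast
      then show ?L
        using * unfolding forms_iff by blast
    qed
    then show "f \<in> regular (Proj_variety N I) U \<longleftrightarrow> f \<in> regular X U"
      unfolding Proj_variety_def fspace.simps TX mem_Collect_eq
      unfolding fspace_of_def Let_def fspace.simps mem_Collect_eq by simp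
  qed
  then have "regular (Proj_variety N I) = regular X"
    by (rule ext)
  moreover have "zariski (Proj_variety N I) = zariski X"
    using TX by (simp add: Proj_variety_def)
  ultimately show ?thesis
    by simp
qed

lemma Var_power: "Var i ^ k = single (single i k) 1"
proof (induction k)
  case 0
  show ?case by simp
next
  case (Suc k)
  then show ?case
    by (simp add: Var_def mult_single flip: single_add)
qed

lemma forms_power: "g \<in> forms N d \<Longrightarrow> g ^ k \<in> forms N (k * d)"
proof (induction k)
  case 0
  then show ?case
    using forms_const[of 1 N] by simp
next
  case (Suc k)
  then show ?case
    using forms_mult[of g N d "g ^ k" "k * d"] by simp
qed

lemma forms_sum: "(\<And>i. i \<in> A \<Longrightarrow> f i \<in> forms N d) \<Longrightarrow> sum f A \<in> forms N d"
  by (induction A rule: infinite_finite_induct) (auto intro: forms_0 forms_add)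

section \<open>The parametrization of the cone\<close>

locale monomial_hypersurface =
  fixes n :: nat
  assumes n2: "n \<ge> 2"
begin

lemma n0: "n > 0"
  using n2 by simp

definition cone :: "(nat \<Rightarrow> complex) set" where
  "cone = {v\<in>affine_points (Suc n). v 0 ^ n = (\<Prod>i = 1..n. v i)}"

definition eqn :: mpoly where
  "eqn = Var 0 ^ n - (\<Prod>i = 1..n. Var i)"

definition defining_ideal :: "mpoly set" where
  "defining_ideal = Idl\<^bsub>mpoly_ring (Suc n)\<^esub> {eqn}"

lemma peval_eqn: "peval eqn v = v 0 ^ n - (\<Prod>i = 1..n. v i)"
  by (simp add: eqn_def peval_prod)

definition parametrization :: "(nat \<Rightarrow> complex) \<Rightarrow> nat \<Rightarrow> complex" where
  "parametrization s i = (if i = 0 then \<Prod>j = 1..n. s j else if i \<le> n then s i ^ n else 0)"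

text \<open>
  The exponent of the monomial that \<open>m\<close> becomes under the substitution \<open>x = parametrization s\<close>.
\<close>
definition exponent_map :: "(nat \<Rightarrow>\<^sub>0 nat) \<Rightarrow> (nat \<Rightarrow>\<^sub>0 nat)" where
  "exponent_map m = (\<Sum>i = 1..n. single i (n * lookup m i + lookup m 0))"

definition pullback :: "mpoly \<Rightarrow> mpoly" where
  "pullback g = (\<Sum>m\<in>keys g. single (exponent_map m) (lookup g m))"

text \<open>
  The monoid \<open>P\<close> whose monomials span the coordinate ring of the cone; see \<open>exponents_iff\<close> for the
  description by congruences.
\<close>
definition exponents :: "(nat \<Rightarrow>\<^sub>0 nat) set" where
  "exponents = exponent_map ` {m. keys m \<subseteq> {..<Suc n}}"

lemma lookup_exponent_map: "lookup (exponent_map m) i = (if i \<in> {1..n} then n * lookup m i + lookup m 0 else 0)"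
proof -
  have "lookup (exponent_map m) i = (\<Sum>j = 1..n. if j = i then n * lookup m j + lookup m 0 else 0)"
    unfolding exponent_map_def lookup_sum by (rule sum.cong) (auto simp: lookup_single when_def)
  then show ?thesis by simp
qed

lemma keys_exponent_map: "keys (exponent_map m) \<subseteq> {1..n}"
  by (auto simp: in_keys_iff lookup_exponent_map split: if_splits)

lemma parametrization_in_cone: "parametrization s \<in> cone"
proof -
  have "(\<Prod>i = 1..n. parametrization s i) = (\<Prod>i = 1..n. s i ^ n)"
    by (rule prod.cong) (auto simp: parametrization_def)
  then show ?thesis
    by (auto simp: cone_def affine_points_def parametrization_def prod_power_distrib)
qed

text \<open>
  If \<open>s\<^sub>i\<close> are \<open>n\<close>-th roots of the \<open>v\<^sub>i\<close>, then their product is an \<open>n\<close>-th root of \<open>v\<^sub>0\<^sup>n\<close>. So it differs from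
  \<open>v\<^sub>0\<close> by a root of unity, which can be moved into \<open>s\<^sub>1\<close>.
\<close>
lemma cone_parametrized:
  assumes "v \<in> cone"
  obtains s where "v = parametrization s"
proof -
  have "\<exists>w. v i = w ^ n" for i
    by (rule exists_complex_root[of n "v i"]) (use n0 in auto)
  then obtain s where s: "\<And>i. v i = s i ^ n"
    by metis
  have eq: "v 0 ^ n = (\<Prod>i = 1..n. s i) ^ n"
    using assms by (simp add: cone_def s prod_power_distrib)
  have vz: "v i = 0" if "i > n" for i
    using assms that by (auto simp: cone_def affine_points_def)
  show ?thesis
  proof (cases "v 0 = 0")
    case True
    have "(\<Prod>i = 1..n. s i) = 0"
      using eq True n0 by (simp add: power_0_left)
    then have "v i = parametrization s i" for i
      using True s[of i] vz[of i] by (cases "i = 0") (simp_all add: parametrization_def)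
    then have "v = parametrization s" ..
    then show ?thesis by (rule that)
  next
    case False
    let ?P = "\<Prod>i = 1..n. s i"
    have P: "?P \<noteq> 0"
    proof
      assume z: "?P = 0"
      have "v 0 ^ n = 0"
        using eq n0 unfolding z by simp
      then show False
        using False by simp
    qed
    define t where "t i = (if i = 1 then v 0 / ?P * s 1 else s i)" for i
    have "v i = t i ^ n" if "i \<noteq> 0" for i
      using s[of i] eq P by (simp add: t_def power_mult_distrib power_divide)
    moreover have "(\<Prod>i = 1..n. t i) = v 0"
    proof -
      have "(\<Prod>i = 1..n. t i) = t 1 * (\<Prod>i\<in>{1..n} - {1}. t i)"
        using n0 by (intro prod.remove) auto
      also have "(\<Prod>i\<in>{1..n} - {1}. t i) = (\<Prod>i\<in>{1..n} - {1}. s i)"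
        by (rule prod.cong) (auto simp: t_def)
      also have "t 1 * \<dots> = v 0 / ?P * (s 1 * (\<Prod>i\<in>{1..n} - {1}. s i))"
        by (simp add: t_def)
      also have "s 1 * (\<Prod>i\<in>{1..n} - {1}. s i) = ?P"
        using n0 by (intro prod.remove[symmetric]) auto
      finally show ?thesis
        using P by simp
    qed
    ultimately have "v = parametrization t"
      using vz by (auto simp: parametrization_def fun_eq_iff)
    then show ?thesis by (rule that)
  qed
qed

lemma mon_eval_exponent_map:
  assumes "keys m \<subseteq> {..<Suc n}"
  shows "mon_eval (exponent_map m) s = mon_eval m (parametrization s)"
proof -
  have "mon_eval (exponent_map m) s = (\<Prod>i\<in>{1..n}. s i ^ lookup (exponent_map m) i)"
    by (rule mon_eval_superset[OF _ keys_exponent_map]) simp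
  also have "\<dots> = (\<Prod>i\<in>{1..n}. s i ^ lookup m 0 * (s i ^ n) ^ lookup m i)"
    by (rule prod.cong) (auto simp: lookup_exponent_map power_add power_mult)
  also have "\<dots> = parametrization s 0 ^ lookup m 0 * (\<Prod>i\<in>{1..n}. parametrization s i ^ lookup m i)"
    by (simp add: prod.distrib prod_power_distrib parametrization_def)
  also have "\<dots> = (\<Prod>i\<in>insert 0 {1..n}. parametrization s i ^ lookup m i)"
    by simp
  also have "\<dots> = mon_eval m (parametrization s)"
    by (rule mon_eval_superset[symmetric]) (use assms in auto)
  finally show ?thesis .
qed

lemma mon_deg_exponent_map:
  assumes "keys m \<subseteq> {..<Suc n}"
  shows "mon_deg (exponent_map m) = n * mon_deg m"
proof -
  have "mon_deg (exponent_map m) = (\<Sum>i\<in>{1..n}. n * lookup m i + lookup m 0)"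
    by (subst mon_deg_superset[OF _ keys_exponent_map]) (auto simp: lookup_exponent_map)
  also have "\<dots> = n * (\<Sum>i\<in>insert 0 {1..n}. lookup m i)"
    by (simp add: sum.distrib distrib_left sum_distrib_left)
  also have "(\<Sum>i\<in>insert 0 {1..n}. lookup m i) = mon_deg m"
    by (rule mon_deg_superset[symmetric]) (use assms in auto)
  finally show ?thesis .
qed

lemma peval_pullback:
  assumes "g \<in> polys (Suc n)"
  shows "peval (pullback g) s = peval g (parametrization s)"
proof -
  have "lookup g m * mon_eval (exponent_map m) s = lookup g m * mon_eval m (parametrization s)" if "m \<in> keys g" for m
    using mon_eval_exponent_map assms that unfolding polys_eq supported_def by auto
  then show ?thesis
    unfolding pullback_def peval_sum peval_single peval_alt[of g] by (rule sum.cong[OF refl])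
qed

lemma pullback_eqI:
  assumes "g \<in> polys (Suc n)" "\<And>s. peval g (parametrization s) = peval G s"
  shows "pullback g = G"
proof -
  have "pullback g - G = 0"
    by (rule peval_eq_0_imp) (simp add: peval_pullback assms)
  then show ?thesis by simp
qed

lemma pullback_form:
  assumes "g \<in> forms n d"
  shows "pullback g \<in> supported {u\<in>exponents. mon_deg u = n * d}"
proof -
  have "exponent_map m \<in> exponents \<and> mon_deg (exponent_map m) = n * d" if "m \<in> keys g" for m
    using assms that mon_deg_exponent_map unfolding forms_def supported_def exponents_def by auto
  then show ?thesis
    unfolding pullback_def by (intro supported_sum supported_single) auto
qed

text \<open>
  The converse of \<open>pullback_form\<close>: the pullbacks of forms fill the graded pieces of \<open>\<complex>[P]\<close>.
\<close>
lemma form_of_exponents: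
  assumes "w \<in> supported {u\<in>exponents. mon_deg u = n * d}"
  obtains g where "g \<in> forms n d" "\<And>s. peval g (parametrization s) = peval w s"
proof -
  have "\<exists>m. keys m \<subseteq> {..<Suc n} \<and> exponent_map m = u" if "u \<in> keys w" for u
    using assms that unfolding supported_def exponents_def by auto
  then obtain \<mu> where \<mu>: "\<And>u. u \<in> keys w \<Longrightarrow> keys (\<mu> u) \<subseteq> {..<Suc n} \<and> exponent_map (\<mu> u) = u"
    by metis
  define g where "g = (\<Sum>u\<in>keys w. single (\<mu> u) (lookup w u))"
  have "mon_deg (\<mu> u) = d" if "u \<in> keys w" for u
  proof -
    have "n * mon_deg (\<mu> u) = n * d"
      using mon_deg_exponent_map[of "\<mu> u"] \<mu>[OF that] assms that unfolding supported_def by auto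
    then show ?thesis using n0 by simp
  qed
  then have "g \<in> forms n d"
    unfolding g_def forms_def using \<mu> by (intro supported_sum supported_single) auto
  moreover have "peval g (parametrization s) = peval w s" for s
  proof -
    have "lookup w u * mon_eval (\<mu> u) (parametrization s) = lookup w u * mon_eval u s" if "u \<in> keys w" for u
      using mon_eval_exponent_map[of "\<mu> u" s] \<mu>[OF that] by simp
    then show ?thesis
      unfolding g_def peval_sum peval_single peval_alt[of w] by (rule sum.cong[OF refl])
  qed
  ultimately show ?thesis by (rule that)
qed

lemma exponents_iff:
  "u \<in> exponents \<longleftrightarrow> keys u \<subseteq> {1..n} \<and> (\<forall>i\<in>{1..n}. [lookup u i = lookup u 1] (mod n))"
proof
  assume "u \<in> exponents"
  then obtain m where "u = exponent_map m"
    by (auto simp: exponents_def)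
  then show "keys u \<subseteq> {1..n} \<and> (\<forall>i\<in>{1..n}. [lookup u i = lookup u 1] (mod n))"
    using keys_exponent_map n0 by (auto simp: lookup_exponent_map cong_def)
next
  assume u: "keys u \<subseteq> {1..n} \<and> (\<forall>i\<in>{1..n}. [lookup u i = lookup u 1] (mod n))"
  define m where "m = single 0 (lookup u 1 mod n) + (\<Sum>i = 1..n. single i (lookup u i div n))"
  have lm: "lookup m i = (if i = 0 then lookup u 1 mod n else if i \<le> n then lookup u i div n else 0)" for i
  proof -
    have "lookup (\<Sum>i = 1..n. single i (lookup u i div n)) i = (\<Sum>j = 1..n. if j = i then lookup u j div n else 0)"
      unfolding lookup_sum by (rule sum.cong) (auto simp: lookup_single when_def)
    then show ?thesis
      by (auto simp: m_def lookup_add lookup_single when_def)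
  qed
  have "exponent_map m = u"
  proof (rule poly_mapping_eqI)
    fix i
    show "lookup (exponent_map m) i = lookup u i"
    proof (cases "i \<in> {1..n}")
      case True
      then have "lookup u 1 mod n = lookup u i mod n"
        using bspec[OF conjunct2[OF u] True] by (simp only: cong_def)
      then show ?thesis
        using True by (simp add: lookup_exponent_map lm)
    next
      case False
      then have "lookup u i = 0"
        using u by (auto simp: in_keys_iff)
      then show ?thesis
        using False by (auto simp: lookup_exponent_map)
    qed
  qed
  moreover have "keys m \<subseteq> {..<Suc n}"
    by (auto simp: in_keys_iff lm split: if_splits)
  ultimately show "u \<in> exponents"
    unfolding exponents_def by blast
qed

sublocale saturated_monoid exponents
proof
  show "0 \<in> exponents"
    by (simp add: exponents_iff)
  show "u + v \<in> exponents" if "u \<in> exponents" "v \<in> exponents" for u v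
    using that unfolding exponents_iff by (auto simp: keys_add_nat lookup_add intro!: cong_add)
  show "finite {m \<in> exponents. mon_deg m = d}" for d
  proof -
    let ?S = "{m \<in> exponents. mon_deg m = d}"
    have "lookup ` ?S \<subseteq> {f. \<forall>i. (i \<in> {1..n} \<longrightarrow> f i \<in> {..d}) \<and> (i \<notin> {1..n} \<longrightarrow> f i = 0)}"
    proof (clarify, intro conjI impI)
      fix m i assume m: "m \<in> exponents" and d: "d = mon_deg m"
      show "lookup m i \<in> {..mon_deg m}"
        using member_le_sum[of i "keys m" "lookup m"] unfolding mon_deg_def
        by (cases "i \<in> keys m") (auto simp: in_keys_iff)
      show "lookup m i = 0" if "i \<notin> {1..n}"
        using m that unfolding exponents_iff by (auto simp: in_keys_iff)
    qed
    then have "finite (lookup ` ?S)"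
      by (rule finite_subset) (rule finite_set_of_finite_funs, auto)
    then show ?thesis
      by (rule finite_imageD) (rule inj_onI, rule poly_mapping_eqI, simp)
  qed
  fix u v w
  assume u: "u \<in> exponents" and v: "v \<in> exponents"
    and *: "\<And>j. \<exists>t\<in>exponents. w + (\<Sum>i<(j::nat). u) = t + (\<Sum>i<j. v)"
  have le: "lookup v i \<le> lookup u i" for i
  proof (rule ccontr)
    assume "\<not> ?thesis"
    then have lt: "Suc (lookup u i) \<le> lookup v i" by simp
    define j where "j = Suc (lookup w i)"
    obtain t where "w + (\<Sum>i<j. u) = t + (\<Sum>i<j. v)"
      using * by blast
    then have "lookup (w + (\<Sum>i<j. u)) i = lookup (t + (\<Sum>i<j. v)) i"
      by simp
    then have "lookup w i + j * lookup u i = lookup t i + j * lookup v i"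
      by (simp add: lookup_add lookup_sum del: sum_constant)
         (simp only: sum_constant card_lessThan of_nat_id)
    moreover have "j * Suc (lookup u i) \<le> j * lookup v i"
      using lt by (rule mult_le_mono2)
    ultimately show False
      by (simp add: j_def)
  qed
  have eq: "u = (u - v) + v"
    by (rule poly_mapping_eqI) (simp add: lookup_add lookup_minus le)
  moreover have "u - v \<in> exponents"
    unfolding exponents_iff
  proof (intro conjI ballI)
    show "keys (u - v) \<subseteq> {1..n}"
      using u unfolding exponents_iff by (auto simp: in_keys_iff lookup_minus)
    fix i assume i: "i \<in> {1..n}"
    have "[lookup (u - v) i + lookup v i = lookup (u - v) 1 + lookup v 1] (mod n)"
      using u i unfolding exponents_iff by (simp add: lookup_minus le)
    moreover have "[lookup v i = lookup v 1] (mod n)"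
      using v i unfolding exponents_iff by simp
    ultimately have "[lookup (u - v) i + lookup v 1 = lookup (u - v) 1 + lookup v 1] (mod n)"
      by (meson cong_add cong_refl cong_sym cong_trans)
    then show "[lookup (u - v) i = lookup (u - v) 1] (mod n)"
      by (simp add: cong_add_rcancel_nat)
  qed
  ultimately show "\<exists>t\<in>exponents. u = t + v"
    by blast
qed

section \<open>The ideal is prime\<close>

lemma eqn_polys: "eqn \<in> polys (Suc n)"
  unfolding eqn_def by (intro polys_diff polys_power polys_prod polys_Var) auto

lemma defining_ideal_eq: "defining_ideal = {r * eqn | r. r \<in> polys (Suc n)}"
proof -
  interpret cring "mpoly_ring (Suc n)"
    by (rule mpoly_ring_cring)
  show ?thesis
    unfolding defining_ideal_def cgenideal_eq_genideal[OF eqn_polys, symmetric]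
    by (simp add: cgenideal_def)
qed

lemma defining_ideal_vanishes:
  assumes "g \<in> defining_ideal" "v \<in> cone"
  shows "peval g v = 0"
  using assms by (auto simp: defining_ideal_eq peval_eqn cone_def)

definition reduced :: "(nat \<Rightarrow>\<^sub>0 nat) set" where
  "reduced = {m. keys m \<subseteq> {..<Suc n} \<and> lookup m 0 < n}"

text \<open>
  The residue modulo \<open>n\<close> of an exponent of \<open>exponent_map m\<close> recovers the exponent of \<open>x\<^sub>0\<close>, which is less
  than \<open>n\<close>; the others are then determined.
\<close>
lemma exponent_map_inj_on_reduced: "inj_on exponent_map reduced"
proof (rule inj_onI)
  fix m m' assume m: "m \<in> reduced" and m': "m' \<in> reduced" and eq: "exponent_map m = exponent_map m'"
  have e: "n * lookup m i + lookup m 0 = n * lookup m' i + lookup m' 0" if "i \<in> {1..n}" for i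
    using arg_cong[OF eq, of "\<lambda>u. lookup u i"] that by (simp add: lookup_exponent_map)
  have "(n * lookup m 1 + lookup m 0) mod n = (n * lookup m' 1 + lookup m' 0) mod n"
    using e[of 1] n0 by simp
  then have 0: "lookup m 0 = lookup m' 0"
    using m m' by (simp add: reduced_def)
  show "m = m'"
  proof (rule poly_mapping_eqI)
    fix i
    consider "i = 0" | "i \<in> {1..n}" | "i > n" by fastforce
    then show "lookup m i = lookup m' i"
    proof cases
      case 2
      then show ?thesis using e[OF 2] 0 n0 by simp
    next
      case 3
      then have "i \<notin> keys m" "i \<notin> keys m'"
        using m m' by (auto simp: reduced_def)
      then show ?thesis by (simp add: in_keys_iff)
    qed (use 0 in simp)
  qed
qed

text \<open>
  Replace \<open>(x\<^sub>0\<^sup>n)\<^sup>q\<close> by \<open>(x\<^sub>1 \<cdots> x\<^sub>n)\<^sup>q\<close>. The difference is a multiple of the equation because \<open>A - B\<close> divides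
  \<open>A\<^sup>q - B\<^sup>q\<close>.
\<close>
lemma reduction_monomial:
  assumes "keys m \<subseteq> {..<Suc n}"
  shows "\<exists>r\<in>supported reduced. single m c - r \<in> defining_ideal"
proof -
  define q where "q = lookup m 0 div n"
  define u where "u = m - single 0 (n * q)"
  define A B where "A = Var 0 ^ n" and "B = (\<Prod>i = 1..n. Var i)"
  have lu: "lookup u i = (if i = 0 then lookup m 0 mod n else lookup m i)" for i
    by (simp add: u_def lookup_minus lookup_single when_def q_def minus_mult_div_eq_mod)
  have m: "m = u + single 0 (n * q)"
    by (rule poly_mapping_eqI) (simp add: lookup_add lu lookup_single when_def q_def)
  have "i \<in> keys m" if "i \<in> keys u" "i \<noteq> 0" for i
    using that by (simp add: in_keys_iff lu)
  then have "keys u \<subseteq> {..<Suc n}"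
    using assms by (metis lessThan_iff subset_iff zero_less_Suc)
  then have ured: "u \<in> reduced"
    using n0 by (simp add: reduced_def lu)
  have "A ^ q = single (single 0 (n * q)) 1"
    unfolding A_def power_mult[symmetric] by (rule Var_power)
  then have sm: "single m c = single u c * A ^ q"
    by (subst m) (simp add: mult_single)
  have uP: "single u c \<in> polys (Suc n)"
    unfolding polys_eq using ured by (intro supported_single) (simp add: reduced_def)
  have AP: "A \<in> polys (Suc n)" and BP: "B \<in> polys (Suc n)"
    unfolding A_def B_def by (intro polys_power polys_prod polys_Var; simp)+
  have "single u c * B ^ q \<in> supported reduced"
  proof (rule supported_mult)
    show "single u c \<in> supported reduced"
      using ured by (intro supported_single) simp
    have "Var i \<in> supported {b. keys b \<subseteq> {1..n}}" if "i \<in> {1..n}" for i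
      unfolding Var_def using that by (intro supported_single) simp
    then have "prod Var A \<in> supported {b. keys b \<subseteq> {1..n}}" if "A \<subseteq> {1..n}" for A
      using that
    proof (induction A rule: infinite_finite_induct)
      case (insert i A)
      then have "Var i * prod Var A \<in> supported {b. keys b \<subseteq> {1..n}}"
        by (intro supported_mult[where A = "{b. keys b \<subseteq> {1..n}}" and B = "{b. keys b \<subseteq> {1..n}}"])
           (auto simp: keys_add_nat)
      then show ?case
        using insert by simp
    qed (auto intro: supported_1)
    then show "B ^ q \<in> supported {b. keys b \<subseteq> {1..n}}"
      unfolding B_def by (intro supported_power) (auto simp: keys_add_nat)
    fix a b :: "nat \<Rightarrow>\<^sub>0 nat"
    assume "a \<in> reduced" "b \<in> {b. keys b \<subseteq> {1..n}}"
    moreover from this have "lookup b 0 = 0"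
      by (auto simp: in_keys_iff)
    ultimately show "a + b \<in> reduced"
      by (auto simp: reduced_def keys_add_nat lookup_add)
  qed
  moreover have "single m c - single u c * B ^ q \<in> defining_ideal"
  proof -
    have "single m c - single u c * B ^ q = single u c * (A ^ q - B ^ q)"
      by (simp add: sm algebra_simps)
    also have "\<dots> = (single u c * (\<Sum>i<q. B ^ (q - Suc i) * A ^ i)) * eqn"
      unfolding power_diff_sumr2 by (simp add: eqn_def A_def B_def mult_ac)
    finally have "single m c - single u c * B ^ q = (single u c * (\<Sum>i<q. B ^ (q - Suc i) * A ^ i)) * eqn" .
    moreover have "single u c * (\<Sum>i<q. B ^ (q - Suc i) * A ^ i) \<in> polys (Suc n)"
      by (intro polys_mult polys_sum polys_power uP AP BP)
    ultimately show ?thesis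
      unfolding defining_ideal_eq by blast
  qed
  ultimately show ?thesis by blast
qed

lemma reduction:
  assumes "p \<in> polys (Suc n)"
  obtains r where "r \<in> supported reduced" "p - r \<in> defining_ideal"
proof -
  have "\<exists>r\<in>supported reduced. single m (lookup p m) - r \<in> defining_ideal" if "m \<in> keys p" for m
    using reduction_monomial assms that unfolding polys_eq supported_def by auto
  then obtain r where r: "\<And>m. m \<in> keys p \<Longrightarrow> r m \<in> supported reduced \<and> single m (lookup p m) - r m \<in> defining_ideal"
    by metis
  have sum: "sum f A \<in> defining_ideal" if "\<And>a. a \<in> A \<Longrightarrow> f a \<in> defining_ideal" for f and A :: "(nat \<Rightarrow>\<^sub>0 nat) set"
    using that
  proof (induction A rule: infinite_finite_induct)
    case (insert a A)
    then obtain g h where "f a = g * eqn" "sum f A = h * eqn" "g \<in> polys (Suc n)" "h \<in> polys (Suc n)"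
      unfolding defining_ideal_eq by blast
    then have "sum f (insert a A) = (g + h) * eqn" "g + h \<in> polys (Suc n)"
      using insert by (auto simp: distrib_right intro: polys_add)
    then show ?case
      unfolding defining_ideal_eq by blast
  next
    case empty
    show ?case unfolding defining_ideal_eq using polys_0[of "Suc n"] by (auto intro!: exI[of _ 0])
  next
    case (infinite A)
    show ?case unfolding defining_ideal_eq using polys_0[of "Suc n"] infinite(1) by (auto intro!: exI[of _ 0])
  qed
  show ?thesis
  proof (rule that)
    show "(\<Sum>m\<in>keys p. r m) \<in> supported reduced"
      using r by (intro supported_sum) auto
    have "p - (\<Sum>m\<in>keys p. r m) = (\<Sum>m\<in>keys p. single m (lookup p m) - r m)"
      by (subst poly_expansion[of p]) (simp add: sum_subtractf)
    also have "\<dots> \<in> defining_ideal"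
      using r by (intro sum) auto
    finally show "p - (\<Sum>m\<in>keys p. r m) \<in> defining_ideal" .
  qed
qed

text \<open>
  The pullback of a reduced polynomial is a linear combination of distinct monomials with the same
  coefficients, so it can only vanish if the reduced polynomial is zero.
\<close>
lemma defining_ideal_iff_pullback:
  assumes "p \<in> polys (Suc n)"
  shows "p \<in> defining_ideal \<longleftrightarrow> pullback p = 0"
proof
  assume "p \<in> defining_ideal"
  then show "pullback p = 0"
    using defining_ideal_vanishes parametrization_in_cone by (intro pullback_eqI assms) auto
next
  assume p0: "pullback p = 0"
  obtain r where r: "r \<in> supported reduced" "p - r \<in> defining_ideal"
    by (rule reduction[OF assms])
  have rP: "peval r (parametrization s) = 0" for s
    using defining_ideal_vanishes[OF r(2) parametrization_in_cone[of s]] peval_pullback[OF assms, of s] p0 by simp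
  have inj: "inj_on exponent_map (keys r)"
    using exponent_map_inj_on_reduced r(1) inj_on_subset unfolding supported_def by blast
  have "lookup r m = 0" if m: "m \<in> keys r" for m
  proof -
    let ?i = "the_inv_into (keys r) exponent_map"
    have "lookup r (?i (exponent_map m)) = 0"
    proof (rule monomials_linearly_independent[of "exponent_map ` keys r" "\<lambda>u. lookup r (?i u)"])
      fix s
      have "(\<Sum>u\<in>exponent_map ` keys r. lookup r (?i u) * mon_eval u s) = (\<Sum>m\<in>keys r. lookup r m * mon_eval (exponent_map m) s)"
        by (subst sum.reindex[OF inj]) (simp add: the_inv_into_f_f[OF inj])
      also have "\<dots> = peval r (parametrization s)"
        unfolding peval_alt using r(1)
        by (intro sum.cong) (auto simp: supported_def reduced_def subset_iff intro!: mon_eval_exponent_map)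
      finally show "(\<Sum>u\<in>exponent_map ` keys r. lookup r (?i u) * mon_eval u s) = 0"
        using rP by simp
    qed (use m in auto)
    then show ?thesis
      by (simp add: the_inv_into_f_f[OF inj m])
  qed
  then have "keys r = {}"
    unfolding in_keys_iff by blast
  then have "r = 0"
    by simp
  then show "p \<in> defining_ideal"
    using r(2) by simp
qed

lemma pullback_mult:
  assumes "p \<in> polys (Suc n)" "q \<in> polys (Suc n)"
  shows "pullback (p * q) = pullback p * pullback q"
  by (rule pullback_eqI) (simp_all add: polys_mult peval_pullback assms)

lemma defining_ideal_prime: "primeideal defining_ideal (mpoly_ring (Suc n))"
proof (rule primeidealI)
  interpret cring "mpoly_ring (Suc n)"
    by (rule mpoly_ring_cring)
  show "cring (mpoly_ring (Suc n))"
    by (rule mpoly_ring_cring)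
  show "ideal defining_ideal (mpoly_ring (Suc n))"
    unfolding defining_ideal_def using eqn_polys by (intro genideal_ideal) auto
  have "pullback 1 = 1"
    by (rule pullback_eqI) (auto intro: polys_1)
  then have "1 \<notin> defining_ideal"
    using defining_ideal_iff_pullback[OF polys_1] by simp
  then show "polys (Suc n) \<noteq> defining_ideal"
    using polys_1 by blast
  fix a b
  assume a: "a \<in> polys (Suc n)" and b: "b \<in> polys (Suc n)"
    and ab: "a \<otimes>\<^bsub>mpoly_ring (Suc n)\<^esub> b \<in> defining_ideal"
  have "pullback a * pullback b = 0"
    using ab defining_ideal_iff_pullback[OF polys_mult[OF a b]] pullback_mult[OF a b] by simp
  then show "a \<in> defining_ideal \<or> b \<in> defining_ideal"
    using defining_ideal_iff_pullback[OF a] defining_ideal_iff_pullback[OF b] by auto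
qed

section \<open>The projective variety\<close>

definition hypersurface :: "(nat \<Rightarrow> complex) set set" where
  "hypersurface = projective_zeros n defining_ideal"

lemma cone_scale: "v \<in> cone \<Longrightarrow> (\<lambda>i. c * v i) \<in> cone"
  by (auto simp: cone_def affine_points_def power_mult_distrib prod.distrib)

lemma line_in_hypersurface:
  assumes "v \<in> cone" "v i \<noteq> 0"
  shows "line v \<in> hypersurface"
proof -
  have "line v \<in> projective_points n"
    using assms unfolding projective_points_def line_def cone_def by blast
  moreover have "w \<in> cone" if "w \<in> line v" for w
    using that assms(1) cone_scale unfolding line_def by auto
  ultimately show ?thesis
    using defining_ideal_vanishes unfolding hypersurface_def projective_zeros_def by auto
qed

lemma hypersurface_rep:
  assumes "q \<in> hypersurface"
  shows "q = line (rep q)" "rep q \<in> cone" "\<exists>i. rep q i \<noteq> 0"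
proof -
  have q: "q \<in> projective_points n"
    using assms by (simp add: hypersurface_def projective_zeros_def)
  show 1: "q = line (rep q)" and 2: "\<exists>i. rep q i \<noteq> 0"
    using projective_pointE[OF q] by blast+
  have "eqn \<in> defining_ideal"
    unfolding defining_ideal_eq using polys_1[of "Suc n"] by (auto intro!: exI[of _ 1])
  moreover have "rep q \<in> q"
    using 1 line_self by metis
  ultimately have "peval eqn (rep q) = 0"
    using assms unfolding hypersurface_def projective_zeros_def by blast
  then show "rep q \<in> cone"
    using projective_pointE[OF q] by (auto simp: cone_def peval_eqn)
qed

lemma hypersurface_nonempty: "hypersurface \<noteq> {}"
proof -
  have "parametrization (\<lambda>_. 1) 0 \<noteq> 0"
    by (simp add: parametrization_def)
  then show ?thesis
    using line_in_hypersurface[OF parametrization_in_cone] by blast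
qed

text \<open>
  The parametrization reaches all points of the hypersurface, and also the vertex of the cone. There
  the value of a form is \<open>0\<^sup>d\<close> times its value at any point.
\<close>
lemma form_vanishes_iff:
  assumes "g \<in> forms n d"
  shows "(\<forall>q\<in>hypersurface. peval g (rep q) = 0) \<longleftrightarrow> pullback g = 0"
proof
  assume L: "\<forall>q\<in>hypersurface. peval g (rep q) = 0"
  have "peval g (parametrization s) = 0" for s
  proof (cases "\<exists>i. parametrization s i \<noteq> 0")
    case True
    then have "peval g (rep (line (parametrization s))) = 0"
      using L line_in_hypersurface[OF parametrization_in_cone] by blast
    moreover obtain c where "c \<noteq> 0" "rep (line (parametrization s)) = (\<lambda>i. c * parametrization s i)"
      by (rule rep_line)
    ultimately show ?thesis
      by (simp add: peval_form_scale[OF assms])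
  next
    case False
    obtain q where "q \<in> hypersurface"
      using hypersurface_nonempty by blast
    have "parametrization s = (\<lambda>i. 0 * rep q i)"
      using False by auto
    then have "peval g (parametrization s) = 0 ^ d * peval g (rep q)"
      by (simp only: peval_form_scale[OF assms])
    then show ?thesis
      using L \<open>q \<in> hypersurface\<close> by simp
  qed
  then show "pullback g = 0"
    by (intro pullback_eqI forms_polys[OF assms]) simp
next
  assume R: "pullback g = 0"
  show "\<forall>q\<in>hypersurface. peval g (rep q) = 0"
  proof
    fix q assume "q \<in> hypersurface"
    then obtain s where "rep q = parametrization s"
      using cone_parametrized hypersurface_rep(2) by blast
    then show "peval g (rep q) = 0"
      using peval_pullback[OF forms_polys[OF assms], of s] R by simp
  qed
qed

sublocale S: integral_system hypersurface "form_functions n"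
proof -
  interpret function_system hypersurface "form_functions n"
    by (rule function_system_forms)
  show "integral_system hypersurface (form_functions n)"
  proof
    show "hypersurface \<noteq> {}" by (rule hypersurface_nonempty)
    fix f d h e assume "f \<in> form_functions n d" "h \<in> form_functions n e"
      and fh: "\<And>z. z \<in> hypersurface \<Longrightarrow> f z * h z = 0"
    then obtain p q where p: "p \<in> forms n d" "f = (\<lambda>x. peval p (rep x))"
      and q: "q \<in> forms n e" "h = (\<lambda>x. peval q (rep x))"
      unfolding form_functions_def by blast
    have "\<forall>z\<in>hypersurface. peval (p * q) (rep z) = 0"
      using fh p q by simp
    then have "pullback (p * q) = 0"
      using form_vanishes_iff[OF forms_mult[OF p(1) q(1)]] by simp
    then have "pullback p * pullback q = 0"
      using pullback_mult p q forms_polys by metis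
    then show "(\<forall>z\<in>hypersurface. f z = 0) \<or> (\<forall>z\<in>hypersurface. h z = 0)"
      using form_vanishes_iff[OF p(1)] form_vanishes_iff[OF q(1)] p q by auto
  qed
qed

lemma Proj_eq: "Proj_variety n defining_ideal = S.X"
  by (simp add: Proj_variety_eq hypersurface_def)

text \<open>
  Vanishing on the hypersurface is equality in \<open>\<complex>[P]\<close>, so \<open>integral_dvd\<close> applies to the pullbacks, and
  the quotient that it yields is again the pullback of a form.
\<close>
lemma normal: "normal_variety S.X"
proof (rule S.normal_varietyI)
  fix d k :: nat and a b h c
  assume "a \<in> form_functions n d" "b \<in> form_functions n d" "h \<in> form_functions n d"
    and c: "\<And>i. i < k \<Longrightarrow> c i \<in> form_functions n d"
    and bnz: "\<exists>z\<in>hypersurface. b z \<noteq> 0" and hnz: "\<exists>z\<in>hypersurface. h z \<noteq> 0"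
    and eq: "\<And>z. z \<in> hypersurface \<Longrightarrow> h z * a z ^ k + (\<Sum>i<k. c i z * a z ^ i * b z ^ (k - i)) = 0"
  then obtain A B H where A: "A \<in> forms n d" "a = (\<lambda>x. peval A (rep x))"
      and B: "B \<in> forms n d" "b = (\<lambda>x. peval B (rep x))" and H: "H \<in> forms n d" "h = (\<lambda>x. peval H (rep x))"
    unfolding form_functions_def by blast
  have "\<forall>i. \<exists>C. i < k \<longrightarrow> C \<in> forms n d \<and> c i = (\<lambda>x. peval C (rep x))"
    using c unfolding form_functions_def by blast
  then obtain C where C: "\<And>i. i < k \<Longrightarrow> C i \<in> forms n d" "\<And>i. i < k \<Longrightarrow> c i = (\<lambda>x. peval (C i) (rep x))"
    by metis
  define G where "G = H * A ^ k + (\<Sum>i<k. C i * A ^ i * B ^ (k - i))"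
  have "C i * A ^ i * B ^ (k - i) \<in> forms n (d + k * d)" if "i < k" for i
  proof -
    have "C i * A ^ i * B ^ (k - i) \<in> forms n (d + i * d + (k - i) * d)"
      by (intro forms_mult forms_power A B C that)
    moreover have "d + i * d + (k - i) * d = d + k * d"
      using that by (simp flip: distrib_right)
    ultimately show ?thesis by simp
  qed
  then have "(\<Sum>i<k. C i * A ^ i * B ^ (k - i)) \<in> forms n (d + k * d)"
    by (intro forms_sum) simp
  then have G: "G \<in> forms n (d + k * d)"
    unfolding G_def by (intro forms_add forms_mult forms_power A H)
  have "\<forall>z\<in>hypersurface. peval G (rep z) = 0"
  proof
    fix z assume "z \<in> hypersurface"
    have "peval G (rep z) = h z * a z ^ k + (\<Sum>i<k. c i z * a z ^ i * b z ^ (k - i))"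
      unfolding G_def using A B C H by (simp add: peval_sum)
    then show "peval G (rep z) = 0"
      using eq[OF \<open>z \<in> hypersurface\<close>] by simp
  qed
  then have G0: "pullback G = 0"
    using form_vanishes_iff[OF G] by simp
  have eqG: "pullback H * pullback A ^ k + (\<Sum>i<k. pullback (C i) * pullback A ^ i * pullback B ^ (k - i)) = 0"
  proof -
    have polys: "A \<in> polys (Suc n)" "B \<in> polys (Suc n)"
        "H \<in> polys (Suc n)" "\<And>i. i < k \<Longrightarrow> C i \<in> polys (Suc n)"
      using A B C H forms_polys by blast+
    show ?thesis
      unfolding G0[symmetric]
      by (rule pullback_eqI[OF forms_polys[OF G], symmetric])
         (simp add: G_def peval_sum peval_pullback polys)
  qed
  have "\<exists>w\<in>supported {m\<in>exponents. mon_deg m = n * d}. pullback H * pullback A = w * pullback B"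
  proof (rule integral_dvd[OF pullback_form[OF A(1)] pullback_form[OF B(1)] pullback_form[OF H(1)] _ _ _ eqG])
    show "pullback B \<noteq> 0" "pullback H \<noteq> 0"
      using bnz hnz form_vanishes_iff[OF B(1)] form_vanishes_iff[OF H(1)] B H by auto
    show "pullback (C i) \<in> supported exponents" if "i < k" for i
      by (rule supported_mono[OF pullback_form[OF C(1)[OF that]]]) auto
  qed
  then obtain w where w: "w \<in> supported {m\<in>exponents. mon_deg m = n * d}" "pullback H * pullback A = w * pullback B"
    by blast
  obtain W where W: "W \<in> forms n d" "\<And>s. peval W (parametrization s) = peval w s"
    using form_of_exponents[OF w(1)] by blast
  have "peval W (rep z) * b z = h z * a z" if z: "z \<in> hypersurface" for z
  proof -
    obtain s where s: "rep z = parametrization s"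
      using cone_parametrized hypersurface_rep(2)[OF z] by blast
    have "peval w s * peval (pullback B) s = peval (pullback H) s * peval (pullback A) s"
      using arg_cong[OF w(2), of "\<lambda>p. peval p s"] by simp
    then show ?thesis
      using W(2)[of s] by (simp add: s A(2) B(2) H(2) peval_pullback forms_polys[OF A(1)] forms_polys[OF B(1)] forms_polys[OF H(1)])
  qed
  then show "\<exists>w\<in>form_functions n d. \<forall>z\<in>hypersurface. w z * b z = h z * a z"
    by (intro bexI[OF _ form_functionsI[OF W(1)]] ballI)
qed

end

section \<open>Homogenization\<close>

context function_system
begin

lemma prod_power_mem:
  "(\<And>i. i \<in> A \<Longrightarrow> E i \<in> F 1) \<Longrightarrow> (\<lambda>z. \<Prod>i\<in>A. E i z ^ k i) \<in> F (\<Sum>i\<in>A. k i)"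
proof (induction A rule: infinite_finite_induct)
  case (insert i A)
  have "(\<lambda>z. E i z ^ k i * (\<Prod>i\<in>A. E i z ^ k i)) \<in> F (k i * 1 + (\<Sum>i\<in>A. k i))"
    by (intro mult_mem power_mem) (use insert in auto)
  then show ?case
    using insert by simp
qed (use const_mem[of 1] in auto)

text \<open>
  Substituting the quotients \<open>E i / e\<close> into a polynomial and clearing denominators with \<open>e\<^sup>N\<close> produces
  a function of degree \<open>N\<close>.
\<close>
lemma homogenization:
  assumes e: "e \<in> F 1" and E: "\<And>i. i < k \<Longrightarrow> E i \<in> F 1"
    and p: "p \<in> polys k" "\<And>m. m \<in> keys p \<Longrightarrow> mon_deg m \<le> N"
  shows "\<exists>g\<in>F N. \<forall>z x. e z \<noteq> 0 \<longrightarrow> (\<forall>i<k. x i = E i z / e z) \<longrightarrow> g z = e z ^ N * peval p x"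
proof -
  define g where "g z = (\<Sum>m\<in>keys p. lookup p m * (e z ^ (N - mon_deg m) * mon_eval m (\<lambda>i. E i z)))" for z
  have k: "i < k" if "m \<in> keys p" "i \<in> keys m" for m i
    using p(1) that unfolding polys_eq supported_def by auto
  have "g \<in> F N"
    unfolding g_def
  proof (rule sum_mem)
    fix m assume m: "m \<in> keys p"
    have "(\<lambda>z. mon_eval m (\<lambda>i. E i z)) \<in> F (mon_deg m)"
      unfolding mon_eval_def mon_deg_def by (rule prod_power_mem) (use E k m in auto)
    then have "(\<lambda>z. lookup p m * (e z ^ (N - mon_deg m) * mon_eval m (\<lambda>i. E i z)))
        \<in> F (0 + ((N - mon_deg m) * 1 + mon_deg m))"
      by (intro mult_mem power_mem const_mem e)
    then show "(\<lambda>z. lookup p m * (e z ^ (N - mon_deg m) * mon_eval m (\<lambda>i. E i z))) \<in> F N"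
      using p(2)[OF m] by simp
  qed
  moreover have "g z = e z ^ N * peval p x" if ez: "e z \<noteq> 0" and x: "\<And>i. i < k \<Longrightarrow> x i = E i z / e z" for z x
  proof -
    have "e z ^ (N - mon_deg m) * mon_eval m (\<lambda>i. E i z) = e z ^ N * mon_eval m x" if m: "m \<in> keys p" for m
    proof -
      have "mon_eval m (\<lambda>i. E i z) = mon_eval m (\<lambda>i. e z * x i)"
        by (rule mon_eval_cong) (use k[OF m] x ez in auto)
      also have "\<dots> = e z ^ mon_deg m * mon_eval m x"
        by (rule mon_eval_scale)
      finally show ?thesis
        using p(2)[OF m] by (simp flip: power_add)
    qed
    then show ?thesis
      unfolding g_def peval_alt sum_distrib_left by (intro sum.cong) auto
  qed
  ultimately show ?thesis
    by (intro bexI[of _ g] allI impI) blast+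
qed

lemma open_subspace_Z: "open_subspace X Z = X"
  unfolding open_subspace_def using subtopology_topspace[of "zariski X"] points_eq by simp

end

lemma degree_bound: "\<exists>N. \<forall>m\<in>keys (p :: mpoly) \<union> keys q. mon_deg m \<le> N"
proof -
  have "finite (mon_deg ` (keys p \<union> keys q))"
    by simp
  then show ?thesis
    using finite_nat_set_iff_bounded_le by auto
qed

section \<open>Affine varieties as function systems\<close>

definition poly_functions :: "nat \<Rightarrow> nat \<Rightarrow> ((nat \<Rightarrow> complex) \<Rightarrow> complex) set" where
  "poly_functions k d = peval ` polys k"

lemma poly_functionsI: "p \<in> polys k \<Longrightarrow> (\<lambda>x. peval p x) \<in> poly_functions k d"
  by (simp add: poly_functions_def)

lemma function_system_polys: "function_system (poly_functions k)"
proof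
  fix c show "(\<lambda>_. c) \<in> poly_functions k 0"
    using poly_functionsI[OF polys_const[of c k]] by simp
next
  fix d show "(\<lambda>_. 0) \<in> poly_functions k d"
    using poly_functionsI[OF polys_0[of k]] by simp
next
  fix f g d assume "f \<in> poly_functions k d" "g \<in> poly_functions k d"
  then obtain p q where "p \<in> polys k" "f = peval p" "q \<in> polys k" "g = peval q"
    unfolding poly_functions_def by blast
  then show "(\<lambda>x. f x + g x) \<in> poly_functions k d"
    using poly_functionsI[OF polys_add[of p k q]] by simp
next
  fix f g d e assume "f \<in> poly_functions k d" "g \<in> poly_functions k e"
  then obtain p q where "p \<in> polys k" "f = peval p" "q \<in> polys k" "g = peval q"
    unfolding poly_functions_def by blast
  then show "(\<lambda>x. f x * g x) \<in> poly_functions k (d + e)"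
    using poly_functionsI[OF polys_mult[of p k q]] by simp
qed

lemma closed_affine_eq: "closed_affine k J = fspace_of (affine_zeros k J) (poly_functions k)"
proof -
  have "{{x\<in>affine_zeros k J. peval g x \<noteq> 0} | g. g \<in> polys k}
      = {{z\<in>affine_zeros k J. g z \<noteq> 0} | g. \<exists>d. g \<in> poly_functions k d}"
    unfolding poly_functions_def by blast
  then have T: "affine_topology k J = topology_generated_by
      {{z\<in>affine_zeros k J. g z \<noteq> 0} | g. \<exists>d. g \<in> poly_functions k d}"
    by (simp add: affine_topology_def)
  show ?thesis
    unfolding closed_affine_def fspace_of_def Let_def T[symmetric]
    by (auto simp: poly_functions_def fun_eq_iff set_eq_iff) (metis | blast)+
qed

context monomial_hypersurface
begin

abbreviation X where "X \<equiv> S.X"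

lemma coordinate_mem: "j \<le> n \<Longrightarrow> (\<lambda>q. rep q j) \<in> form_functions n 1"
  using form_functionsI[OF forms_Var[of j n]] by simp

lemma rep_zero: "q \<in> hypersurface \<Longrightarrow> j > n \<Longrightarrow> rep q j = 0"
  using hypersurface_rep(2)[of q] by (auto simp: cone_def affine_points_def)

text \<open>
  The scalar by which the chosen representative of the line through \<open>v\<close> differs from \<open>v\<close>.
\<close>
definition line_factor :: "(nat \<Rightarrow> complex) \<Rightarrow> complex" where
  "line_factor v = (SOME c. c \<noteq> 0 \<and> rep (line v) = (\<lambda>i. c * v i))"

lemma line_factor: "line_factor v \<noteq> 0" "rep (line v) = (\<lambda>i. line_factor v * v i)"
proof -
  have "\<exists>c. c \<noteq> 0 \<and> rep (line v) = (\<lambda>i. c * v i)"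
    by (rule rep_line[of v]) blast
  from someI_ex[OF this] show "line_factor v \<noteq> 0" "rep (line v) = (\<lambda>i. line_factor v * v i)"
    unfolding line_factor_def by blast+
qed

lemma form_at_line: "g \<in> forms n d \<Longrightarrow> peval g (rep (line v)) = line_factor v ^ d * peval g v"
  unfolding line_factor(2) by (rule peval_form_scale)

section \<open>Affine charts\<close>

definition chart :: "nat \<Rightarrow> (nat \<Rightarrow> complex) set set" where
  "chart j = {q\<in>hypersurface. rep q j \<noteq> 0}"

lemma open_chart: "j \<le> n \<Longrightarrow> openin (zariski X) (chart j)"
  unfolding chart_def using S.openin_basic[OF coordinate_mem] by simp

text \<open>
  The chart \<open>x\<^sub>j \<noteq> 0\<close> is realised inside the same affine space as the cone, as the slice \<open>x\<^sub>j = 1\<close>. This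
  avoids a renumbering of the remaining coordinates.
\<close>
definition chart_equations :: "nat \<Rightarrow> mpoly set" where
  "chart_equations j = {eqn, Var j - 1}"

lemma chart_zeros: "affine_zeros (Suc n) (chart_equations j) = {v\<in>cone. v j = 1}"
  by (auto simp: affine_zeros_def chart_equations_def cone_def peval_eqn)

lemma open_subspace_everything: "open_subspace (fspace_of Z (poly_functions k)) Z = fspace_of Z (poly_functions k)"
proof -
  interpret Q: function_system Z "poly_functions k" by (rule function_system_polys)
  show ?thesis by (rule Q.open_subspace_Z)
qed

lemma open_all: "openin (zariski (fspace_of Z (poly_functions k))) Z"
proof -
  interpret Q: function_system Z "poly_functions k" by (rule function_system_polys)
  show ?thesis using openin_topspace[of "zariski Q.X"] Q.points_eq by simp
qed

lemma chart_affine: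
  assumes j: "j \<le> n"
  shows "affine_variety (open_subspace X (chart j))"
proof -
  let ?Z = "{v\<in>cone. v j = 1}" and ?F = "poly_functions (Suc n)"
  let ?\<phi> = "\<lambda>q i. rep q i / rep q j"
  interpret Aff: function_system ?Z ?F
    by (rule function_system_polys)
  have ca: "closed_affine (Suc n) (chart_equations j) = Aff.X"
    by (simp add: closed_affine_eq chart_zeros)
  have pts: "points (open_subspace X (chart j)) = chart j"
    by (auto simp: open_subspace_def S.points_eq chart_def)
  have \<phi>Z: "?\<phi> q \<in> ?Z" if "q \<in> chart j" for q
    using cone_scale[OF hypersurface_rep(2), of q "1 / rep q j"] that by (auto simp: chart_def)
  have \<psi>chart: "line v \<in> chart j" if "v \<in> ?Z" for v
  proof -
    obtain c where "c \<noteq> 0" "rep (line v) = (\<lambda>i. c * v i)"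
      by (rule rep_line)
    then show ?thesis
      using line_in_hypersurface[of v j] that by (simp add: chart_def)
  qed
  have "is_morphism (open_subspace X (chart j)) (open_subspace Aff.X ?Z) ?\<phi>"
  proof (rule subspace_morphism[OF S.function_system_axioms function_system_polys open_chart[OF j] open_all])
    fix d g h assume "g \<in> ?F d" "h \<in> ?F d"
    then obtain G H where G: "G \<in> polys (Suc n)" "g = peval G"
      and H: "H \<in> polys (Suc n)" "h = peval H"
      unfolding poly_functions_def by blast
    obtain N where N: "\<And>m. m \<in> keys G \<Longrightarrow> mon_deg m \<le> N" "\<And>m. m \<in> keys H \<Longrightarrow> mon_deg m \<le> N"
      using degree_bound[of G H] by blast
    have co: "(\<lambda>q. rep q i) \<in> form_functions n 1" if "i < Suc n" for i
      using coordinate_mem[of i] that by simp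
    obtain g' where g': "g' \<in> form_functions n N"
      "\<And>z x. rep z j \<noteq> 0 \<Longrightarrow> (\<And>i. i < Suc n \<Longrightarrow> x i = rep z i / rep z j) \<Longrightarrow> g' z = rep z j ^ N * peval G x"
      using S.homogenization[where E = "\<lambda>i q. rep q i", OF coordinate_mem[OF j] co G(1) N(1)] by blast
    obtain h' where h': "h' \<in> form_functions n N"
      "\<And>z x. rep z j \<noteq> 0 \<Longrightarrow> (\<And>i. i < Suc n \<Longrightarrow> x i = rep z i / rep z j) \<Longrightarrow> h' z = rep z j ^ N * peval H x"
      using S.homogenization[where E = "\<lambda>i q. rep q i", OF coordinate_mem[OF j] co H(1) N(2)] by blast
    show "\<exists>d' e. \<exists>g'\<in>form_functions n d'. \<exists>h'\<in>form_functions n d'. \<forall>z\<in>chart j.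
        e z \<noteq> 0 \<and> g' z = e z * g (?\<phi> z) \<and> h' z = e z * h (?\<phi> z)"
      by (rule exI[of _ N], rule exI[of _ "\<lambda>z. rep z j ^ N"], rule bexI[OF _ g'(1)], rule bexI[OF _ h'(1)])
         (auto simp: chart_def G(2) H(2) intro!: g'(2) h'(2))
  qed (use \<phi>Z in blast)
  moreover have "is_morphism (open_subspace Aff.X ?Z) (open_subspace X (chart j)) line"
  proof (rule subspace_morphism[OF function_system_polys S.function_system_axioms open_all open_chart[OF j]])
    fix d g h assume "g \<in> form_functions n d" "h \<in> form_functions n d"
    then obtain G H where G: "G \<in> forms n d" "g = (\<lambda>q. peval G (rep q))"
      and H: "H \<in> forms n d" "h = (\<lambda>q. peval H (rep q))"
      unfolding form_functions_def by blast
    show "\<exists>d' e. \<exists>g'\<in>?F d'. \<exists>h'\<in>?F d'. \<forall>z\<in>?Z.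
        e z \<noteq> 0 \<and> g' z = e z * g (line z) \<and> h' z = e z * h (line z)"
      by (rule exI[of _ 0], rule exI[of _ "\<lambda>v. 1 / line_factor v ^ d"],
          rule bexI[OF _ poly_functionsI[OF forms_polys[OF G(1)]]],
          rule bexI[OF _ poly_functionsI[OF forms_polys[OF H(1)]]])
         (simp add: G(2) H(2) form_at_line[OF G(1)] form_at_line[OF H(1)] line_factor(1))
  qed (use \<psi>chart in blast)
  moreover have "line (?\<phi> q) = q" if "q \<in> chart j" for q
    using line_scale[of "1 / rep q j" "rep q"] hypersurface_rep(1)[of q] that by (auto simp: chart_def)
  moreover have "?\<phi> (line v) = v" if v: "v \<in> ?Z" for v
  proof -
    obtain c where "c \<noteq> 0" "rep (line v) = (\<lambda>i. c * v i)"
      by (rule rep_line)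
    then show ?thesis using v by auto
  qed
  ultimately have "is_isomorphism (open_subspace X (chart j)) Aff.X ?\<phi>"
    unfolding is_isomorphism_def open_subspace_everything pts Aff.points_eq by blast
  moreover have "chart_equations j \<subseteq> polys (Suc n)"
    using j unfolding chart_equations_def by (auto intro!: eqn_polys polys_diff polys_Var polys_1)
  ultimately show ?thesis
    unfolding affine_variety_def ca[symmetric] by blast
qed

lemma charts_cover: "\<Union>(chart ` {..n}) = hypersurface"
proof
  show "hypersurface \<subseteq> \<Union>(chart ` {..n})"
  proof
    fix q assume q: "q \<in> hypersurface"
    then obtain i where "rep q i \<noteq> 0"
      using hypersurface_rep(3) by blast
    then show "q \<in> \<Union>(chart ` {..n})"
      using rep_zero[OF q, of i] q by (auto simp: chart_def not_less intro!: bexI[of _ i] leI)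
  qed
qed (auto simp: chart_def)

lemma ratio_regular:
  assumes "i \<le> n" "j \<le> n"
  shows "(\<lambda>q. rep q i / rep q j) \<in> regular X (chart j)"
  by (rule S.regular_quotient[OF coordinate_mem[OF assms(1)] coordinate_mem[OF assms(2)] open_chart[OF assms(2)]])
     (auto simp: chart_def)

lemma one_regular: "(\<lambda>_. 1) \<in> regular X (points X)"
  using S.space_with_functions unfolding space_with_functions_def by (metis openin_topspace)

lemma const_regular: "openin (zariski X) U \<Longrightarrow> (\<lambda>_. c) \<in> regular X U"
  by (rule S.regular_quotient[OF S.const_mem[of c] S.const_mem[of 1]]) auto

text \<open>
  If \<open>p\<close> and \<open>q\<close> are different points and \<open>p\<^sub>i \<noteq> 0\<close>, then some minor \<open>p\<^sub>i q\<^sub>b - p\<^sub>b q\<^sub>i\<close> is not zero, while all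
  of them vanish on the diagonal. Divided by \<open>p\<^sub>i q\<^sub>j\<close>, with \<open>q\<^sub>j \<noteq> 0\<close>, the minor is a tensor of regular
  functions.
\<close>
lemma separated: "separated X"
proof -
  let ?T = "product_topology_fs X X"
  have t: "topspace ?T = hypersurface \<times> hypersurface"
    using topspace_product[OF one_regular one_regular] S.points_eq by simp
  have "openin ?T (hypersurface \<times> hypersurface - {(q, q) | q. q \<in> hypersurface})"
  proof (subst openin_subopen, rule ballI)
    fix z assume "z \<in> hypersurface \<times> hypersurface - {(q, q) | q. q \<in> hypersurface}"
    then obtain p q where z: "z = (p, q)" "p \<in> hypersurface" "q \<in> hypersurface" "p \<noteq> q"
      by auto
    obtain i j where i: "rep p i \<noteq> 0" and j: "rep q j \<noteq> 0"
      using hypersurface_rep(3) z by metis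
    have in': "i \<le> n" "j \<le> n"
      using rep_zero z i j by (meson not_less)+
    have "\<exists>b. rep p i * rep q b \<noteq> rep p b * rep q i"
    proof (rule ccontr)
      assume "\<not> ?thesis"
      then have *: "rep p i * rep q b = rep p b * rep q i" for b
        by blast
      have nz: "rep q i \<noteq> 0"
        using *[of j] i j by auto
      have "rep q = (\<lambda>b. rep q i / rep p i * rep p b)"
        using * i by (auto simp: field_simps)
      then have "line (rep q) = line (rep p)"
        using line_scale[of "rep q i / rep p i" "rep p"] nz i by simp
      then show False
        using hypersurface_rep(1) z by metis
    qed
    then obtain b where b: "rep p i * rep q b \<noteq> rep p b * rep q i"
      by blast
    then have bn: "b \<le> n"
      using rep_zero z by (metis mult_zero_left mult_zero_right not_less)
    define A where "A k = (if k = (0::nat) then (\<lambda>_. 1) else (\<lambda>q. - 1 * (rep q b / rep q i)))" for k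
    define B where "B k = (if k = (0::nat) then (\<lambda>q. rep q b / rep q j) else (\<lambda>q. rep q i / rep q j))" for k
    have A: "A k \<in> regular X (chart i)" for k
    proof -
      have "(\<lambda>q. - 1 * (rep q b / rep q i)) \<in> regular X (chart i)"
        by (rule S.regular_quotient[OF S.mult_mem[OF S.const_mem[of "-1"] coordinate_mem[OF bn]] _ open_chart[OF in'(1)]])
           (use coordinate_mem[OF in'(1)] in \<open>auto simp: chart_def\<close>)
      then show ?thesis
        using const_regular[OF open_chart[OF in'(1)], of 1] by (simp add: A_def)
    qed
    have B: "B k \<in> regular X (chart j)" for k
      using ratio_regular bn in' by (simp add: B_def)
    have G: "(\<lambda>(x, y). \<Sum>k\<in>{0,1}. A k x * B k y) \<in> tensor_functions X X (chart i) (chart j)"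
      by (rule tensor_functions_sumI) (use A B in auto)
    let ?W = "{z \<in> chart i \<times> chart j. (\<lambda>(x, y). \<Sum>k\<in>{0,1}. A k x * B k y) z \<noteq> 0}"
    have "openin ?T ?W"
      by (rule openin_product_basic[OF open_chart[OF in'(1)] open_chart[OF in'(2)] G])
    moreover have "z \<in> ?W"
      using z i j b by (auto simp: chart_def A_def B_def field_simps)
    moreover have "?W \<subseteq> hypersurface \<times> hypersurface - {(q, q) | q. q \<in> hypersurface}"
      by (auto simp: chart_def A_def B_def)
    ultimately show "\<exists>T. openin ?T T \<and> z \<in> T \<and> T \<subseteq> hypersurface \<times> hypersurface - {(q, q) | q. q \<in> hypersurface}"
      by blast
  qed
  then show ?thesis
    unfolding separated_def product_space_def fspace.simps closedin_def t S.points_eq by auto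
qed

lemma algebraic: "algebraic_variety X"
  unfolding algebraic_variety_def
proof (intro conjI exI[of _ "chart ` {..n}"])
  show "\<Union>(chart ` {..n}) = points X"
    by (simp only: charts_cover S.points_eq)
qed (use S.space_with_functions separated open_chart chart_affine in auto)

lemma irreducible: "irreducible_variety X"
  unfolding irreducible_variety_def using algebraic S.irreducible S.points_eq hypersurface_nonempty by blast

section \<open>The torus\<close>

definition torus_points :: "(nat \<Rightarrow> complex) set" where
  "torus_points = {t\<in>affine_points (n - 1). \<forall>i<n - 1. t i \<noteq> 0}"

definition tprod :: "(nat \<Rightarrow> complex) \<Rightarrow> complex" where
  "tprod t = (\<Prod>j<n - 1. t j)"

text \<open>
  The point of the cone with \<open>x\<^sub>0 = 1\<close> and \<open>x\<^sub>i = t\<^bsub>i-1\<^esub>\<close> for \<open>0 < i < n\<close>; the equation determines \<open>x\<^sub>n\<close>.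
\<close>
definition vec :: "(nat \<Rightarrow> complex) \<Rightarrow> nat \<Rightarrow> complex" where
  "vec t i = (if i = 0 then 1 else if i < n then t (i - 1) else if i = n then 1 / tprod t else 0)"

text \<open>
  The polynomials that remain after \<open>tprod t\<close> is taken out of \<open>vec t\<close> as a denominator.
\<close>
definition vec_num :: "nat \<Rightarrow> (nat \<Rightarrow> complex) \<Rightarrow> complex" where
  "vec_num i t = (if i = 0 then tprod t else if i < n then t (i - 1) * tprod t else 1)"

lemma tprod_nonzero: "t \<in> torus_points \<Longrightarrow> tprod t \<noteq> 0"
  by (auto simp: tprod_def torus_points_def)

lemma vec_eq: "t \<in> torus_points \<Longrightarrow> i < Suc n \<Longrightarrow> vec t i = vec_num i t / tprod t"
  using tprod_nonzero[of t] n0 by (auto simp: vec_def vec_num_def)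

lemma vec_nonzero: "t \<in> torus_points \<Longrightarrow> i \<le> n \<Longrightarrow> vec t i \<noteq> 0"
  using tprod_nonzero[of t] by (auto simp: vec_def torus_points_def)

lemma prod_vec: "t \<in> torus_points \<Longrightarrow> (\<Prod>i = 1..n. vec t i) = 1"
proof -
  assume t: "t \<in> torus_points"
  have "(\<Prod>i = 1..n. vec t i) = (\<Prod>j<n. vec t (Suc j))"
    by (rule prod.reindex_bij_witness[of _ Suc "\<lambda>i. i - 1"]) auto
  also have "{..<n} = insert (n - 1) {..<n - 1}"
    using n0 by auto
  also have "(\<Prod>j\<in>insert (n - 1) {..<n - 1}. vec t (Suc j)) = vec t n * (\<Prod>j<n - 1. vec t (Suc j))"
    using n0 by simp
  also have "(\<Prod>j<n - 1. vec t (Suc j)) = tprod t"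
    unfolding tprod_def by (rule prod.cong) (auto simp: vec_def)
  finally show ?thesis
    using tprod_nonzero[OF t] n0 by (simp add: vec_def)
qed

lemma vec_cone:
  assumes "t \<in> torus_points" "v \<in> cone"
  shows "(\<lambda>i. vec t i * v i) \<in> cone"
  using assms prod_vec[OF assms(1)]
  by (auto simp: cone_def affine_points_def prod.distrib vec_def[of t 0])

lemma vec_cone_1: "t \<in> torus_points \<Longrightarrow> vec t \<in> cone"
  using prod_vec[of t] n0 by (auto simp: cone_def affine_points_def vec_def[of t 0]) (simp add: vec_def)

lemma vec_mult: "vec (torus_mult s t) i = vec s i * vec t i"
  by (simp add: vec_def tprod_def torus_mult_def prod.distrib)

lemma vec_one: "i \<le> n \<Longrightarrow> vec (torus_one (n - 1)) i = 1"
  by (auto simp: vec_def tprod_def torus_one_def)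

abbreviation Aspace where "Aspace \<equiv> fspace_of (affine_points (n - 1)) (poly_functions (n - 1))"

lemma torus_eq: "torus (n - 1) = open_subspace Aspace torus_points"
  by (simp add: torus_def closed_affine_eq affine_zeros_def torus_points_def)

lemma tprod_mem: "tprod \<in> poly_functions (n - 1) d"
proof -
  have "(\<lambda>x. peval (\<Prod>j<n - 1. Var j) x) \<in> poly_functions (n - 1) d"
    by (intro poly_functionsI polys_prod polys_Var) auto
  moreover have "(\<lambda>x. peval (\<Prod>j<n - 1. Var j) x) = tprod"
    by (simp add: peval_prod tprod_def fun_eq_iff)
  ultimately show ?thesis by simp
qed

lemma vec_num_mem: "i < Suc n \<Longrightarrow> vec_num i \<in> poly_functions (n - 1) 1"
proof -
  assume i: "i < Suc n"
  interpret Q: function_system "affine_points (n - 1)" "poly_functions (n - 1)"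
    by (rule function_system_polys)
  consider "i = 0" | "i > 0" "i < n" | "i = n" "i > 0" using i by linarith
  then show ?thesis
  proof cases
    case 1
    then have "vec_num i = tprod" by (simp add: vec_num_def fun_eq_iff)
    then show ?thesis using tprod_mem by simp
  next
    case 2
    have "(\<lambda>x. peval (Var (i - 1)) x) \<in> poly_functions (n - 1) 1"
      by (intro poly_functionsI polys_Var) (use 2 in auto)
    from Q.mult_mem[OF this tprod_mem[of 0]] show ?thesis
      using 2 by (simp add: vec_num_def[abs_def])
  next
    case 3
    then have "vec_num i = (\<lambda>_. 1)" by (simp add: vec_num_def fun_eq_iff)
    then show ?thesis
      using poly_functionsI[OF polys_1, of "n - 1" 1] by simp
  qed
qed

lemma open_torus: "openin (zariski Aspace) torus_points"
proof -
  interpret Q: function_system "affine_points (n - 1)" "poly_functions (n - 1)"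
    by (rule function_system_polys)
  have "torus_points = Q.basic tprod"
    by (auto simp: torus_points_def tprod_def)
  then show ?thesis
    using Q.openin_basic[OF tprod_mem] by simp
qed

lemma torus_topspace: "points (torus (n - 1)) = torus_points"
proof -
  interpret Q: function_system "affine_points (n - 1)" "poly_functions (n - 1)"
    by (rule function_system_polys)
  show ?thesis
    unfolding torus_eq using Q.points_eq by (auto simp: open_subspace_def torus_points_def)
qed

lemma form_on_vec:
  assumes "g \<in> forms n d"
  obtains g' where "\<And>e. g' \<in> poly_functions (n - 1) e"
    "\<And>t. t \<in> torus_points \<Longrightarrow> g' t = tprod t ^ d * peval g (vec t)"
proof -
  interpret Q: function_system "affine_points (n - 1)" "poly_functions (n - 1)"
    by (rule function_system_polys)
  have deg: "mon_deg m \<le> d" if "m \<in> keys g" for m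
    using assms that by (auto simp: forms_def supported_def)
  obtain g' where g': "g' \<in> poly_functions (n - 1) d"
     "\<And>t x. tprod t \<noteq> 0 \<Longrightarrow> (\<And>i. i < Suc n \<Longrightarrow> x i = vec_num i t / tprod t) \<Longrightarrow> g' t = tprod t ^ d * peval g x"
    using Q.homogenization[where E = vec_num, OF tprod_mem vec_num_mem forms_polys[OF assms] deg] by blast
  show ?thesis
  proof (rule that)
    show "g' \<in> poly_functions (n - 1) e" for e
      using g'(1) by (simp add: poly_functions_def)
    show "g' t = tprod t ^ d * peval g (vec t)" if "t \<in> torus_points" for t
      using g'(2)[of t "vec t"] tprod_nonzero vec_eq that by blast
  qed
qed

definition embed :: "(nat \<Rightarrow> complex) \<Rightarrow> (nat \<Rightarrow> complex) set" where
  "embed t = line (vec t)"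

definition coords :: "(nat \<Rightarrow> complex) set \<Rightarrow> nat \<Rightarrow> complex" where
  "coords q i = (if i < n - 1 then rep q (Suc i) / rep q 0 else 0)"

lemma embed_chart: "t \<in> torus_points \<Longrightarrow> embed t \<in> chart 0"
proof -
  assume t: "t \<in> torus_points"
  obtain c where "c \<noteq> 0" "rep (line (vec t)) = (\<lambda>i. c * vec t i)"
    by (rule rep_line)
  then show ?thesis
    using line_in_hypersurface[OF vec_cone_1[OF t], of 0] by (simp add: embed_def chart_def vec_def)
qed

lemma coords_torus: "q \<in> chart 0 \<Longrightarrow> coords q \<in> torus_points"
proof -
  assume q: "q \<in> chart 0"
  have "rep q 0 ^ n = (\<Prod>i = 1..n. rep q i)" "rep q 0 \<noteq> 0"
    using q hypersurface_rep(2)[of q] by (auto simp: chart_def cone_def)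
  then have "rep q i \<noteq> 0" if "i \<in> {1..n}" for i
    using that by (metis finite_atLeastAtMost power_eq_0_iff prod_zero_iff)
  then show ?thesis
    using \<open>rep q 0 \<noteq> 0\<close> by (auto simp: torus_points_def affine_points_def coords_def)
qed

lemma coords_embed: "t \<in> torus_points \<Longrightarrow> coords (embed t) = t"
proof -
  assume t: "t \<in> torus_points"
  obtain c where "c \<noteq> 0" "rep (line (vec t)) = (\<lambda>i. c * vec t i)"
    by (rule rep_line)
  then show ?thesis
    using t by (auto simp: coords_def embed_def fun_eq_iff vec_def torus_points_def affine_points_def)
qed

text \<open>
  Both points have \<open>x\<^sub>0 = 1\<close> and agree up to \<open>x\<^bsub>n-1\<^esub>\<close>; as \<open>x\<^sub>1 \<cdots> x\<^sub>n = 1\<close> on both, they agree in \<open>x\<^sub>n\<close>.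
\<close>
lemma embed_coords: "q \<in> chart 0 \<Longrightarrow> embed (coords q) = q"
proof -
  assume q: "q \<in> chart 0"
  let ?v = "\<lambda>i. 1 / rep q 0 * rep q i"
  have t: "coords q \<in> torus_points"
    by (rule coords_torus[OF q])
  have v: "?v \<in> cone" "?v 0 = 1"
    using q cone_scale[OF hypersurface_rep(2), of q "1 / rep q 0"] by (auto simp: chart_def)
  have less: "vec (coords q) i = ?v i" if "i < n" for i
    using that v(2) by (cases i) (auto simp: vec_def coords_def)
  define P where "P = (\<Prod>i = 1..<n. vec (coords q) i)"
  have P': "P = (\<Prod>i = 1..<n. ?v i)"
    unfolding P_def by (rule prod.cong) (use less in auto)
  have "P \<noteq> 0"
    unfolding P_def using vec_nonzero[OF t] by auto
  have ins: "{1..n} = insert n {1..<n}"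
    using n0 by auto
  have "(\<Prod>i = 1..n. vec (coords q) i) = (\<Prod>i = 1..n. ?v i)"
    using prod_vec[OF t] v by (simp add: cone_def)
  moreover have "(\<Prod>i = 1..n. vec (coords q) i) = vec (coords q) n * P"
    unfolding ins P_def by (rule prod.insert) auto
  moreover have "(\<Prod>i = 1..n. ?v i) = ?v n * P"
    unfolding ins P' by (rule prod.insert) auto
  ultimately have "vec (coords q) n = ?v n"
    using \<open>P \<noteq> 0\<close> by (simp only: mult_cancel_right) simp
  moreover have "vec (coords q) i = ?v i" if "i > n" for i
    using that v(1) by (simp add: vec_def cone_def affine_points_def)
  ultimately have "vec (coords q) = ?v"
    using less by (metis linorder_neqE_nat)
  then show ?thesis
    unfolding embed_def using line_scale[of "1 / rep q 0" "rep q"] q hypersurface_rep(1)[of q]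
    by (simp add: chart_def)
qed

lemma embed_isomorphism: "is_isomorphism (torus (n - 1)) (open_subspace X (chart 0)) embed"
proof -
  have c0: "openin (zariski X) (chart 0)"
    by (rule open_chart) simp
  have pts: "points (open_subspace X (chart 0)) = chart 0"
    by (auto simp: open_subspace_def S.points_eq chart_def)
  have "is_morphism (open_subspace Aspace torus_points) (open_subspace X (chart 0)) embed"
  proof (rule subspace_morphism[OF function_system_polys S.function_system_axioms open_torus c0])
    fix d g h assume "g \<in> form_functions n d" "h \<in> form_functions n d"
    then obtain G H where G: "G \<in> forms n d" "g = (\<lambda>q. peval G (rep q))"
      and H: "H \<in> forms n d" "h = (\<lambda>q. peval H (rep q))"
      unfolding form_functions_def by blast
    obtain g' where g': "\<And>e. g' \<in> poly_functions (n - 1) e"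
      "\<And>t. t \<in> torus_points \<Longrightarrow> g' t = tprod t ^ d * peval G (vec t)"
      using form_on_vec[OF G(1)] by blast
    obtain h' where h': "\<And>e. h' \<in> poly_functions (n - 1) e"
      "\<And>t. t \<in> torus_points \<Longrightarrow> h' t = tprod t ^ d * peval H (vec t)"
      using form_on_vec[OF H(1)] by blast
    show "\<exists>d' e. \<exists>g'\<in>poly_functions (n - 1) d'. \<exists>h'\<in>poly_functions (n - 1) d'. \<forall>z\<in>torus_points.
        e z \<noteq> 0 \<and> g' z = e z * g (embed z) \<and> h' z = e z * h (embed z)"
      by (rule exI[of _ 0], rule exI[of _ "\<lambda>t. tprod t ^ d / line_factor (vec t) ^ d"],
          rule bexI[OF _ g'(1)], rule bexI[OF _ h'(1)])
         (simp add: G(2) H(2) embed_def form_at_line[OF G(1)] form_at_line[OF H(1)] line_factor(1)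
            g'(2) h'(2) tprod_nonzero)
  qed (rule embed_chart)
  moreover have "is_morphism (open_subspace X (chart 0)) (open_subspace Aspace torus_points) coords"
  proof (rule subspace_morphism[OF S.function_system_axioms function_system_polys c0 open_torus])
    fix d g h assume "g \<in> poly_functions (n - 1) d" "h \<in> poly_functions (n - 1) d"
    then obtain G H where G: "G \<in> polys (n - 1)" "g = peval G"
      and H: "H \<in> polys (n - 1)" "h = peval H"
      unfolding poly_functions_def by blast
    obtain N where N: "\<And>m. m \<in> keys G \<Longrightarrow> mon_deg m \<le> N" "\<And>m. m \<in> keys H \<Longrightarrow> mon_deg m \<le> N"
      using degree_bound[of G H] by blast
    have co: "(\<lambda>q. rep q (Suc i)) \<in> form_functions n 1" if "i < n - 1" for i
      using coordinate_mem[of "Suc i"] that by simp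
    have co0: "(\<lambda>q. rep q 0) \<in> form_functions n 1"
      by (rule coordinate_mem) simp
    obtain g' where g': "g' \<in> form_functions n N"
      "\<And>z x. rep z 0 \<noteq> 0 \<Longrightarrow> (\<And>i. i < n - 1 \<Longrightarrow> x i = rep z (Suc i) / rep z 0) \<Longrightarrow> g' z = rep z 0 ^ N * peval G x"
      using S.homogenization[where E = "\<lambda>i q. rep q (Suc i)", OF co0 co G(1) N(1)] by blast
    obtain h' where h': "h' \<in> form_functions n N"
      "\<And>z x. rep z 0 \<noteq> 0 \<Longrightarrow> (\<And>i. i < n - 1 \<Longrightarrow> x i = rep z (Suc i) / rep z 0) \<Longrightarrow> h' z = rep z 0 ^ N * peval H x"
      using S.homogenization[where E = "\<lambda>i q. rep q (Suc i)", OF co0 co H(1) N(2)] by blast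
    show "\<exists>d' e. \<exists>g'\<in>form_functions n d'. \<exists>h'\<in>form_functions n d'. \<forall>z\<in>chart 0.
        e z \<noteq> 0 \<and> g' z = e z * g (coords z) \<and> h' z = e z * h (coords z)"
      by (rule exI[of _ N], rule exI[of _ "\<lambda>z. rep z 0 ^ N"], rule bexI[OF _ g'(1)], rule bexI[OF _ h'(1)])
         (auto simp: chart_def G(2) H(2) coords_def intro!: g'(2) h'(2))
  qed (rule coords_torus)
  ultimately show ?thesis
    unfolding is_isomorphism_def torus_topspace pts torus_eq[symmetric]
    using coords_embed embed_coords by blast
qed

section \<open>The torus action\<close>

definition act :: "(nat \<Rightarrow> complex) \<times> (nat \<Rightarrow> complex) set \<Rightarrow> (nat \<Rightarrow> complex) set" where
  "act = (\<lambda>(t, q). line (\<lambda>i. vec t i * rep q i))"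

lemma act_line: "act (t, line v) = line (\<lambda>i. vec t i * v i)"
proof -
  obtain c where c: "c \<noteq> 0" "rep (line v) = (\<lambda>i. c * v i)"
    by (rule rep_line)
  have "act (t, line v) = line (\<lambda>i. c * (vec t i * v i))"
    by (simp add: act_def c mult_ac)
  then show ?thesis
    using line_scale[OF c(1)] by simp
qed

lemma act_hypersurface:
  assumes "t \<in> torus_points" "q \<in> hypersurface"
  shows "act (t, q) \<in> hypersurface"
proof -
  obtain i where i: "rep q i \<noteq> 0"
    using hypersurface_rep(3)[OF assms(2)] by blast
  then have "i \<le> n"
    using rep_zero[OF assms(2)] by (meson not_less)
  then show ?thesis
    unfolding act_def using line_in_hypersurface[OF vec_cone[OF assms(1) hypersurface_rep(2)[OF assms(2)]], of i] i vec_nonzero[OF assms(1)]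
    by simp
qed

text \<open>
  Each monomial evaluated at a coordinatewise product splits into a factor that depends on \<open>t\<close> and
  one that depends on \<open>q\<close>, so the monomials of \<open>g\<close> are the summands of the tensor.
\<close>
lemma form_on_act_tensor:
  assumes "g \<in> forms n d" "j \<le> n"
  shows "(\<lambda>(t, q). peval g (\<lambda>i. vec t i * rep q i) / rep q j ^ d)
     \<in> tensor_functions (torus (n - 1)) X torus_points (chart j)"
proof -
  interpret Aff: function_system "affine_points (n - 1)" "poly_functions (n - 1)"
    by (rule function_system_polys)
  have "(\<lambda>(t, q). \<Sum>m\<in>keys g. (lookup g m * mon_eval m (vec t)) * (mon_eval m (rep q) / rep q j ^ d))
    \<in> tensor_functions (torus (n - 1)) X torus_points (chart j)"
  proof (rule tensor_functions_sumI)
    fix m assume m: "m \<in> keys g"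
    have mf: "single m c \<in> forms n d" for c
      using assms(1) m unfolding forms_def supported_def by (cases "c = 0") auto
    obtain g' where g': "\<And>e. g' \<in> poly_functions (n - 1) e"
      "\<And>t. t \<in> torus_points \<Longrightarrow> g' t = tprod t ^ d * peval (single m (lookup g m)) (vec t)"
      using form_on_vec[OF mf] by blast
    have pw: "(\<lambda>t. tprod t ^ d) \<in> poly_functions (n - 1) (d * 0)"
      by (intro Aff.power_mem tprod_mem)
    have "(\<lambda>t. lookup g m * mon_eval m (vec t)) \<in> regular Aspace torus_points"
      by (rule Aff.regular_quotient[OF g'(1) pw open_torus]) (auto simp: g'(2) tprod_nonzero)
    then show "(\<lambda>t. lookup g m * mon_eval m (vec t)) \<in> regular (torus (n - 1)) torus_points"
      unfolding torus_eq open_subspace_def fspace.simps .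
    have "(\<lambda>q. peval (single m 1) (rep q)) \<in> form_functions n d"
      by (rule form_functionsI[OF mf])
    then have 1: "(\<lambda>q. mon_eval m (rep q)) \<in> form_functions n d"
      by simp
    have 2: "(\<lambda>q. rep q j ^ d) \<in> form_functions n d"
      using S.power_mem[OF coordinate_mem[OF assms(2)], of d] by simp
    show "(\<lambda>q. mon_eval m (rep q) / rep q j ^ d) \<in> regular X (chart j)"
      by (rule S.regular_quotient[OF 1 2 open_chart[OF assms(2)]]) (auto simp: chart_def)
  qed simp
  also have "(\<lambda>(t, q). \<Sum>m\<in>keys g. (lookup g m * mon_eval m (vec t)) * (mon_eval m (rep q) / rep q j ^ d))
     = (\<lambda>(t, q). peval g (\<lambda>i. vec t i * rep q i) / rep q j ^ d)"
    by (simp add: peval_alt mon_eval_times sum_divide_distrib mult_ac fun_eq_iff)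
  finally show ?thesis .
qed

lemma act_morphism: "is_morphism (product_space (torus (n - 1)) X) X act"
proof (rule product_morphism[OF _ one_regular S.function_system_axioms])
  interpret Aff: function_system "affine_points (n - 1)" "poly_functions (n - 1)"
    by (rule function_system_polys)
  show "(\<lambda>_. 1) \<in> regular (torus (n - 1)) (points (torus (n - 1)))"
    unfolding torus_topspace unfolding torus_eq open_subspace_def fspace.simps
    by (rule Aff.regular_quotient[OF Aff.const_mem[of 1] Aff.const_mem[of 1] open_torus]) auto
  show "act (t, q) \<in> hypersurface" if "t \<in> points (torus (n - 1))" "q \<in> points X" for t q
    using that unfolding torus_topspace S.points_eq by (rule act_hypersurface)
  fix d g h z assume "g \<in> form_functions n d" "h \<in> form_functions n d"
    and z: "z \<in> points (torus (n - 1)) \<times> points X"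
  then obtain G H where G: "G \<in> forms n d" "g = (\<lambda>q. peval G (rep q))"
    and H: "H \<in> forms n d" "h = (\<lambda>q. peval H (rep q))"
    unfolding form_functions_def by blast
  have "snd z \<in> hypersurface"
    using z unfolding S.points_eq mem_Times_iff by (rule conjunct2)
  then obtain j where j: "j \<le> n" "snd z \<in> chart j"
    unfolding charts_cover[symmetric] by auto
  let ?T = "\<lambda>g (t, q). peval g (\<lambda>i. vec t i * rep q i) / rep q j ^ d"
  let ?e = "\<lambda>(t, q). 1 / (line_factor (\<lambda>i. vec t i * rep q i) ^ d * rep q j ^ d)"
  have e: "?e w \<noteq> 0" "?T G w = ?e w * g (act w)" "?T H w = ?e w * h (act w)"
    if "w \<in> torus_points \<times> chart j" for w
    using that by (auto simp: chart_def act_def G(2) H(2) form_at_line[OF G(1)] form_at_line[OF H(1)] line_factor(1))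
  have "openin (zariski (torus (n - 1))) torus_points"
    using openin_topspace[of "zariski (torus (n - 1))"] by (simp only: torus_topspace)
  moreover have "z \<in> torus_points \<times> chart j"
    using z j unfolding torus_topspace mem_Times_iff by simp
  ultimately show "\<exists>U V e G H. G \<in> tensor_functions (torus (n - 1)) X U V \<and>
      H \<in> tensor_functions (torus (n - 1)) X U V \<and> openin (zariski (torus (n - 1))) U \<and>
      openin (zariski X) V \<and> z \<in> U \<times> V \<and>
      (\<forall>z\<in>U \<times> V. e z \<noteq> 0 \<and> G z = e z * g (act z) \<and> H z = e z * h (act z))"
    using form_on_act_tensor[OF G(1) j(1)] form_on_act_tensor[OF H(1) j(1)] open_chart[OF j(1)]
    by - (rule exI[of _ torus_points], rule exI[of _ "chart j"], rule exI[of _ ?e],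
          rule exI[of _ "?T G"], rule exI[of _ "?T H"], intro conjI ballI, (assumption | rule e)+)
qed

lemma action: "algebraic_torus_action (n - 1) X act"
  unfolding algebraic_torus_action_def torus_topspace S.points_eq
proof (intro conjI ballI)
  show "is_morphism (product_space (torus (n - 1)) X) X act"
    by (rule act_morphism)
  fix q assume q: "q \<in> hypersurface"
  have "(\<lambda>i. vec (torus_one (n - 1)) i * rep q i) = rep q"
  proof
    fix i show "vec (torus_one (n - 1)) i * rep q i = rep q i"
      using rep_zero[OF q, of i] vec_one[of i] by (cases "i \<le> n") auto
  qed
  then show "act (torus_one (n - 1), q) = q"
    using hypersurface_rep(1)[OF q] by (simp add: act_def)
  fix s t
  have "act (t, q) = line (\<lambda>i. vec t i * rep q i)"
    by (simp add: act_def)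
  then show "act (torus_mult s t, q) = act (s, act (t, q))"
    by (simp add: act_line) (simp add: act_def vec_mult mult_ac)
qed

lemma toric: "toric_variety X"
  unfolding toric_variety_def
proof (intro conjI exI[of _ "n - 1"] exI[of _ "chart 0"] exI[of _ embed] exI[of _ act] ballI)
  show "n - 1 > 0" using n2 by simp
  show "openin (zariski X) (chart 0)" by (rule open_chart) simp
  fix s t
  show "act (s, embed t) = embed (torus_mult s t)"
    unfolding embed_def act_line by (simp add: vec_mult[abs_def])
qed (rule irreducible embed_isomorphism action)+

end

section \<open>The hypersurface is a normal toric variety\<close>

theorem theorem3p7:
  fixes n :: nat and I :: "mpoly set"
  assumes "n \<ge> 3"
    and "I = Idl\<^bsub>mpoly_ring (Suc n)\<^esub> {Var 0 ^ n - (\<Prod>i = 1..n. Var i)}"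
  shows "primeideal I (mpoly_ring (Suc n)) \<and>
         toric_variety (Proj_variety n I) \<and>
         normal_variety (Proj_variety n I)"
proof -
  interpret monomial_hypersurface n
    by unfold_locales (use assms(1) in simp)
  have I: "I = defining_ideal"
    using assms(2) by (simp add: defining_ideal_def eqn_def)
  show ?thesis
    unfolding I Proj_eq by (intro conjI defining_ideal_prime toric normal)
qed

end
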